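(* For $n\geq 3$, the function $D_0\colon\mathcal{AC}_n\to(0,\infty)$ that records hyperbolic area is smooth and symmetric. For $\mathbf{d}=(d_0,\ldots,d_{n-1})\in\mathcal{AC}_n$: $$\frac{\partial D_0}{\partial d_i}(\mathbf{d})=\begin{cases}-\sqrt{\frac{1}{\cosh^2(d_i/2)}-\frac{1}{\cosh^2J(\mathbf{d})}} & \text{if } \mathbf{d}\in\mathcal{AC}_n-\mathcal{C}_n\text{ and } d_i=\max\{d_j\}_{j=0}^{n-1},\\ \ \ \sqrt{\frac{1}{\cosh^2(d_i/2)}-\frac{1}{\cosh^2J(\mathbf{d})}} & \text{otherwise.}\end{cases}$$
   Context: For $d>0$ and $J\geq d/2$ let $\theta(d,J)=2\sin^{-1}(\sinh(d/2)/\sinh J)\in[0,\pi]$. Define $$\mathcal{AC}_n=\Big\{(d_0,\ldots,d_{n-1})\in(0,\infty)^n : \sinh(d_i/2)<\sum_{j\neq i}\sinh(d_j/2)\text{ for each } i\Big\},$$ $$\mathcal{C}_n=\Big\{(d_0,\ldots,d_{n-1})\in(0,\infty)^n : \sum_{i=0}^{n-1}\theta(d_i,D/2)>2\pi,\ D=\max_i d_i\Big\}\subset\mathcal{AC}_n.$$ A cyclic $n$-gon in the hyperbolic plane $\mathbb{H}^2$ with side length collection $(d_0,\ldots,d_{n-1})$ is a set $\{x_0,\ldots,x_{n-1}\}$ of points on a hyperbolic metric circle (its circumcircle), cyclically ordered counterclockwise (for each $i$ with $1\le i\le n-1$, the counterclockwise half-open arc $(x_{i-1},x_i]$ contains no $x_j$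 with $j\neq i$), such that $\mathrm{dist}(x_{i-1},x_i)=d_i$ for $i>0$ and $\mathrm{dist}(x_{n-1},x_0)=d_0$. The set $\mathcal{AC}_n$ is exactly the set of side length collections of cyclic $n$-gons, and a cyclic $n$-gon is determined up to isometry of $\mathbb{H}^2$ by its side length collection. For $\mathbf{d}\in\mathcal{AC}_n$, $J(\mathbf{d})$ is the radius of the circumcircle of a cyclic $n$-gon with side length collection $\mathbf{d}$, and $D_0(\mathbf{d})$ is the hyperbolic area of its convex hull (a compact convex polygon with vertex set $\{x_0,\ldots,x_{n-1}\}$). A function is symmetric if it is invariant under all permutations of its arguments. *)

theory Defs
  imports "HOL-Analysis.Analysis"
begin

section \<open>The hyperbolic plane\<close>

text \<open>
  The hyperbolic plane (curvature -1) is the open unit disc with the Beltrami--Klein metric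
  ds^2 = |dz|^2 / (1 - |z|^2) + (z . dz)^2 / (1 - |z|^2)^2.
  Its distance function and its area density sqrt (det g) = (1 - |z|^2)^(-3/2) are written out
  below. Values outside the disc carry no meaning.
\<close>

definition hyp_plane :: "complex set" where
  "hyp_plane = ball 0 1"

definition hdist :: "complex \<Rightarrow> complex \<Rightarrow> real" where
  "hdist z w = arcosh ((1 - z \<bullet> w) / sqrt ((1 - (cmod z)\<^sup>2) * (1 - (cmod w)\<^sup>2)))"

definition hmeasure :: "complex measure" where
  "hmeasure = density lborel
     (\<lambda>z. if z \<in> hyp_plane then ennreal ((1 - (cmod z)\<^sup>2) powr (- 3 / 2)) else 0)"

definition hcircle :: "complex \<Rightarrow> real \<Rightarrow> complex set" where
  "hcircle c r = {z \<in> hyp_plane. hdist c z = r}"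

text \<open>
  The hyperbolic convex hull is the intersection of all convex sets containing the given one, where
  convexity refers to geodesic segments.
\<close>

definition hsegment :: "complex \<Rightarrow> complex \<Rightarrow> complex set" where
  "hsegment p q = {z \<in> hyp_plane. hdist p z + hdist z q = hdist p q}"

definition hconvex :: "complex set \<Rightarrow> bool" where
  "hconvex S \<longleftrightarrow> S \<subseteq> hyp_plane \<and> (\<forall>p\<in>S. \<forall>q\<in>S. hsegment p q \<subseteq> S)"

text \<open>
  The half-open counterclockwise arc (p, q] of a circle. Hyperbolic rays from c are straight in this
  model and each of them meets the circle exactly once, so the Euclidean argument of z - c is a
  counterclockwise parameter on the circle even though the model is not conformal.
\<close>

definition ccw_arc :: "complex \<Rightarrow> real \<Rightarrow> complex \<Rightarrow> complex \<Rightarrow> complex set" where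
  "ccw_arc c r p q = {z \<in> hcircle c r.
     0 < Arg2pi ((z - c) / (p - c)) \<and> Arg2pi ((z - c) / (p - c)) \<le> Arg2pi ((q - c) / (p - c))}"


section \<open>Cyclic polygons and their side lengths\<close>

text \<open>
  A tuple (d_0, ..., d_(n-1)) is a vector \<open>d :: real ^ 'n\<close> with n = \<open>CARD('n)\<close>, read through an
  enumeration \<open>e\<close> of the index type, i.e. a bijection from {0, ..., n-1} onto \<open>'n\<close>: the entry d_i
  is \<open>d $ e i\<close>. Notions that do not depend on the order of the entries do not mention \<open>e\<close>.
\<close>

definition cyclic_ngon ::
    "(nat \<Rightarrow> 'n::finite) \<Rightarrow> real ^ 'n \<Rightarrow> complex \<Rightarrow> real \<Rightarrow> (nat \<Rightarrow> complex) \<Rightarrow> bool" where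
  "cyclic_ngon e d c r x \<longleftrightarrow>
     c \<in> hyp_plane \<and> r > 0 \<and>
     (\<forall>i<CARD('n). x i \<in> hcircle c r) \<and>
     (\<forall>i\<in>{1..<CARD('n)}. \<forall>j<CARD('n). j \<noteq> i \<longrightarrow> x j \<notin> ccw_arc c r (x (i - 1)) (x i)) \<and>
     (\<forall>i\<in>{1..<CARD('n)}. hdist (x (i - 1)) (x i) = d $ e i) \<and>
     hdist (x (CARD('n) - 1)) (x 0) = d $ e 0"

definition AC_set :: "(real ^ 'n::finite) set" where
  "AC_set = {d. (\<forall>i. 0 < d $ i) \<and> (\<forall>i. sinh (d $ i / 2) < (\<Sum>j\<in>UNIV - {i}. sinh (d $ j / 2)))}"

definition theta :: "real \<Rightarrow> real \<Rightarrow> real" where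
  "theta d J = 2 * arcsin (sinh (d / 2) / sinh J)"

definition maxside :: "real ^ 'n::finite \<Rightarrow> real" where
  "maxside d = Max (range (\<lambda>i. d $ i))"

definition C_set :: "(real ^ 'n::finite) set" where
  "C_set = {d. (\<forall>i. 0 < d $ i) \<and> (\<Sum>i\<in>UNIV. theta (d $ i) (maxside d / 2)) > 2 * pi}"

text \<open>
  For \<open>d \<in> AC_set\<close> a cyclic polygon with these side lengths exists and is unique up to isometry, so the
  following descriptions are proper there.
\<close>

definition circumradius :: "(nat \<Rightarrow> 'n::finite) \<Rightarrow> real ^ 'n \<Rightarrow> real" where
  "circumradius e d = (THE r. \<exists>c x. cyclic_ngon e d c r x)"

definition D0 :: "(nat \<Rightarrow> 'n::finite) \<Rightarrow> real ^ 'n \<Rightarrow> real" where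
  "D0 e d = (THE a. \<exists>c r x. cyclic_ngon e d c r x \<and>
                a = measure hmeasure (hconvex hull (x ` {..<CARD('n)})))"


section \<open>Smooth functions\<close>

text \<open>Meant for open \<open>S\<close>; the derivatives are taken in the ambient space.\<close>

primrec Ck_on :: "nat \<Rightarrow> ('a::euclidean_space \<Rightarrow> 'b::real_normed_vector) \<Rightarrow> 'a set \<Rightarrow> bool" where
  "Ck_on 0 f S \<longleftrightarrow> continuous_on S f"
| "Ck_on (Suc k) f S \<longleftrightarrow>
     (\<exists>f'. (\<forall>x\<in>S. (f has_derivative f' x) (at x)) \<and> (\<forall>v. Ck_on k (\<lambda>x. f' x v) S))"

definition smooth_on :: "'a::euclidean_space set \<Rightarrow> ('a \<Rightarrow> 'b::real_normed_vector) \<Rightarrow> bool" where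
  "smooth_on S f \<longleftrightarrow> (\<forall>k. Ck_on k f S)"

end

theory Submission
  imports Defs
begin

text \<open>
  A cyclic polygon with sides d_i and circumradius r corresponds to half central angles a_i in (0, pi)
  with sum pi and sinh (d_i / 2) = sinh r * sin (a_i), that is, to a Euclidean polygon with sides
  2 sinh (d_i / 2) inscribed in a circle of radius sinh r. Existence and uniqueness of (r, a) are thus
  Euclidean, and the inverse function theorem makes them differentiable in d with a derivative that is
  a rational expression in sin (a_i), cos (a_i) and sinh r, so smoothness follows by bootstrapping.

  The area is computed as that of the disc minus the caps cut off by the sides, which treats polygons
  containing and not containing the centre alike. It is a sum of signed areas of isosceles triangles,
  and its differential simplifies, because the da_i sum to zero, to the sum of
  tanh r * cos (a_i) / cosh (d_i / 2) dd_i. The sign of cos (a_i) accounts for the two cases of the formula.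
\<close>

section \<open>Functions of class C^k\<close>

text \<open>Inverting the sines directly is the obstacle: \<open>arcsin\<close> is not
  differentiable at 1, and the half angle of the longest side equals pi / 2 when the centre lies on
  that side, which is the border between the two cases of the formula. The unknown is therefore the
  tuple of the radius and all half angles but one; the sides are an explicit function of it, and the
  linear system for the differentials is solved without dividing by cosines. Four facts are delicate
  when the half angle a_m of a longest side is not acute: uniqueness of the radius, nonvanishing of
  the Jacobian, the criterion for \<open>C_set\<close>, positivity of the area. They share one
  source: the other half angles add up to b = pi - a_m <= pi / 2, and a function that vanishes at 0
  and is in effect convex or concave up to b compares its value at a_j with the fraction a_j / b of
  its value at b. The Klein model makes hyperbolic convex hulls Euclidean, at the price of
  distorting angles. Hence the counterclockwise condition is moved along isometries as an order
  given by signs of cross products.\<close>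

lemma Ck_on_cong:
  assumes "open S" "\<And>x. x \<in> S \<Longrightarrow> f x = g x" "Ck_on k f S"
  shows "Ck_on k g S"
  using assms(2,3)
proof (induction k arbitrary: f g)
  case 0
  then show ?case using continuous_on_cong[of S S f g] by auto
next
  case (Suc k)
  obtain f' where f': "\<And>x. x \<in> S \<Longrightarrow> (f has_derivative f' x) (at x)" "\<And>v. Ck_on k (\<lambda>x. f' x v) S"
    using Suc.prems by auto
  have "(g has_derivative f' x) (at x)" if "x \<in> S" for x
    using has_derivative_transform_within_open[OF f'(1)[OF that] \<open>open S\<close> that] Suc.prems(1) by simp
  then show ?case using f'(2) by auto
qed

lemma Ck_on_Suc_imp: "Ck_on (Suc k) f S \<Longrightarrow> Ck_on k f S"
proof (induction k arbitrary: f)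
  case 0
  then show ?case
    by (auto intro!: continuous_at_imp_continuous_on dest: has_derivative_continuous)
next
  case (Suc k)
  then show ?case by (metis Ck_on.simps(2))
qed

lemma Ck_on_SucI:
  assumes "\<And>x. x \<in> S \<Longrightarrow> (f has_derivative f' x) (at x)" "\<And>v. Ck_on k (\<lambda>x. f' x v) S"
  shows "Ck_on (Suc k) f S"
  unfolding Ck_on.simps by (intro exI[of _ f']) (use assms in blast)

lemma Ck_on_const: "Ck_on k (\<lambda>x. c) S"
proof (induction k arbitrary: c)
  case (Suc k)
  then show ?case using has_derivative_const by (auto intro!: exI[of _ "\<lambda>x v. 0"])
qed simp

lemma Ck_on_bounded_linear:
  assumes "bounded_linear f" shows "Ck_on k f S"
proof (cases k)
  case 0
  then show ?thesis using assms by (simp add: linear_continuous_on)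
next
  case (Suc j)
  then show ?thesis using assms Ck_on_const
    by (auto intro!: exI[of _ "\<lambda>x. f"] bounded_linear_imp_has_derivative)
qed

lemma Ck_on_add:
  "Ck_on k f S \<Longrightarrow> Ck_on k g S \<Longrightarrow> Ck_on k (\<lambda>x. f x + g x) S"
proof (induction k arbitrary: f g)
  case 0
  then show ?case by (simp add: continuous_on_add)
next
  case (Suc k)
  obtain f' g' where fg: "\<And>x. x \<in> S \<Longrightarrow> (f has_derivative f' x) (at x)" "\<And>v. Ck_on k (\<lambda>x. f' x v) S"
    "\<And>x. x \<in> S \<Longrightarrow> (g has_derivative g' x) (at x)" "\<And>v. Ck_on k (\<lambda>x. g' x v) S"
    using Suc.prems unfolding Ck_on.simps by metis
  then show ?case
    by (auto intro!: exI[of _ "\<lambda>x v. f' x v + g' x v"] has_derivative_add Suc.IH)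
qed

lemma Ck_on_mult:
  fixes f g :: "'a::euclidean_space \<Rightarrow> real"
  shows "Ck_on k f S \<Longrightarrow> Ck_on k g S \<Longrightarrow> Ck_on k (\<lambda>x. f x * g x) S"
proof (induction k arbitrary: f g)
  case 0
  then show ?case by (simp add: continuous_on_mult)
next
  case (Suc k)
  obtain f' g' where fg: "\<And>x. x \<in> S \<Longrightarrow> (f has_derivative f' x) (at x)" "\<And>v. Ck_on k (\<lambda>x. f' x v) S"
    "\<And>x. x \<in> S \<Longrightarrow> (g has_derivative g' x) (at x)" "\<And>v. Ck_on k (\<lambda>x. g' x v) S"
    using Suc.prems unfolding Ck_on.simps by metis
  have "Ck_on k f S" "Ck_on k g S" using Suc.prems Ck_on_Suc_imp by blast+
  then show ?case using fg
    by (auto intro!: exI[of _ "\<lambda>x v. f x * g' x v + f' x v * g x"] has_derivative_mult Suc.IH Ck_on_add)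
qed

lemma Ck_on_sum:
  assumes "\<And>i. i \<in> I \<Longrightarrow> Ck_on k (f i) S"
  shows "Ck_on k (\<lambda>x. \<Sum>i\<in>I. f i x) S"
  using assms by (induction I rule: infinite_finite_induct) (auto intro: Ck_on_const Ck_on_add)

lemma Ck_on_prod:
  fixes f :: "'i \<Rightarrow> 'a::euclidean_space \<Rightarrow> real"
  assumes "\<And>i. i \<in> I \<Longrightarrow> Ck_on k (f i) S"
  shows "Ck_on k (\<lambda>x. \<Prod>i\<in>I. f i x) S"
  using assms by (induction I rule: infinite_finite_induct) (auto intro: Ck_on_const Ck_on_mult)

lemma Ck_on_diff:
  fixes f g :: "'a::euclidean_space \<Rightarrow> real"
  assumes "Ck_on k f S" "Ck_on k g S"
  shows "Ck_on k (\<lambda>x. f x - g x) S"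
  using Ck_on_add[OF assms(1) Ck_on_mult[OF Ck_on_const[of k "-1"] assms(2)]] by simp

text \<open>The sequence \<open>p\<close> lists all derivatives of one function at once: the chain
  rule turns \<open>p j\<close> into \<open>p (Suc j)\<close>, so the induction on \<open>k\<close>
  has to keep \<open>j\<close> arbitrary.\<close>

lemma Ck_on_compose_real:
  fixes f :: "'a::euclidean_space \<Rightarrow> real" and p :: "nat \<Rightarrow> real \<Rightarrow> real"
  assumes "\<And>j y. y \<in> T \<Longrightarrow> (p j has_real_derivative p (Suc j) y) (at y)"
    and "f ` S \<subseteq> T" and "Ck_on k f S"
  shows "Ck_on k (\<lambda>x. p j (f x)) S"
  using assms(3)
proof (induction k arbitrary: j)
  case 0
  have "continuous_on T (p j)"
    using assms(1) by (meson DERIV_continuous_on DERIV_subset subset_UNIV)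
  with 0 assms(2) show ?case by (auto intro: continuous_on_compose2)
next
  case (Suc k)
  then obtain f' where f': "\<And>x. x \<in> S \<Longrightarrow> (f has_derivative f' x) (at x)" "\<And>v. Ck_on k (\<lambda>x. f' x v) S"
    by auto
  have "((\<lambda>x. p j (f x)) has_derivative (\<lambda>v. p (Suc j) (f x) * f' x v)) (at x)" if "x \<in> S" for x
  proof -
    have "(p j has_derivative (*) (p (Suc j) (f x))) (at (f x))"
      using assms(1,2) that by (auto simp: has_field_derivative_def)
    from has_derivative_compose[OF f'(1)[OF that] this] show ?thesis by simp
  qed
  moreover have "Ck_on k (\<lambda>x. p (Suc j) (f x) * f' x v) S" for v
    by (intro Ck_on_mult f' Suc.IH Ck_on_Suc_imp[OF Suc.prems])
  ultimately show ?case by (rule Ck_on_SucI)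
qed

lemma Ck_on_sin: "Ck_on k f S \<Longrightarrow> Ck_on k (\<lambda>x. sin (f x :: real)) S"
  and Ck_on_cos: "Ck_on k f S \<Longrightarrow> Ck_on k (\<lambda>x. cos (f x :: real)) S"
proof -
  \<comment> \<open>Differentiation of the sine is a shift of its argument by pi / 2, so one
    sequence serves both claims: index 0 is the sine, index 1 the cosine.\<close>
  have *: "((\<lambda>y. sin (y + real j * (pi/2))) has_real_derivative sin (y + real (Suc j) * (pi/2))) (at y)" for j y
  proof -
    have "sin (y + real (Suc j) * (pi/2)) = sin ((y + real j * (pi/2)) + pi/2)"
      by (simp add: algebra_simps add_divide_distrib)
    also have "\<dots> = cos (y + real j * (pi/2))" by (subst sin_add) simp
    finally show ?thesis by (auto intro!: derivative_eq_intros)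
  qed
  assume "Ck_on k f S"
  from Ck_on_compose_real[of UNIV "\<lambda>j y. sin (y + real j * (pi/2))" f S k 0, OF * _ this]
    Ck_on_compose_real[of UNIV "\<lambda>j y. sin (y + real j * (pi/2))" f S k 1, OF * _ this]
  show "Ck_on k (\<lambda>x. sin (f x)) S" "Ck_on k (\<lambda>x. cos (f x)) S" by (simp_all add: sin_add)
qed

lemma Ck_on_cosh: "Ck_on k f S \<Longrightarrow> Ck_on k (\<lambda>x. cosh (f x :: real)) S"
proof -
  have *: "((\<lambda>y. if even j then cosh y else sinh y) has_real_derivative
      (if even (Suc j) then cosh y else sinh y)) (at y)" for j and y :: real
    by (cases "even j") (auto intro!: derivative_eq_intros)
  assume "Ck_on k f S"
  from Ck_on_compose_real[of UNIV "\<lambda>j y. if even j then cosh y else sinh y" f S k 0, OF * _ this]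
  show ?thesis by simp
qed

lemma Ck_on_powr:
  assumes "Ck_on k f S" "\<And>x. x \<in> S \<Longrightarrow> f x > (0::real)"
  shows "Ck_on k (\<lambda>x. f x powr a) S"
proof -
  \<comment> \<open>The product is the falling factorial left by j differentiations of the
    power.\<close>
  have *: "((\<lambda>y. (\<Prod>i<j. a - real i) * y powr (a - real j)) has_real_derivative
      (\<Prod>i<Suc j. a - real i) * y powr (a - real (Suc j))) (at y)" if "y \<in> {0<..}" for j and y :: real
    using that by (auto intro!: derivative_eq_intros simp: algebra_simps)
  from Ck_on_compose_real[of "{0<..}" "\<lambda>j y. (\<Prod>i<j. a - real i) * y powr (a - real j)" f S k 0, OF * _ assms(1)] assms(2)
  show ?thesis by auto
qed

lemma Ck_on_inverse:
  fixes f :: "'a::euclidean_space \<Rightarrow> real"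
  assumes "Ck_on k f S" "\<And>x. x \<in> S \<Longrightarrow> f x \<noteq> 0"
  shows "Ck_on k (\<lambda>x. inverse (f x)) S"
proof -
  define p where "p = (\<lambda>j y::real. (\<Prod>i<j. - (1 + real i)) * inverse y ^ Suc j)"
  have *: "(p j has_real_derivative p (Suc j) y) (at y)" if "y \<in> -{0}" for j y
  proof -
    have "((\<lambda>y. inverse y ^ Suc j) has_real_derivative (1 + real j) * (- (inverse y ^ 2) * inverse y ^ j)) (at y)"
      using that DERIV_power_Suc[OF DERIV_inverse[of y UNIV], of j] by (simp add: power2_eq_square)
    from DERIV_cmult[OF this, of "\<Prod>i<j. - (1 + real i)"] show ?thesis
      unfolding p_def by (simp add: algebra_simps power2_eq_square)
  qed
  have "Ck_on k (\<lambda>x. p 0 (f x)) S"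
    by (rule Ck_on_compose_real[where T = "-{0}" and p = p and j = 0]) (use * assms in auto)
  then show ?thesis by (simp add: p_def)
qed

lemma Ck_on_divide:
  fixes f g :: "'a::euclidean_space \<Rightarrow> real"
  assumes "Ck_on k f S" "Ck_on k g S" "\<And>x. x \<in> S \<Longrightarrow> g x \<noteq> 0"
  shows "Ck_on k (\<lambda>x. f x / g x) S"
  using Ck_on_mult[OF assms(1) Ck_on_inverse[OF assms(2,3)]] by (simp add: divide_inverse)

lemma has_derivative_vec:
  fixes f :: "'a::real_normed_vector \<Rightarrow> real ^ 'n"
  assumes "\<And>i. ((\<lambda>x. f x $ i) has_derivative (\<lambda>v. f' v $ i)) (at x within S)"
  shows "(f has_derivative f') (at x within S)"
proof (subst has_derivative_componentwise_within, intro ballI)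
  fix b :: "real ^ 'n" assume "b \<in> Basis"
  then obtain i where "b = axis i 1" by (auto simp: Basis_vec_def)
  then show "((\<lambda>x. f x \<bullet> b) has_derivative (\<lambda>v. f' v \<bullet> b)) (at x within S)"
    using assms[of i] by (simp add: inner_axis)
qed

section \<open>Polygons inscribed in a Euclidean circle\<close>

text \<open>The difference of the two sides vanishes at x = 0 and has derivative (1 - t^2) sin (t x)
  sin x. For x < pi / 2, division by the cosines gives tan (t x) < t tan x; the product form also
  covers x >= pi / 2.\<close>

lemma sin_scaled_less:
  assumes "0 < t" "t < 1" "0 < x" "x < pi"
  shows "sin (t * x) * cos x < t * cos (t * x) * sin (x::real)"
proof -
  let ?f = "\<lambda>x. t * cos (t * x) * sin x - sin (t * x) * cos x"
  have "?f 0 < ?f x"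
  proof (rule DERIV_pos_imp_increasing_open[OF assms(3)])
    fix y assume y: "0 < y" "y < x"
    have "t * y < 1 * y" using y assms by (intro mult_strict_right_mono) auto
    then have "t * y < pi" using y assms by linarith
    then have "0 < (1 - t\<^sup>2) * (sin (t * y) * sin y)"
      using y assms by (intro mult_pos_pos) (auto intro!: sin_gt_zero simp: power_less_one_iff)
    moreover have "(?f has_real_derivative (1 - t\<^sup>2) * (sin (t * y) * sin y)) (at y)"
      by (rule derivative_eq_intros refl | simp add: algebra_simps power2_eq_square)+
    ultimately show "\<exists>d. (?f has_real_derivative d) (at y) \<and> 0 < d" by blast
  qed (intro continuous_intros)
  then show ?thesis by simp
qed

text \<open>By \<open>sin_scaled_less\<close> the quotient sin (t z) / sin z has a positive
  derivative on (0, pi); the claim is its monotonicity, cross-multiplied.\<close>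

lemma sin_ratio_less:
  assumes "0 < t" "t < 1" "0 < y" "y < x" "x < pi"
  shows "sin (t * y) * sin x < sin (t * x) * sin (y::real)"
proof -
  let ?f = "\<lambda>x. sin (t * x) / sin x"
  have "?f y < ?f x"
  proof (rule DERIV_pos_imp_increasing_open[OF assms(4)])
    fix z assume z: "y < z" "z < x"
    have s: "sin z > 0" using z assms by (intro sin_gt_zero) auto
    have "(?f has_real_derivative (t * cos (t * z) * sin z - sin (t * z) * cos z) / (sin z)\<^sup>2) (at z)"
      using s by (auto intro!: derivative_eq_intros simp: power2_eq_square)
    moreover have "0 < (t * cos (t * z) * sin z - sin (t * z) * cos z) / (sin z)\<^sup>2"
      using sin_scaled_less[of t z] assms z s by (simp del: zero_less_power2)
    ultimately show "\<exists>d. (?f has_real_derivative d) (at z) \<and> 0 < d" by blast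
  next
    have "sin z \<noteq> 0" if "z \<in> {y..x}" for z
      using that assms by (metis atLeastAtMost_iff less_irrefl order_less_le_trans order_le_less_trans sin_gt_zero)
    then show "continuous_on {y..x} ?f" by (intro continuous_intros) auto
  qed
  moreover have "sin x > 0" "sin y > 0" using assms by (auto intro: sin_gt_zero)
  ultimately show ?thesis by (simp add: field_simps)
qed

text \<open>The Euclidean polygon has sides 2 s_i and central angles 2 a_i. That each a_i stays
  below pi follows from the sum as soon as there is a second index.\<close>

definition inscribed :: "('n::finite \<Rightarrow> real) \<Rightarrow> real \<Rightarrow> ('n \<Rightarrow> real) \<Rightarrow> bool" where
  "inscribed s S a \<longleftrightarrow> 0 < S \<and> (\<forall>i. 0 < a i) \<and> sum a UNIV = pi \<and> (\<forall>i. s i = S * sin (a i))"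

lemma exists_other2:
  assumes "CARD('n::finite) \<ge> 3"
  obtains k :: "'n::finite" where "k \<noteq> i" "k \<noteq> j"
proof -
  have "card {i, j} < CARD('n)" using assms card_insert_le_m1[of 2 "{j}" i] by auto
  then have "{i, j} \<noteq> UNIV" by auto
  then show ?thesis using that by auto
qed

lemma finite_argmax:
  fixes s :: "'n::finite \<Rightarrow> real"
  obtains m where "\<And>j. s j \<le> s m"
proof -
  have "Max (range s) \<in> range s" by (intro Max_in) auto
  then obtain m where "Max (range s) = s m" by (meson imageE)
  then show ?thesis using that[of m] by (metis Max_ge finite finite_imageI rangeI)
qed

lemma angle_sum2_less_pi:
  fixes a :: "'n::finite \<Rightarrow> real"
  assumes "CARD('n) \<ge> 3" "\<And>i. 0 < a i" "sum a UNIV = pi" "i \<noteq> j"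
  shows "a i + a j < pi"
proof -
  obtain k where k: "k \<noteq> i" "k \<noteq> j" using exists_other2[OF assms(1)] .
  have "sum a {i, j, k} \<le> sum a UNIV" using assms(2) by (intro sum_mono2) (auto intro: less_imp_le)
  then show ?thesis using k assms(2)[of k] assms(3,4) by auto
qed

lemma angle_less_pi:
  fixes a :: "'n::finite \<Rightarrow> real"
  assumes "CARD('n) \<ge> 3" "\<And>i. 0 < a i" "sum a UNIV = pi"
  shows "a i < pi"
proof -
  obtain j where "j \<noteq> i" using exists_other2[OF assms(1)] .
  then show ?thesis using angle_sum2_less_pi[OF assms, of i j] assms(2)[of j] by simp
qed

lemma angle_others_sum:
  fixes a :: "'n::finite \<Rightarrow> real"
  assumes "CARD('n) \<ge> 3" "\<And>i. 0 < a i" "sum a UNIV = pi"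
  shows "sum a (UNIV - {m}) = pi - a m" "j \<noteq> m \<Longrightarrow> a j < pi - a m"
proof -
  show "sum a (UNIV - {m}) = pi - a m" using assms(3) by (simp add: sum_diff1)
  show "a j < pi - a m" if "j \<noteq> m" using angle_sum2_less_pi[OF assms that] by simp
qed

text \<open>If a_i were at least pi / 2, then a_m < pi - a_i <= pi / 2 would give sin (a_m) < sin
  (a_i), against \<open>s i \<le> s m\<close>.\<close>

lemma inscribed_nonmax_acute:
  fixes a :: "'n::finite \<Rightarrow> real"
  assumes n: "CARD('n) \<ge> 3" and "inscribed s S a" "s i \<le> s m" "i \<noteq> m"
  shows "a i < pi / 2"
proof (rule ccontr)
  assume "\<not> a i < pi / 2"
  have a: "\<And>i. 0 < a i" "sum a UNIV = pi" "S > 0" "\<And>i. s i = S * sin (a i)"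
    using assms by (auto simp: inscribed_def)
  have "a m < pi - a i" "0 < a m" using angle_sum2_less_pi[OF n a(1,2) assms(4)] a(1) by auto
  then have "sin (a m) < sin (pi - a i)" using \<open>\<not> a i < pi / 2\<close> by (intro sin_monotone_2pi) auto
  then show False using a(3,4) assms(3) by simp
qed

lemma sum_scaled_fractions: "(\<Sum>i\<in>A. f i / (b::real) * c) = sum f A / b * c"
  by (simp add: sum_distrib_right sum_divide_distrib)

text \<open>Suppose S < S'. Passing to the larger circle multiplies every sine by l = S / S' < 1 and
  shrinks the acute angles, but a smaller angle keeps a larger fraction of itself. Hence the new sum
  b' of the angles other than m lies strictly between y and pi - y, where sin y = l sin (a_m), so
  that sin b' > sin y. But b' = pi - a'_m forces sin b' = l sin (a_m).\<close>

lemma inscribed_radius_le: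
  fixes a :: "'n::finite \<Rightarrow> real"
  assumes n: "CARD('n) \<ge> 3" and i1: "inscribed s S a" and i2: "inscribed s S' a'"
  shows "S' \<le> S"
proof (rule ccontr)
  assume "\<not> S' \<le> S"
  then have "S < S'" by simp
  have a: "\<And>i. 0 < a i" "sum a UNIV = pi" "S > 0" "\<And>i. s i = S * sin (a i)"
    using i1 by (auto simp: inscribed_def)
  have a': "\<And>i. 0 < a' i" "sum a' UNIV = pi" "S' > 0" "\<And>i. s i = S' * sin (a' i)"
    using i2 by (auto simp: inscribed_def)
  define l where "l = S / S'"
  have l: "0 < l" "l < 1" using a a' \<open>S < S'\<close> by (auto simp: l_def)
  have sl: "sin (a' i) = l * sin (a i)" for i
    using a(4)[of i] a'(3) a'(4)[of i] by (simp add: l_def field_simps)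
  obtain m where m: "\<And>j. s j \<le> s m" using finite_argmax[of s] by blast
  have acute: "a j < pi/2" "a' j < pi/2" if "j \<noteq> m" for j
    using inscribed_nonmax_acute[OF n i1 m that] inscribed_nonmax_acute[OF n i2 m that] by auto
  let ?M = "UNIV - {m}"
  define b where "b = sum a ?M"
  define b' where "b' = sum a' ?M"
  have b: "b = pi - a m" and b': "b' = pi - a' m"
    using angle_others_sum(1)[OF n a(1,2)] angle_others_sum(1)[OF n a'(1,2)] by (auto simp: b_def b'_def)
  obtain j0 where j0: "j0 \<in> ?M" using exists_other2[OF n, of m m] by auto
  have less: "a' j < a j" if "j \<noteq> m" for j
  proof -
    have "sin (a j) > 0" using a(1) angle_less_pi[OF n a(1,2)] by (intro sin_gt_zero) auto
    then have "sin (a' j) < sin (a j)" using sl[of j] l by auto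
    then show ?thesis using acute[OF that] a(1)[of j] a'(1)[of j]
      using sin_mono_less_eq[of "a' j" "a j"] by auto
  qed
  have "b' < b" unfolding b_def b'_def using less j0 by (intro sum_strict_mono) auto
  \<comment> \<open>Of \<open>a m\<close> and its supplement \<open>b\<close>, \<open>u\<close> is
    the one that is at most pi / 2; both have the same sine. \<open>y\<close> below is the angle
    that replaces \<open>u\<close> in the larger circle.\<close>
  define u where "u = min b (a m)"
  have u: "0 < u" "u \<le> pi/2" "u \<le> b" "b \<le> pi - u" "sin (a m) = sin u"
    using b a(1)[of m] angle_less_pi[OF n a(1,2), of m] by (auto simp: u_def min_def)
  have su: "0 < sin u" using u by (intro sin_gt_zero) auto
  define y where "y = arcsin (l * sin u)"
  have "l * sin u < 1 * sin u" using su l by (intro mult_strict_right_mono) auto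
  then have lsu: "0 < l * sin u" "l * sin u < sin u" "l * sin u < 1"
    using su l sin_le_one[of u] by (simp, linarith, linarith)
  have siny: "sin y = l * sin u" unfolding y_def using lsu by (intro sin_arcsin) auto
  have ypos: "0 < y" using lsu arcsin_less_mono[of 0 "l * sin u"] by (simp add: y_def)
  have yhalf: "y \<le> pi / 2" using lsu arcsin_ubound[of "l * sin u"] by (simp add: y_def)
  have yu: "y < u" using sin_mono_less_eq[of y u] siny lsu u ypos yhalf by auto
  have aju: "a j \<le> u" and ajb: "a j < b" if "j \<noteq> m" for j
  proof -
    show ajb: "a j < b" using angle_others_sum(2)[OF n a(1,2) that] b by simp
    have "a j \<le> a m"
    proof (cases "a m < pi/2")
      case True
      have "sin (a j) \<le> sin (a m)" using m[of j] a(3,4) by simp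
      then show ?thesis using True acute(1)[OF that] a(1)[of j] a(1)[of m] sin_mono_le_eq[of "a j" "a m"] by auto
    qed (use acute(1)[OF that] in auto)
    then show "a j \<le> u" using ajb by (simp add: u_def)
  qed
  \<comment> \<open>Since y < u, \<open>sin_ratio_less\<close> with t = a_j / u gives sin (t y) <
    sin (t u) sin y / sin u = l sin (a_j), and this is the sine of the new angle.\<close>
  have key: "a j / u * y < a' j" if "j \<noteq> m" "a j < u" for j
  proof -
    let ?t = "a j / u"
    have t: "0 < ?t" "?t < 1" using a(1)[of j] u that by auto
    have "sin (?t * y) * sin u < sin (?t * u) * sin y"
      using sin_ratio_less[OF t ypos yu] u by auto
    then have "sin (?t * y) < sin (a' j)" using siny su sl[of j] u(1) by (simp add: mult_ac)
    moreover have "?t * y \<le> 1 * y" using t ypos by (intro mult_right_mono) auto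
    moreover have "0 < ?t * y" using t ypos by (intro mult_pos_pos)
    ultimately show ?thesis
      using acute(2)[OF that(1)] a'(1)[of j] yhalf sin_mono_less_eq[of "?t * y" "a' j"] by linarith
  qed
  have key2: "a j / u * y \<le> a' j" if "j \<noteq> m" for j
  proof (cases "a j < u")
    case False
    then have "a j = u" using aju[OF that] by simp
    then have "sin (a' j) = sin y" using sl[of j] siny by simp
    then show ?thesis using \<open>a j = u\<close> u acute(2)[OF that] a'(1)[of j] ypos yhalf
        sin_mono_le_eq[of y "a' j"] by auto
  qed (use key[OF that] in auto)
  \<comment> \<open>Strictness comes from the summands when u = b, as then every a_j is below u, and
    from the factor b / u > 1 when u < b.\<close>
  have "y < b'"
  proof (cases "u = b")
    case True
    have "(\<Sum>j\<in>?M. a j / u * y) < b'"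
      unfolding b'_def using key ajb True j0 by (intro sum_strict_mono) auto
    then show ?thesis using True u by (simp only: sum_scaled_fractions b_def[symmetric]) simp
  next
    case False
    then have "u < b" using u by auto
    have "(\<Sum>j\<in>?M. a j / u * y) \<le> b'"
      unfolding b'_def using key2 by (intro sum_mono) auto
    then have "b / u * y \<le> b'" by (simp only: sum_scaled_fractions b_def[symmetric])
    moreover have "y < b / u * y" using \<open>u < b\<close> u ypos by (simp add: field_simps)
    ultimately show ?thesis by simp
  qed
  moreover have "b' < pi - y" using \<open>b' < b\<close> u yu by simp
  ultimately have "sin y < sin b'"
  proof (cases "b' \<le> pi/2")
    case True
    then show ?thesis using \<open>y < b'\<close> ypos by (intro sin_monotone_2pi) auto
  next
    case False
    then have "sin y < sin (pi - b')" using \<open>b' < pi - y\<close> ypos by (intro sin_monotone_2pi) auto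
    then show ?thesis by simp
  qed
  then show False using siny sl[of m] u(5) b' by simp
qed

text \<open>Once the radii agree, the sines determine the acute angles, which are all but the one at
  a longest side; that one is then fixed by the sum.\<close>

lemma inscribed_unique:
  fixes a :: "'n::finite \<Rightarrow> real"
  assumes n: "CARD('n) \<ge> 3" and i1: "inscribed s S a" and i2: "inscribed s S' a'"
  shows "S = S'" "a = a'"
proof -
  show S: "S = S'" using inscribed_radius_le[OF n] i1 i2 by (meson order_antisym)
  obtain m where m: "\<And>j. s j \<le> s m" using finite_argmax[of s] by blast
  have a: "\<And>i. 0 < a i" "sum a UNIV = pi" "S > 0" "\<And>i. s i = S * sin (a i)"
    using i1 by (auto simp: inscribed_def)
  have a': "\<And>i. 0 < a' i" "sum a' UNIV = pi" "\<And>i. s i = S * sin (a' i)"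
    using i2 S by (auto simp: inscribed_def)
  have eq: "a j = a' j" if "j \<noteq> m" for j
  proof -
    have "a j < pi/2" "a' j < pi/2"
      using inscribed_nonmax_acute[OF n i1 m that] inscribed_nonmax_acute[OF n i2 m that] by auto
    moreover have "sin (a j) = sin (a' j)" using a(3) a(4)[of j] a'(3)[of j] by simp
    ultimately show ?thesis using a(1)[of j] a'(1)[of j] sin_inj_pi[of "a j" "a' j"] by auto
  qed
  have "a m = a' m"
    using angle_others_sum(1)[OF n a(1,2), of m] angle_others_sum(1)[OF n a'(1,2), of m]
      sum.cong[of "UNIV - {m}" "UNIV - {m}" a a'] eq by auto
  then show "a = a'" using eq by (metis ext)
qed

lemma mult_cos_le_sin:
  assumes "0 \<le> y" "y \<le> pi"
  shows "y * cos y \<le> sin (y::real)"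
proof -
  have "(\<lambda>y. sin y - y * cos y) 0 \<le> (\<lambda>y. sin y - y * cos y) y"
  proof (rule DERIV_nonneg_imp_nondecreasing[OF assms(1)])
    fix z assume "0 \<le> z" "z \<le> y"
    then have "0 \<le> z * sin z" using assms by (intro mult_nonneg_nonneg sin_ge_zero) auto
    moreover have "((\<lambda>y. sin y - y * cos y) has_real_derivative z * sin z) (at z)"
      by (auto intro!: derivative_eq_intros)
    ultimately show "\<exists>d. ((\<lambda>y. sin y - y * cos y) has_real_derivative d) (at z) \<and> 0 \<le> d" by blast
  qed
  then show ?thesis by simp
qed

lemma le_arcsin:
  assumes "0 \<le> x" "x \<le> 1" shows "x \<le> arcsin x"
  using sin_x_le_x[of "arcsin x"] assms arcsin_le_mono[of 0 x] by auto

text \<open>The radius comes from the intermediate value theorem on S >= s_m, starting at the circle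
  that has the longest side as diameter. If the \<open>arcsin\<close> values there add up to at
  least pi, enlarging the circle lowers the sum to pi and no angle exceeds pi / 2. Otherwise the
  centre lies beyond the longest side, whose angle becomes pi - arcsin (s_m / S), and the other
  angles must add up to arcsin (s_m / S).\<close>

lemma inscribed_exists:
  fixes s :: "'n::finite \<Rightarrow> real"
  assumes pos: "\<And>i. 0 < s i" and less: "\<And>i. s i < sum s (UNIV - {i})"
  shows "\<exists>S a. inscribed s S a"
proof -
  obtain m where m: "\<And>j. s j \<le> s m" using finite_argmax[of s] by blast
  let ?M = "UNIV - {m}"
  define A where "A S = (\<Sum>j\<in>?M. arcsin (s j / S))" for S
  have split: "sum f UNIV = f m + sum f ?M" for f :: "'n \<Rightarrow> real"
    by (simp add: sum.remove)
  have sS: "0 < s j / S \<and> s j / S \<le> 1" if "s m \<le> S" for S j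
    using that pos[of j] pos[of m] m[of j] by auto
  have arc: "0 < arcsin (s j / S) \<and> sin (arcsin (s j / S)) = s j / S" if "s m \<le> S" for S j
  proof -
    have "s j / S \<le> arcsin (s j / S)" "0 < s j / S" using sS[OF that, of j] by (auto intro!: le_arcsin)
    then show ?thesis using sS[OF that, of j] by (auto intro!: sin_arcsin)
  qed
  have cont: "continuous_on {s m..} (\<lambda>S. arcsin (s j / S))" for j
  proof (intro continuous_intros)
    show "\<forall>S\<in>{s m..}. S \<noteq> 0" using pos[of m] by auto
    show "\<forall>S\<in>{s m..}. - 1 \<le> s j / S \<and> s j / S \<le> 1"
      using sS[of _ j] by (metis atLeast_iff less_imp_le neg_le_0_iff_le order_trans zero_le_one)
  qed
  have contA: "continuous_on {s m..} A"
    unfolding A_def by (intro continuous_on_sum cont)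
  show ?thesis
  proof (cases "A (s m) + arcsin (s m / s m) \<ge> pi")
    case True
    have "((\<lambda>S. arcsin (s j / S)) \<longlongrightarrow> arcsin 0) at_top" for j
      by (rule isCont_tendsto_compose[OF isCont_arcsin])
         (auto intro!: tendsto_divide_0[OF tendsto_const] filterlim_at_top_imp_at_infinity filterlim_ident)
    then have "((\<lambda>S. A S + arcsin (s m / S)) \<longlongrightarrow> (\<Sum>j\<in>?M. arcsin 0) + arcsin 0) at_top"
      unfolding A_def by (intro tendsto_add tendsto_sum)
    then have "eventually (\<lambda>S. A S + arcsin (s m / S) < pi) at_top"
      by (rule order_tendstoD(2)) simp
    then have "eventually (\<lambda>S. A S + arcsin (s m / S) < pi \<and> s m \<le> S) at_top"
      by (intro eventually_conj eventually_ge_at_top)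
    then obtain S1 where S1: "A S1 + arcsin (s m / S1) < pi" "s m \<le> S1"
      using eventually_happens'[of at_top] by (metis (lifting) trivial_limit_at_top_linorder)
    have "\<exists>S\<ge>s m. S \<le> S1 \<and> A S + arcsin (s m / S) = pi"
      by (rule IVT2') (use True S1 in \<open>auto intro!: continuous_on_subset[OF continuous_on_add[OF contA cont]]\<close>)
    then obtain S where S: "s m \<le> S" "A S + arcsin (s m / S) = pi" by auto
    have "S > 0" using S pos[of m] by simp
    have "inscribed s S (\<lambda>j. arcsin (s j / S))"
      unfolding inscribed_def using \<open>S > 0\<close> arc[OF S(1)] S(2) by (auto simp: split A_def)
    then show ?thesis by blast
  next
    case False
    then have neg: "A (s m) - arcsin (s m / s m) < 0" using pos[of m] by simp
    define w where "w = sum s ?M"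
    have w: "s m < w" "0 < w" using less[of m] pos[of m] by (auto simp: w_def)
    \<comment> \<open>The choice of \<open>y\<close> gives, for S1 = w / y, the bound s_m / S1 = y
      cos y <= sin y. So arcsin (s_m / S1) <= y = w / S1, and w / S1 is at most the sum of the other
      \<open>arcsin\<close> values. The polygon inequality s_m < w is what makes y positive.\<close>
    define y where "y = arccos (s m / w)"
    have "0 < s m / w" using w pos[of m] by (intro divide_pos_pos) auto
    then have "-1 < s m / w" by linarith
    then have cosy: "cos y = s m / w" "0 < y" "y < pi/2"
      using w pos[of m] arccos_lt_bounded[of "s m / w"] arccos_less_arccos[of 0 "s m / w"]
        divide_pos_pos[of "s m" w]
      by (auto simp: y_def simp del: zero_less_divide_iff intro!: cos_arccos)
    define S1 where "S1 = w / y"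
    have "0 < S1" using w cosy by (simp add: S1_def)
    have sm: "s m / S1 = y * cos y" using w cosy by (simp add: S1_def)
    also have "\<dots> \<le> sin y" using cosy by (intro mult_cos_le_sin) auto
    finally have le: "s m / S1 \<le> sin y" .
    have "s m / S1 \<le> 1" using le sin_le_one[of y] by linarith
    then have "s m \<le> S1" using \<open>0 < S1\<close> by simp
    have "arcsin (s m / S1) \<le> arcsin (sin y)"
      using le sS[OF \<open>s m \<le> S1\<close>, of m] by (intro arcsin_le_arcsin) auto
    then have "arcsin (s m / S1) \<le> y" using cosy by (simp add: arcsin_sin)
    also have "y = (\<Sum>j\<in>?M. s j / S1)" using w cosy
      unfolding sum_divide_distrib[symmetric] w_def[symmetric] S1_def by (simp add: field_simps)
    also have "\<dots> \<le> A S1" unfolding A_def using sS[OF \<open>s m \<le> S1\<close>]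
      by (intro sum_mono le_arcsin) (auto intro: less_imp_le)
    finally have "0 \<le> A S1 - arcsin (s m / S1)" by simp
    have "\<exists>S\<ge>s m. S \<le> S1 \<and> A S - arcsin (s m / S) = 0"
      by (rule IVT') (use neg \<open>0 \<le> A S1 - arcsin (s m / S1)\<close> \<open>s m \<le> S1\<close> in
          \<open>auto intro!: continuous_on_subset[OF continuous_on_diff[OF contA cont]]\<close>)
    then obtain S where S: "s m \<le> S" "A S - arcsin (s m / S) = 0" by auto
    have "S > 0" using S pos[of m] by simp
    define a where "a = (\<lambda>j. if j = m then pi - arcsin (s m / S) else arcsin (s j / S))"
    have "sum a ?M = A S" unfolding A_def a_def by (intro sum.cong) auto
    moreover have "0 < a j" for j
      using arc[OF S(1), of j] arcsin_ubound[of "s m / S"] sS[OF S(1), of m] pi_gt_zero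
      by (auto simp: a_def)
    ultimately have "inscribed s S a"
      unfolding inscribed_def using \<open>S > 0\<close> arc[OF S(1)] S(2) by (auto simp: split) (auto simp: a_def)
    then show ?thesis by blast
  qed
qed

text \<open>This is the denominator in \<open>d_radius\<close> and \<open>d_angle\<close>. Where no
  cosine vanishes it is the product of the cosines times the sum of the tangents. If a_m >= pi / 2,
  the other tangents are compared with tan b for b = pi - a_m through tan (a_j) < (a_j / b) tan b;
  writing products instead of quotients includes a_m = pi / 2.\<close>

lemma tangent_form_pos:
  fixes a :: "'n::finite \<Rightarrow> real"
  assumes n: "CARD('n) \<ge> 3" and a: "\<And>i. 0 < a i" "sum a UNIV = pi"
  shows "0 < (\<Sum>j\<in>UNIV. sin (a j) * (\<Prod>k\<in>UNIV - {j}. cos (a k)))"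
proof (cases "\<forall>i. a i < pi/2")
  case True
  then show ?thesis using a(1)
    by (intro sum_pos mult_pos_pos prod_pos sin_gt_zero cos_gt_zero) (use angle_less_pi[OF n a] in auto)
next
  case False
  then obtain m where m: "a m \<ge> pi/2" by (auto simp: not_less)
  let ?M = "UNIV - {m}"
  define b where "b = pi - a m"
  have b: "0 < b" "b \<le> pi/2" "sum a ?M = b" "\<And>j. j \<noteq> m \<Longrightarrow> a j < b"
    using m angle_less_pi[OF n a] angle_others_sum[OF n a] by (auto simp: b_def)
  define P where "P = (\<Prod>k\<in>?M. cos (a k))"
  have cp: "cos (a j) > 0" if "j \<noteq> m" for j
    using b(2) b(4)[OF that] a(1)[of j] by (intro cos_gt_zero) auto
  have P: "P > 0" unfolding P_def using cp by (intro prod_pos) auto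
  have sm: "sin (a m) = sin b" "cos (a m) = - cos b" by (auto simp: b_def)
  have sb: "sin b > 0" using b(1,2) by (intro sin_gt_zero) auto
  have summand: "sin (a j) * (\<Prod>k\<in>UNIV - {j}. cos (a k)) > - (a j / b * (sin b * P))" if "j \<noteq> m" for j
  proof -
    have "(\<Prod>k\<in>UNIV - {j}. cos (a k)) = cos (a m) * (\<Prod>k\<in>UNIV - {j} - {m}. cos (a k))"
      using that by (intro prod.remove) auto
    moreover have "P = cos (a j) * (\<Prod>k\<in>UNIV - {j} - {m}. cos (a k))"
      unfolding P_def using that prod.remove[of ?M j "\<lambda>k. cos (a k)"] by (simp add: Diff_insert2[symmetric] insert_commute)
    ultimately have eq: "(\<Prod>k\<in>UNIV - {j}. cos (a k)) = - (cos b * P / cos (a j))"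
      using cp[OF that] sm by simp
    have "sin (a j / b * b) * cos b < a j / b * cos (a j / b * b) * sin b"
      using b(1) b(2) b(4)[OF that] a(1)[of j] by (intro sin_scaled_less) auto
    then have "sin (a j) * cos b * (P / cos (a j)) < a j / b * cos (a j) * sin b * (P / cos (a j))"
      using b(1) P cp[OF that] by (intro mult_strict_right_mono) auto
    then have "sin (a j) * cos b * P / cos (a j) < a j / b * (sin b * P)"
      using cp[OF that] by simp
    then show ?thesis by (simp add: eq)
  qed
  obtain j0 where j0: "j0 \<noteq> m" using exists_other2[OF n] .
  have "(\<Sum>j\<in>?M. - (a j / b * (sin b * P))) < (\<Sum>j\<in>?M. sin (a j) * (\<Prod>k\<in>UNIV - {j}. cos (a k)))"
    using summand j0 by (intro sum_strict_mono) auto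
  moreover have "(\<Sum>j\<in>?M. - (a j / b * (sin b * P))) = - (sin b * P)"
    using b by (simp only: sum_negf sum_scaled_fractions) simp
  moreover have "(\<Sum>j\<in>UNIV. sin (a j) * (\<Prod>k\<in>UNIV - {j}. cos (a k))) =
     sin b * P + (\<Sum>j\<in>?M. sin (a j) * (\<Prod>k\<in>UNIV - {j}. cos (a k)))"
    by (subst sum.remove[of _ m]) (auto simp: sm P_def)
  ultimately show ?thesis by linarith
qed

text \<open>The right side refers to the circle with the longest side as diameter. If a_m < pi / 2,
  moving there divides all sines by sin (a_m) < 1 and raises every angle, so the sum exceeds pi.
  Otherwise the angles other than m have sum b <= pi / 2, each becomes at most (a_j / b) pi / 2, and
  with pi / 2 for m itself the total is at most pi.\<close>

lemma inscribed_max_acute_iff: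
  fixes a :: "'n::finite \<Rightarrow> real"
  assumes n: "CARD('n) \<ge> 3" and i: "inscribed s S a" and m: "\<And>j. s j \<le> s m"
  shows "a m < pi / 2 \<longleftrightarrow> pi < (\<Sum>i\<in>UNIV. arcsin (s i / s m))"
proof -
  have a: "\<And>i. 0 < a i" "sum a UNIV = pi" "S > 0" "\<And>i. s i = S * sin (a i)"
    using i by (auto simp: inscribed_def)
  have sp: "sin (a j) > 0" for j using a(1) angle_less_pi[OF n a(1,2)] by (intro sin_gt_zero) auto
  have eq: "s i / s m = sin (a i) / sin (a m)" for i using a(3,4) by simp
  have le: "sin (a j) \<le> sin (a m)" for j using m[of j] a(3,4) by simp
  show ?thesis
  proof (cases "a m < pi/2")
    case True
    have "sum a UNIV < (\<Sum>i\<in>UNIV. arcsin (s i / s m))"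
    proof (intro sum_strict_mono)
      fix j
      have "sin (a m) < 1" using sin_monotone_2pi[of "a m" "pi/2"] True a(1)[of m] by auto
      then have "sin (a j) < sin (a j) / sin (a m)" using sp[of j] sp[of m] by (simp add: field_simps)
      moreover have "sin (a j) / sin (a m) \<le> 1" using le[of j] sp[of m] by simp
      ultimately have "arcsin (sin (a j)) < arcsin (sin (a j) / sin (a m))"
        using sp[of j] by (intro arcsin_less_arcsin) auto
      moreover have "a j < pi/2" using True inscribed_nonmax_acute[OF n i m[of j]] by (cases "j = m") auto
      ultimately show "a j < arcsin (s j / s m)" using a(1)[of j] eq[of j] by (simp add: arcsin_sin)
    qed auto
    then show ?thesis using True a by simp
  next
    case False
    let ?M = "UNIV - {m}"
    define b where "b = pi - a m"
    have b: "0 < b" "b \<le> pi/2" "sum a ?M = b" "\<And>j. j \<noteq> m \<Longrightarrow> a j < b" "sin (a m) = sin b"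
      using False angle_less_pi[OF n a(1,2)] angle_others_sum[OF n a(1,2)] by (auto simp: b_def)
    have "(\<Sum>j\<in>?M. arcsin (s j / s m)) \<le> (\<Sum>j\<in>?M. a j / b * (pi/2))"
    proof (intro sum_mono)
      fix j assume "j \<in> ?M"
      then have j: "0 < a j / b" "a j / b < 1" using a(1) b by auto
      have "sin (a j / b * b) * sin (pi/2) \<le> sin (a j / b * (pi/2)) * sin b"
      proof (cases "b = pi/2")
        case True
        show ?thesis unfolding True by simp
      qed (use sin_ratio_less[OF j b(1), of "pi/2"] b(2) in auto)
      then have "sin (a j) / sin b \<le> sin (a j / b * (pi/2))" using b sp[of m] by (simp add: field_simps)
      then have "arcsin (sin (a j) / sin b) \<le> arcsin (sin (a j / b * (pi/2)))"
        using sp[of j] sp[of m] b(5) by (intro arcsin_le_arcsin) (auto intro: order_trans[of _ 0])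
      moreover have "0 \<le> a j / b * (pi/2)" using j by (intro mult_nonneg_nonneg) auto
      then have "-(pi/2) \<le> a j / b * (pi/2)" using pi_gt_zero by linarith
      moreover have "a j / b * (pi/2) \<le> 1 * (pi/2)" using j by (intro mult_right_mono) auto
      ultimately show "arcsin (s j / s m) \<le> a j / b * (pi/2)"
        by (simp add: eq b(5) arcsin_sin del: times_divide_eq_left)
    qed
    also have "\<dots> = pi/2" using b by (simp only: sum_scaled_fractions) simp
    finally show ?thesis using False eq[of m] sp[of m] by (simp add: sum.remove[of UNIV m])
  qed
qed

text \<open>The angle whose tangent is \<open>c tan a\<close> is \<open>a + tri_area c a / 2\<close>, continued across \<open>pi / 2\<close>.\<close>

definition tri_area :: "real \<Rightarrow> real \<Rightarrow> real" where
  "tri_area c a = 2 * arctan ((c - 1) * sin a * cos a / ((cos a)\<^sup>2 + c * (sin a)\<^sup>2))"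

lemma tri_area_denominator_pos:
  fixes a :: real
  assumes "0 < c" shows "0 < (cos a)\<^sup>2 + c * (sin a)\<^sup>2"
  using assms sin_cos_squared_add2[of a] by (cases "sin a = 0") (auto simp: add_nonneg_pos)

text \<open>An obtuse half angle belongs to a side that separates the centre from the polygon; its
  triangle counts negatively.\<close>

lemma tri_area_pi_minus: "tri_area c (pi - a) = - tri_area c a"
  by (simp add: tri_area_def arctan_minus)

lemma has_derivative_tri_area:
  assumes "0 < c" "(c' has_derivative c'') (at x)" "(a' has_derivative a'') (at x)" "c' x = c" "a' x = a"
  shows "((\<lambda>x. tri_area (c' x) (a' x)) has_derivative
    (\<lambda>v. 2 * (c / ((cos a)\<^sup>2 + c\<^sup>2 * (sin a)\<^sup>2) - 1) * a'' v + 2 * sin a * cos a / ((cos a)\<^sup>2 + c\<^sup>2 * (sin a)\<^sup>2) * c'' v)) (at x)"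
proof -
  define D where "D = (cos a)\<^sup>2 + c * (sin a)\<^sup>2"
  define N where "N = (c - 1) * sin a * cos a"
  define E where "E = (cos a)\<^sup>2 + c\<^sup>2 * (sin a)\<^sup>2"
  have D: "0 < D" and E: "0 < E" using tri_area_denominator_pos[of _ a] assms(1) by (auto simp: D_def E_def)
  have sq: "(sin a)\<^sup>2 = 1 - (cos a)\<^sup>2" by (simp add: sin_squared_eq)
  \<comment> \<open>This identity is why the derivative of \<open>arctan\<close> simplifies: D^2
    times 1 + (N / D)^2 is \<open>E\<close>. When c is the cosh of the radius, \<open>E\<close> is
    the squared cosh of half the side.\<close>
  have DNE: "D\<^sup>2 + N\<^sup>2 = E"
    unfolding D_def N_def E_def power_mult_distrib sq by (simp add: power2_eq_square algebra_simps)
  have "((\<lambda>x. (c' x - 1) * sin (a' x) * cos (a' x)) has_derivative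
      (\<lambda>v. c'' v * sin a * cos a + (c - 1) * ((cos a)\<^sup>2 - (sin a)\<^sup>2) * a'' v)) (at x)"
    by (rule has_derivative_eq_rhs, (rule derivative_intros assms)+)
       (auto simp: assms(4,5) algebra_simps power2_eq_square)
  moreover have "((\<lambda>x. (cos (a' x))\<^sup>2 + c' x * (sin (a' x))\<^sup>2) has_derivative
      (\<lambda>v. c'' v * (sin a)\<^sup>2 + 2 * (c - 1) * sin a * cos a * a'' v)) (at x)"
    by (rule has_derivative_eq_rhs, (rule derivative_intros assms)+)
       (auto simp: assms(4,5) algebra_simps power2_eq_square)
  ultimately have "((\<lambda>x. (c' x - 1) * sin (a' x) * cos (a' x) / ((cos (a' x))\<^sup>2 + c' x * (sin (a' x))\<^sup>2)) has_derivative
      (\<lambda>v. ((c'' v * sin a * cos a + (c - 1) * ((cos a)\<^sup>2 - (sin a)\<^sup>2) * a'' v) * D -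
        N * (c'' v * (sin a)\<^sup>2 + 2 * (c - 1) * sin a * cos a * a'' v)) / (D * D))) (at x)"
    unfolding D_def N_def assms(4,5)[symmetric]
    by (rule has_derivative_divide') (use D in \<open>simp add: D_def assms(4,5)\<close>)
  then have "((\<lambda>x. tri_area (c' x) (a' x)) has_derivative
    (\<lambda>v. 2 * (inverse (1 + (N / D)\<^sup>2) *
      (((c'' v * sin a * cos a + (c - 1) * ((cos a)\<^sup>2 - (sin a)\<^sup>2) * a'' v) * D -
        N * (c'' v * (sin a)\<^sup>2 + 2 * (c - 1) * sin a * cos a * a'' v)) / D\<^sup>2)))) (at x)"
    unfolding tri_area_def
    by (rule has_derivative_eq_rhs[OF has_derivative_mult_right[OF has_derivative_arctan]])
       (simp add: assms(4,5) N_def D_def power2_eq_square mult.commute[of _ "inverse _"])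
  moreover have "2 * (inverse (1 + (N / D)\<^sup>2) *
      (((c'' v * sin a * cos a + (c - 1) * ((cos a)\<^sup>2 - (sin a)\<^sup>2) * a'' v) * D -
        N * (c'' v * (sin a)\<^sup>2 + 2 * (c - 1) * sin a * cos a * a'' v)) / D\<^sup>2))
     = 2 * (c / E - 1) * a'' v + 2 * sin a * cos a / E * c'' v" for v
  proof -
    have e1: "inverse (1 + (N / D)\<^sup>2) = D\<^sup>2 / E" using D DNE by (simp add: field_simps)
    have "N * (2 * (c - 1) * sin a * cos a) = 2 * (c-1)\<^sup>2 * (sin a)\<^sup>2 * (cos a)\<^sup>2"
      by (simp add: N_def power2_eq_square algebra_simps)
    then have f1: "((cos a)\<^sup>2 - (sin a)\<^sup>2) * D * (c - 1) - N * (2 * (c - 1) * sin a * cos a) = c - E"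
      unfolding D_def E_def sq by (simp add: power2_eq_square algebra_simps)
    have "sin a * cos a * D - N * (sin a)\<^sup>2 = sin a * cos a * (D - (c - 1) * (sin a)\<^sup>2)"
      by (simp add: N_def algebra_simps)
    also have "D - (c - 1) * (sin a)\<^sup>2 = 1" by (simp add: D_def algebra_simps)
    finally have f2: "sin a * cos a * D - N * (sin a)\<^sup>2 = sin a * cos a" by simp
    have "(c'' v * sin a * cos a + (c - 1) * ((cos a)\<^sup>2 - (sin a)\<^sup>2) * a'' v) * D -
        N * (c'' v * (sin a)\<^sup>2 + 2 * (c - 1) * sin a * cos a * a'' v) =
      a'' v * (((cos a)\<^sup>2 - (sin a)\<^sup>2) * D * (c - 1) - N * (2 * (c - 1) * sin a * cos a)) +
      c'' v * (sin a * cos a * D - N * (sin a)\<^sup>2)"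
      by (simp add: algebra_simps)
    then have e2: "(c'' v * sin a * cos a + (c - 1) * ((cos a)\<^sup>2 - (sin a)\<^sup>2) * a'' v) * D -
        N * (c'' v * (sin a)\<^sup>2 + 2 * (c - 1) * sin a * cos a * a'' v) =
      a'' v * (c - E) + c'' v * (sin a * cos a)" by (simp only: f1 f2)
    show ?thesis unfolding e1 e2 using D E by (simp add: field_simps)
  qed
  ultimately show ?thesis by (simp add: E_def)
qed

lemma tri_area_has_real_derivative:
  assumes "0 < c"
  shows "(tri_area c has_real_derivative 2 * (c / ((cos a)\<^sup>2 + c\<^sup>2 * (sin a)\<^sup>2) - 1)) (at a)"
  using has_derivative_tri_area[OF assms has_derivative_const has_derivative_ident refl refl, of a]
  by (simp add: has_field_derivative_def)

text \<open>On [0, pi / 2] the function \<open>tri_area c\<close> is concave, and it vanishes at 0: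
  its derivative decreases because the denominator 1 + (c^2 - 1) sin^2 grows. The mean value theorem
  is applied on both sides of x.\<close>

lemma tri_area_superlinear:
  assumes "1 < c" "0 < x" "x < b" "b \<le> pi / 2"
  shows "x / b * tri_area c b < tri_area c x"
proof -
  define d where "d a = 2 * (c / ((cos a)\<^sup>2 + c\<^sup>2 * (sin a)\<^sup>2) - 1)" for a
  have der: "(tri_area c has_real_derivative d a) (at a)" for a
    using tri_area_has_real_derivative assms(1) unfolding d_def by simp
  obtain u where u: "0 < u" "u < x" "tri_area c x - tri_area c 0 = (x - 0) * d u"
    using MVT2[OF assms(2) der] by blast
  obtain v where v: "x < v" "v < b" "tri_area c b - tri_area c x = (b - x) * d v"
    using MVT2[OF assms(3) der] by blast
  have sq: "(cos a)\<^sup>2 + c\<^sup>2 * (sin a)\<^sup>2 = 1 + (c\<^sup>2 - 1) * (sin a)\<^sup>2" for a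
    by (simp add: cos_squared_eq algebra_simps)
  have "sin u < sin v" "0 < sin u" using u v assms by (auto intro!: sin_monotone_2pi sin_gt_zero)
  then have "(sin u)\<^sup>2 < (sin v)\<^sup>2" by (intro power_strict_mono) auto
  moreover have "1 < c\<^sup>2" using assms by (simp add: one_less_power)
  ultimately have "1 + (c\<^sup>2 - 1) * (sin u)\<^sup>2 < 1 + (c\<^sup>2 - 1) * (sin v)\<^sup>2" "0 < 1 + (c\<^sup>2 - 1) * (sin u)\<^sup>2"
    "0 < 1 + (c\<^sup>2 - 1) * (sin v)\<^sup>2"
    by (auto intro!: add_pos_nonneg mult_nonneg_nonneg)
  then have "d v < d u" unfolding d_def sq using assms by (auto intro!: divide_strict_left_mono mult_pos_pos)
  then have "(b - x) * d v < (b - x) * d u" using assms by simp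
  then have "tri_area c b < b * d u" using u v by (simp add: tri_area_def algebra_simps)
  then have "x / b * tri_area c b < x / b * (b * d u)" using assms by (intro mult_strict_left_mono) auto
  then show ?thesis using u assms by (simp add: tri_area_def)
qed

text \<open>At most one summand is negative, that of an angle a_m > pi / 2, and it is minus the
  value at b = pi - a_m. By \<open>tri_area_superlinear\<close> the remaining angles, which add up
  to b, outweigh it.\<close>

lemma sum_tri_area_pos:
  fixes a :: "'n::finite \<Rightarrow> real"
  assumes n: "CARD('n) \<ge> 3" and a: "\<And>i. 0 < a i" "sum a UNIV = pi" and c: "1 < c"
  shows "0 < (\<Sum>i\<in>UNIV. tri_area c (a i))"
proof (cases "\<forall>i. a i \<le> pi/2")
  case True
  have nn: "0 \<le> tri_area c (a i)" for i
    unfolding tri_area_def using True[rule_format, of i] a(1)[of i] c tri_area_denominator_pos[of c "a i"]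
    by (auto intro!: divide_nonneg_pos mult_nonneg_nonneg sin_ge_zero cos_ge_zero)
  obtain j k :: 'n where "j \<noteq> k" using exists_other2[OF n] by metis
  then have "a j < pi/2 \<or> a k < pi/2" using angle_sum2_less_pi[OF n a] by fastforce
  then obtain i where i: "a i < pi/2" by auto
  have "0 < tri_area c (a i)"
    unfolding tri_area_def using i a(1)[of i] c tri_area_denominator_pos[of c "a i"]
    by (auto intro!: divide_pos_pos mult_pos_pos sin_gt_zero cos_gt_zero)
  then show ?thesis using nn by (intro sum_pos2[of _ i]) auto
next
  case False
  then obtain m where m: "a m > pi/2" by (auto simp: not_le)
  let ?M = "UNIV - {m}"
  define b where "b = pi - a m"
  have b: "0 < b" "b \<le> pi/2" "sum a ?M = b" "\<And>j. j \<noteq> m \<Longrightarrow> a j < b"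
    using m angle_less_pi[OF n a] angle_others_sum[OF n a] by (auto simp: b_def)
  obtain j0 where j0: "j0 \<noteq> m" using exists_other2[OF n] .
  have "(\<Sum>j\<in>?M. a j / b * tri_area c b) < (\<Sum>j\<in>?M. tri_area c (a j))"
    using b a(1) j0 c by (intro sum_strict_mono tri_area_superlinear) auto
  then have "tri_area c b < (\<Sum>j\<in>?M. tri_area c (a j))" using b by (simp only: sum_scaled_fractions) simp
  moreover have "tri_area c (a m) = - tri_area c b" unfolding b_def by (simp add: tri_area_pi_minus)
  ultimately show ?thesis by (simp add: sum.remove[of UNIV m])
qed

section \<open>Dependence of radius and angles on the sides\<close>

definition sine_sides :: "(real ^ 'n::finite) set" where
  "sine_sides = {s. (\<forall>i. 0 < s $ i) \<and> (\<forall>i. s $ i < (\<Sum>j\<in>UNIV - {i}. s $ j))}"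

definition circ_R :: "real ^ 'n::finite \<Rightarrow> real" where
  "circ_R s = (THE S. \<exists>a. inscribed (($) s) S a)"

definition circ_a :: "real ^ 'n::finite \<Rightarrow> 'n \<Rightarrow> real" where
  "circ_a s = (THE a. \<exists>S. inscribed (($) s) S a)"

lemma circ_eqI:
  fixes s :: "real ^ 'n::finite"
  assumes "CARD('n) \<ge> 3" "inscribed (($) s) S a"
  shows "circ_R s = S" "circ_a s = a"
  using inscribed_unique[OF assms] assms(2) unfolding circ_R_def circ_a_def by blast+

lemma inscribed_circ:
  fixes s :: "real ^ 'n::finite"
  assumes "CARD('n) \<ge> 3" "s \<in> sine_sides"
  shows "inscribed (($) s) (circ_R s) (circ_a s)"
proof -
  obtain S a where "inscribed (($) s) S a"
    using inscribed_exists[of "($) s"] assms(2) unfolding sine_sides_def by auto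
  then show ?thesis using circ_eqI[OF assms(1)] by metis
qed

text \<open>The solution of \<open>\<sigma> $ i = sin (a i) dS + S cos (a i) da i\<close> with the \<open>da i\<close> summing to zero, multiplied
  through by the cosines so that it stays valid when one of them vanishes.\<close>

definition d_radius :: "real \<Rightarrow> ('n::finite \<Rightarrow> real) \<Rightarrow> real ^ 'n \<Rightarrow> real" where
  "d_radius S a \<sigma> = (\<Sum>j\<in>UNIV. \<sigma> $ j * (\<Prod>k\<in>UNIV - {j}. cos (a k))) /
     (\<Sum>j\<in>UNIV. sin (a j) * (\<Prod>k\<in>UNIV - {j}. cos (a k)))"

definition d_angle :: "real \<Rightarrow> ('n::finite \<Rightarrow> real) \<Rightarrow> 'n \<Rightarrow> real ^ 'n \<Rightarrow> real" where
  "d_angle S a i \<sigma> = (\<Sum>j\<in>UNIV. (\<sigma> $ i * sin (a j) - \<sigma> $ j * sin (a i)) * (\<Prod>k\<in>UNIV - {i, j}. cos (a k))) /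
     (S * (\<Sum>j\<in>UNIV. sin (a j) * (\<Prod>k\<in>UNIV - {j}. cos (a k))))"

text \<open>The terms of the double sum change sign when i and j are exchanged.\<close>

lemma sum_d_angle: "(\<Sum>i\<in>UNIV. d_angle S a i \<sigma>) = 0"
proof -
  define T where "T i j = (\<sigma> $ i * sin (a j) - \<sigma> $ j * sin (a i)) * (\<Prod>k\<in>UNIV - {i, j}. cos (a k))" for i j
  have "(\<Sum>i\<in>UNIV. \<Sum>j\<in>UNIV. T i j) = (\<Sum>j\<in>UNIV. \<Sum>i\<in>UNIV. T i j)" by (rule sum.swap)
  also have "\<dots> = (\<Sum>j\<in>UNIV. \<Sum>i\<in>UNIV. - T j i)"
    by (intro sum.cong refl) (simp add: T_def insert_commute algebra_simps)
  also have "\<dots> = - (\<Sum>i\<in>UNIV. \<Sum>j\<in>UNIV. T i j)" by (simp add: sum_negf)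
  finally have "(\<Sum>i\<in>UNIV. \<Sum>j\<in>UNIV. T i j) = 0" by simp
  then show ?thesis unfolding d_angle_def T_def[symmetric] by (simp add: sum_divide_distrib[symmetric])
qed

lemma d_radius_angle:
  fixes a :: "'n::finite \<Rightarrow> real"
  assumes "S \<noteq> 0" "(\<Sum>j\<in>UNIV. sin (a j) * (\<Prod>k\<in>UNIV - {j}. cos (a k))) \<noteq> 0"
  shows "d_radius S a \<sigma> * sin (a i) + S * cos (a i) * d_angle S a i \<sigma> = \<sigma> $ i"
proof -
  define P where "P j = (\<Prod>k\<in>UNIV - {j}. cos (a k))" for j
  define Q where "Q = (\<Sum>j\<in>UNIV. sin (a j) * P j)"
  have Q: "Q \<noteq> 0" using assms(2) by (simp add: Q_def P_def)
  \<comment> \<open>The factor cos (a_i) completes the product over k different from i and j to the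
    one over k different from j; for j = i the difference in front makes both sides vanish.\<close>
  have "cos (a i) * ((\<sigma> $ i * sin (a j) - \<sigma> $ j * sin (a i)) * (\<Prod>k\<in>UNIV - {i, j}. cos (a k))) =
      (\<sigma> $ i * sin (a j) - \<sigma> $ j * sin (a i)) * P j" for j
  proof (cases "j = i")
    case False
    then have "P j = cos (a i) * (\<Prod>k\<in>UNIV - {j} - {i}. cos (a k))"
      unfolding P_def by (intro prod.remove) auto
    also have "UNIV - {j} - {i} = UNIV - {i, j}" by auto
    finally show ?thesis by simp
  qed simp
  then have "cos (a i) * (\<Sum>j\<in>UNIV. (\<sigma> $ i * sin (a j) - \<sigma> $ j * sin (a i)) * (\<Prod>k\<in>UNIV - {i, j}. cos (a k))) =
      (\<Sum>j\<in>UNIV. (\<sigma> $ i * sin (a j) - \<sigma> $ j * sin (a i)) * P j)"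
    unfolding sum_distrib_left by (intro sum.cong) auto
  also have "\<dots> = \<sigma> $ i * Q - sin (a i) * (\<Sum>j\<in>UNIV. \<sigma> $ j * P j)"
    by (simp add: Q_def sum_distrib_left sum_subtractf algebra_simps)
  finally have "S * cos (a i) * d_angle S a i \<sigma> = (\<sigma> $ i * Q - sin (a i) * (\<Sum>j\<in>UNIV. \<sigma> $ j * P j)) / Q"
    unfolding d_angle_def P_def[symmetric] Q_def[symmetric] using assms(1) Q by (simp add: field_simps)
  then show ?thesis
    unfolding d_radius_def P_def[symmetric] Q_def[symmetric] using Q by (simp add: field_simps)
qed

text \<open>Chart: \<open>y $ m\<close> is the radius, the other entries are half angles, and the half angle at \<open>m\<close> is the
  complement of their sum to \<open>pi\<close>.\<close>

definition chart_angle :: "'n::finite \<Rightarrow> real ^ 'n \<Rightarrow> 'n \<Rightarrow> real" where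
  "chart_angle m y i = (if i = m then pi - (\<Sum>j\<in>UNIV - {m}. y $ j) else y $ i)"

text \<open>\<open>f\<close> sends radius and angles to sides, and \<open>g\<close> collects
  \<open>circ_R\<close> and \<open>circ_a\<close>, which are known only through their defining
  property. By uniqueness \<open>g\<close> is a left inverse of \<open>f\<close> on the open set
  \<open>P\<close>, so the inverse function theorem asks for a right inverse of the derivative of
  \<open>f\<close>; \<open>d_radius\<close> and \<open>d_angle\<close> supply it. Entry
  \<open>m\<close> of the chart holds the radius, whence \<open>i \<noteq> m\<close>.\<close>

lemma circ_has_derivative_chart:
  fixes s :: "real ^ 'n::finite"
  assumes n: "CARD('n) \<ge> 3" and s: "s \<in> sine_sides" and "i \<noteq> m"
  shows "(circ_R has_derivative d_radius (circ_R s) (circ_a s)) (at s)"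
    and "((\<lambda>s. circ_a s i) has_derivative d_angle (circ_R s) (circ_a s) i) (at s)"
proof -
  define f where "f y = (\<chi> i. y $ m * sin (chart_angle m y i))" for y :: "real ^ 'n"
  define P where "P = {y :: real ^ 'n. (\<forall>i. 0 < y $ i) \<and> (\<Sum>j\<in>UNIV - {m}. y $ j) < pi}"
  define g where "g s = (\<chi> i. if i = m then circ_R s else circ_a s i)" for s :: "real ^ 'n"
  define S where "S = circ_R s"
  define a where "a = circ_a s"
  define g' where "g' \<sigma> = (\<chi> i. if i = m then d_radius S a \<sigma> else d_angle S a i \<sigma>)" for \<sigma> :: "real ^ 'n"
  define da where "da w i = (if i = m then - (\<Sum>j\<in>UNIV - {m}. w $ j) else w $ i)" for w :: "real ^ 'n" and i
  define f' where "f' w = (\<chi> i. w $ m * sin (a i) + S * (cos (a i) * da w i))" for w :: "real ^ 'n"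
  have i: "inscribed (($) s) S a" using inscribed_circ[OF n s] by (simp add: S_def a_def)
  then have a: "\<And>i. 0 < a i" "sum a UNIV = pi" "S > 0" "\<And>i. s $ i = S * sin (a i)"
    by (auto simp: inscribed_def)
  have P_eq: "P = (\<Inter>i\<in>UNIV. {y. 0 < y $ i}) \<inter> {y. (\<Sum>j\<in>UNIV - {m}. y $ j) < pi}"
    by (auto simp: P_def)
  have "open P" unfolding P_eq
    by (intro open_Int open_INT open_Collect_less continuous_intros ballI) auto
  have ca: "chart_angle m (g s) = a"
    using angle_others_sum(1)[OF n a(1,2), of m]
    by (auto simp: chart_angle_def g_def a_def S_def fun_eq_iff cong: sum.cong_simp)
  have gsP: "g s \<in> P"
    using a(1,3) angle_others_sum(1)[OF n a(1,2), of m]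
    by (auto simp: P_def g_def a_def S_def cong: sum.cong_simp)
  have der: "(f has_derivative (\<lambda>w. \<chi> i. w $ m * sin (chart_angle m y i) + y $ m * (cos (chart_angle m y i) * da w i))) (at y)" for y
  proof (rule has_derivative_vec)
    fix i
    have "((\<lambda>y. chart_angle m y i) has_derivative (\<lambda>w. da w i)) (at y)"
      unfolding chart_angle_def da_def
      by (cases "i = m") (auto intro!: derivative_eq_intros bounded_linear_imp_has_derivative bounded_linear_vec_nth)
    note d1 = has_derivative_sin[OF this]
    have d2: "((\<lambda>y. y $ m) has_derivative (\<lambda>w. w $ m)) (at y)"
      by (intro bounded_linear_imp_has_derivative bounded_linear_vec_nth)
    show "((\<lambda>x. f x $ i) has_derivative (\<lambda>v. (\<chi> i. v $ m * sin (chart_angle m y i) + y $ m * (cos (chart_angle m y i) * da v i)) $ i)) (at y)"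
      unfolding f_def using has_derivative_mult[OF d2 d1]
      by (simp add: algebra_simps)
  qed
  have "(g has_derivative g') (at s)"
  proof (rule has_derivative_inverse_strong_x[where S = P and f = f and f' = f'])
    show "open P" "g s \<in> P" by fact+
    show "continuous_on P f"
      using der by (intro continuous_at_imp_continuous_on ballI has_derivative_continuous)
    show "g (f y) = y" if "y \<in> P" for y
    proof -
      have "sum (chart_angle m y) UNIV = pi"
        by (simp add: sum.remove[of UNIV m] chart_angle_def)
      then have "inscribed (($) (f y)) (y $ m) (chart_angle m y)"
        using that by (auto simp: inscribed_def P_def f_def chart_angle_def)
      from circ_eqI[OF n this] show ?thesis by (auto simp: g_def vec_eq_iff chart_angle_def)
    qed
    show "(f has_derivative f') (at (g s))"
      using der[of "g s"] unfolding ca f'_def by (simp add: g_def S_def)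
    show "f' \<circ> g' = id"
    proof
      fix \<sigma>
      have "da (g' \<sigma>) i = d_angle S a i \<sigma>" for i
      proof (cases "i = m")
        case True
        have "(\<Sum>j\<in>UNIV - {m}. g' \<sigma> $ j) = (\<Sum>j\<in>UNIV - {m}. d_angle S a j \<sigma>)"
          by (intro sum.cong) (auto simp: g'_def)
        then show ?thesis using True sum_d_angle[of S a \<sigma>] by (simp add: da_def sum.remove[of UNIV m])
      qed (simp add: da_def g'_def)
      then show "(f' \<circ> g') \<sigma> = id \<sigma>"
        using d_radius_angle[of S a \<sigma>] tangent_form_pos[OF n a(1,2)] a(3)
        by (simp add: f'_def vec_eq_iff g'_def mult.assoc)
    qed
    show "f (g s) = s"
      using a(4) by (simp add: f_def ca vec_eq_iff) (simp add: g_def S_def)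
  qed
  from bounded_linear.has_derivative[OF bounded_linear_vec_nth this]
  have *: "((\<lambda>s. g s $ i) has_derivative (\<lambda>\<sigma>. g' \<sigma> $ i)) (at s)" for i .
  show "(circ_R has_derivative d_radius (circ_R s) (circ_a s)) (at s)"
    using *[of m] by (simp add: g_def g'_def S_def a_def)
  show "((\<lambda>s. circ_a s i) has_derivative d_angle (circ_R s) (circ_a s) i) (at s)"
    using *[of i] \<open>i \<noteq> m\<close> by (simp add: g_def g'_def S_def a_def)
qed

lemma circ_has_derivative:
  fixes s :: "real ^ 'n::finite"
  assumes n: "CARD('n) \<ge> 3" and s: "s \<in> sine_sides"
  shows "(circ_R has_derivative d_radius (circ_R s) (circ_a s)) (at s)"
    and "((\<lambda>s. circ_a s i) has_derivative d_angle (circ_R s) (circ_a s) i) (at s)"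
proof -
  obtain m where "m \<noteq> i" using exists_other2[OF n] .
  then show "(circ_R has_derivative d_radius (circ_R s) (circ_a s)) (at s)"
    "((\<lambda>s. circ_a s i) has_derivative d_angle (circ_R s) (circ_a s) i) (at s)"
    using circ_has_derivative_chart[OF n s, of i m] by auto
qed

section \<open>Radius, angles and area as functions of the hyperbolic side lengths\<close>

definition half_sinh :: "real ^ 'n::finite \<Rightarrow> real ^ 'n" where
  "half_sinh d = (\<chi> i. sinh (d $ i / 2))"

definition sinh_radius :: "real ^ 'n::finite \<Rightarrow> real" where
  "sinh_radius d = circ_R (half_sinh d)"

definition half_angle :: "real ^ 'n::finite \<Rightarrow> 'n \<Rightarrow> real" where
  "half_angle d = circ_a (half_sinh d)"

definition area_fun :: "real ^ 'n::finite \<Rightarrow> real" where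
  "area_fun d = (\<Sum>i\<in>UNIV. tri_area (sqrt (1 + (sinh_radius d)\<^sup>2)) (half_angle d i))"

lemma half_sinh_AC: "d \<in> AC_set \<Longrightarrow> half_sinh d \<in> sine_sides"
  by (auto simp: AC_set_def sine_sides_def half_sinh_def)

lemma inscribed_AC:
  fixes d :: "real ^ 'n::finite"
  assumes "CARD('n) \<ge> 3" "d \<in> AC_set"
  shows "inscribed (\<lambda>i. sinh (d $ i / 2)) (sinh_radius d) (half_angle d)"
proof -
  have "($) (half_sinh d) = (\<lambda>i. sinh (d $ i / 2))" by (simp add: half_sinh_def fun_eq_iff)
  then show ?thesis using inscribed_circ[OF assms(1) half_sinh_AC[OF assms(2)]]
    by (simp add: sinh_radius_def half_angle_def)
qed

lemma open_AC: "open (AC_set :: (real ^ 'n::finite) set)"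
proof -
  have "AC_set = (\<Inter>i\<in>UNIV. {d :: real ^ 'n. 0 < d $ i}) \<inter>
      (\<Inter>i\<in>UNIV. {d. sinh (d $ i / 2) < (\<Sum>j\<in>UNIV - {i}. sinh (d $ j / 2))})"
    by (auto simp: AC_set_def)
  also have "open \<dots>"
    by (intro open_Int open_INT open_Collect_less continuous_intros ballI) auto
  finally show ?thesis .
qed

definition d_half_sinh :: "real ^ 'n::finite \<Rightarrow> real ^ 'n \<Rightarrow> real ^ 'n" where
  "d_half_sinh d v = (\<chi> i. cosh (d $ i / 2) / 2 * v $ i)"

lemma half_sinh_has_derivative: "(half_sinh has_derivative d_half_sinh d) (at d)"
proof (rule has_derivative_vec)
  fix i
  have "(sinh has_real_derivative cosh (d $ i / 2)) (at (d $ i / 2))"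
    by (auto intro!: derivative_eq_intros)
  moreover have "((\<lambda>d. d $ i / 2) has_derivative (\<lambda>v. v $ i / 2)) (at d)"
    by (intro has_derivative_divide' bounded_linear_imp_has_derivative bounded_linear_divide
        bounded_linear_compose[OF bounded_linear_divide bounded_linear_vec_nth])
  ultimately show "((\<lambda>d. half_sinh d $ i) has_derivative (\<lambda>v. d_half_sinh d v $ i)) (at d)"
    by (auto simp: half_sinh_def d_half_sinh_def mult.commute dest: DERIV_compose_FDERIV)
qed

lemma sinh_radius_half_angle_has_derivative:
  fixes d :: "real ^ 'n::finite"
  assumes n: "CARD('n) \<ge> 3" and d: "d \<in> AC_set"
  shows "(sinh_radius has_derivative (\<lambda>v. d_radius (sinh_radius d) (half_angle d) (d_half_sinh d v))) (at d)"
    and "((\<lambda>d. half_angle d i) has_derivative (\<lambda>v. d_angle (sinh_radius d) (half_angle d) i (d_half_sinh d v))) (at d)"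
  using circ_has_derivative[OF n half_sinh_AC[OF d], THEN has_derivative_compose[OF half_sinh_has_derivative]]
  unfolding sinh_radius_def half_angle_def by simp_all

lemma Ck_on_component: "Ck_on k (\<lambda>d :: real ^ 'n::finite. d $ i) S"
  by (intro Ck_on_bounded_linear bounded_linear_vec_nth)

lemma Ck_on_d_half_sinh: "Ck_on k (\<lambda>d :: real ^ 'n::finite. d_half_sinh d v $ i) S"
  unfolding d_half_sinh_def vec_lambda_beta
  by (intro Ck_on_mult Ck_on_divide Ck_on_cosh Ck_on_const Ck_on_component) auto

text \<open>The induction treats radius and angles together, since the derivative of each involves
  the others.\<close>

lemma Ck_on_sinh_radius_half_angle:
  assumes n: "CARD('n::finite) \<ge> 3"
  shows "Ck_on k (sinh_radius :: real ^ 'n \<Rightarrow> real) AC_set \<and> (\<forall>i. Ck_on k (\<lambda>d :: real ^ 'n. half_angle d i) AC_set)"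
proof (induction k)
  case 0
  show ?case
    using sinh_radius_half_angle_has_derivative[OF n]
    by (auto intro!: continuous_at_imp_continuous_on intro: has_derivative_continuous)
next
  case (Suc k)
  have nz: "(\<Sum>j\<in>UNIV. sin (half_angle d j) * (\<Prod>k\<in>UNIV - {j}. cos (half_angle d k))) \<noteq> 0"
    "sinh_radius d \<noteq> 0" if "d \<in> AC_set" for d :: "real ^ 'n"
    using inscribed_AC[OF n that] tangent_form_pos[OF n, of "half_angle d"]
    by (auto simp: inscribed_def)
  have R: "Ck_on k (sinh_radius :: real ^ 'n \<Rightarrow> real) AC_set" and A: "Ck_on k (\<lambda>d :: real ^ 'n. half_angle d i) AC_set" for i
    using Suc by auto
  note C = Ck_on_divide Ck_on_sum Ck_on_mult Ck_on_prod Ck_on_diff Ck_on_sin Ck_on_cos Ck_on_d_half_sinh R A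
  have "Ck_on k (\<lambda>d :: real ^ 'n. d_radius (sinh_radius d) (half_angle d) (d_half_sinh d v)) AC_set" for v
    unfolding d_radius_def by (intro C) (use nz in auto)
  moreover have "Ck_on k (\<lambda>d :: real ^ 'n. d_angle (sinh_radius d) (half_angle d) i (d_half_sinh d v)) AC_set" for i v
    unfolding d_angle_def by (intro C) (use nz in auto)
  ultimately show ?case
    by (intro conjI allI Ck_on_SucI[OF sinh_radius_half_angle_has_derivative(1)[OF n]]
        Ck_on_SucI[OF sinh_radius_half_angle_has_derivative(2)[OF n]])
qed

lemma area_fun_has_derivative:
  fixes d :: "real ^ 'n::finite"
  assumes n: "CARD('n) \<ge> 3" and d: "d \<in> AC_set"
  shows "(area_fun has_derivative (\<lambda>v. \<Sum>i\<in>UNIV. sinh_radius d * cos (half_angle d i) /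
     (sqrt (1 + (sinh_radius d)\<^sup>2) * cosh (d $ i / 2)) * v $ i)) (at d)"
proof -
  define S where "S = sinh_radius d"
  define a where "a = half_angle d"
  define c where "c = sqrt (1 + S\<^sup>2)"
  define h where "h i = cosh (d $ i / 2)" for i
  define dS where "dS v = d_radius S a (d_half_sinh d v)" for v
  define da where "da i v = d_angle S a i (d_half_sinh d v)" for i v
  have i: "inscribed (\<lambda>i. sinh (d $ i / 2)) S a" using inscribed_AC[OF n d] by (simp add: S_def a_def)
  then have a: "\<And>i. 0 < a i" "sum a UNIV = pi" "S > 0" "\<And>i. sinh (d $ i / 2) = S * sin (a i)"
    by (auto simp: inscribed_def)
  have c: "c > 0" "c\<^sup>2 = 1 + S\<^sup>2" by (auto simp: c_def add_pos_nonneg)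
  have h: "(h i)\<^sup>2 = (cos (a i))\<^sup>2 + c\<^sup>2 * (sin (a i))\<^sup>2" "h i > 0" for i
  proof -
    have "(h i)\<^sup>2 = 1 + (S * sin (a i))\<^sup>2" unfolding h_def cosh_square_eq a(4) by simp
    also have "\<dots> = (cos (a i))\<^sup>2 + c\<^sup>2 * (sin (a i))\<^sup>2"
      unfolding c by (simp add: cos_squared_eq algebra_simps power_mult_distrib)
    finally show "(h i)\<^sup>2 = (cos (a i))\<^sup>2 + c\<^sup>2 * (sin (a i))\<^sup>2" .
  qed (simp add: h_def)
  have dS: "(sinh_radius has_derivative dS) (at d)" and da: "((\<lambda>d. half_angle d i) has_derivative da i) (at d)" for i
    using sinh_radius_half_angle_has_derivative[OF n d] by (auto simp: dS_def[abs_def] da_def[abs_def] S_def a_def)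
  have dc: "((\<lambda>d. sqrt (1 + (sinh_radius d)\<^sup>2)) has_derivative (\<lambda>v. S * dS v / c)) (at d)"
    using c(1) by (auto intro!: derivative_eq_intros dS simp: c_def S_def add_pos_nonneg field_simps)
  have "(area_fun has_derivative (\<lambda>v. \<Sum>i\<in>UNIV. 2 * (c / (h i)\<^sup>2 - 1) * da i v + 2 * sin (a i) * cos (a i) / (h i)\<^sup>2 * (S * dS v / c))) (at d)"
    unfolding area_fun_def[abs_def] h
    by (intro has_derivative_sum has_derivative_tri_area[OF c(1) dc da]) (auto simp: c_def S_def a_def)
  moreover have "(\<Sum>i\<in>UNIV. 2 * (c / (h i)\<^sup>2 - 1) * da i v + 2 * sin (a i) * cos (a i) / (h i)\<^sup>2 * (S * dS v / c))
    = (\<Sum>i\<in>UNIV. S * cos (a i) / (c * h i) * v $ i)" for v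
  proof -
    \<comment> \<open>Up to a term in \<open>da i v\<close>, whose coefficient 2 (1 / c - 1) is the
      same for all i, the summand is already the claimed one; those terms cancel in the sum over
      i.\<close>
    have summand: "2 * (c / (h i)\<^sup>2 - 1) * da i v + 2 * sin (a i) * cos (a i) / (h i)\<^sup>2 * (S * dS v / c) =
        S * cos (a i) / (c * h i) * v $ i + 2 * (1 / c - 1) * da i v" for i
    proof -
      have "dS v * sin (a i) + S * cos (a i) * da i v = d_half_sinh d v $ i"
        unfolding dS_def da_def using tangent_form_pos[OF n a(1,2)] a(3) by (intro d_radius_angle) auto
      then have v: "h i * v $ i = 2 * (dS v * sin (a i) + S * cos (a i) * da i v)"
        by (simp add: d_half_sinh_def h_def)
      have h2: "(h i)\<^sup>2 = c\<^sup>2 - S\<^sup>2 * (cos (a i))\<^sup>2"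
        unfolding h c by (simp add: sin_squared_eq algebra_simps)
      have "S * cos (a i) / (c * h i) * v $ i = S * cos (a i) / (c * (h i)\<^sup>2) * (h i * v $ i)"
        using h(2)[of i] by (simp add: power2_eq_square)
      also have "\<dots> = 2 * S * cos (a i) * dS v * sin (a i) / (c * (h i)\<^sup>2) + 2 * (S\<^sup>2 * (cos (a i))\<^sup>2) / (c * (h i)\<^sup>2) * da i v"
        unfolding v by (simp add: add_divide_distrib algebra_simps power2_eq_square)
      also have "S\<^sup>2 * (cos (a i))\<^sup>2 = c\<^sup>2 - (h i)\<^sup>2" using h2 by simp
      also have "2 * (c\<^sup>2 - (h i)\<^sup>2) / (c * (h i)\<^sup>2) = 2 * (c / (h i)\<^sup>2 - 1) - 2 * (1 / c - 1)"
        using h(2)[of i] c(1) by (simp add: field_simps power2_eq_square)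
      finally show ?thesis by (simp add: algebra_simps)
    qed
    have "(\<Sum>i\<in>UNIV. da i v) = 0" unfolding da_def by (rule sum_d_angle)
    then show ?thesis unfolding summand by (simp add: sum.distrib sum_distrib_left[symmetric])
  qed
  ultimately show ?thesis by (simp add: S_def a_def c_def h_def)
qed

lemma Ck_on_area_fun:
  assumes n: "CARD('n::finite) \<ge> 3"
  shows "Ck_on k (area_fun :: real ^ 'n \<Rightarrow> real) AC_set"
proof -
  have *: "Ck_on k (sinh_radius :: real ^ 'n \<Rightarrow> real) AC_set" "Ck_on k (\<lambda>d :: real ^ 'n. half_angle d i) AC_set" for i k
    using Ck_on_sinh_radius_half_angle[OF n] by auto
  have "Ck_on k (\<lambda>d. \<Sum>i\<in>UNIV. sinh_radius d * cos (half_angle d i) /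
     (sqrt (1 + (sinh_radius d)\<^sup>2) * cosh (d $ i / 2)) * v $ i) AC_set" for v :: "real ^ 'n"
  proof -
    have "sqrt (1 + (sinh_radius d)\<^sup>2) = (1 + sinh_radius d * sinh_radius d) powr (1/2)" for d :: "real ^ 'n"
      by (simp add: powr_half_sqrt power2_eq_square)
    moreover have "1 + sinh_radius d * sinh_radius d > 0" for d :: "real ^ 'n"
      by (simp add: add_pos_nonneg)
    ultimately show ?thesis
      by (simp only:, intro Ck_on_sum Ck_on_mult Ck_on_divide Ck_on_cos Ck_on_cosh Ck_on_powr Ck_on_add
          Ck_on_const Ck_on_component *)
         (auto simp: less_imp_neq[symmetric])
  qed
  then have "Ck_on (Suc k) (area_fun :: real ^ 'n \<Rightarrow> real) AC_set"
    by (intro Ck_on_SucI[OF area_fun_has_derivative[OF n]])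
  then show ?thesis by (rule Ck_on_Suc_imp)
qed

section \<open>The Klein model\<close>

text \<open>The cross product of z - p and q - p, which vanishes exactly for collinear
  points.\<close>

definition kdet :: "complex \<Rightarrow> complex \<Rightarrow> complex \<Rightarrow> real" where
  "kdet p z q = (Re z - Re p) * (Im q - Im p) - (Im z - Im p) * (Re q - Re p)"

lemma hyp_plane_iff: "z \<in> hyp_plane \<longleftrightarrow> 0 < 1 - (cmod z)\<^sup>2"
  by (simp add: hyp_plane_def dist_norm power_less_one_iff abs_square_less_1)

lemma klein_discriminant:
  "(1 - z \<bullet> w)\<^sup>2 - (1 - (cmod z)\<^sup>2) * (1 - (cmod w)\<^sup>2) = (cmod (z - w))\<^sup>2 - (Re z * Im w - Im z * Re w)\<^sup>2"
  unfolding cmod_power2 inner_complex_def by (simp add: algebra_simps power2_eq_square)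

text \<open>The reversed Cauchy-Schwarz inequality for the Lorentz form on the lifts (1, z) and (1,
  w). By \<open>klein_discriminant\<close> it amounts to bounding the cross product of z and w - z
  by |z| |z - w|, with |z| < 1.\<close>

lemma klein_discriminant_pos:
  assumes "z \<in> hyp_plane" "z \<noteq> w"
  shows "(1 - (cmod z)\<^sup>2) * (1 - (cmod w)\<^sup>2) < (1 - z \<bullet> w)\<^sup>2"
proof -
  have "(Re z * Im w - Im z * Re w)\<^sup>2 + (z \<bullet> (w - z))\<^sup>2 = (cmod z)\<^sup>2 * (cmod (z - w))\<^sup>2"
    unfolding cmod_power2 inner_complex_def by (simp add: algebra_simps power2_eq_square)
  then have "(Re z * Im w - Im z * Re w)\<^sup>2 \<le> (cmod z)\<^sup>2 * (cmod (z - w))\<^sup>2"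
    by (metis le_add_same_cancel1 zero_le_power2)
  also have "\<dots> < 1 * (cmod (z - w))\<^sup>2"
    using assms by (intro mult_strict_right_mono) (auto simp: hyp_plane_iff)
  finally show ?thesis using klein_discriminant[of z w] by simp
qed

lemma klein_discriminant_nonneg:
  assumes "z \<in> hyp_plane"
  shows "(1 - (cmod z)\<^sup>2) * (1 - (cmod w)\<^sup>2) \<le> (1 - z \<bullet> w)\<^sup>2"
  using klein_discriminant_pos[OF assms, of w] klein_discriminant[of z w] by (cases "z = w") auto

lemma inner_less_one:
  assumes "z \<in> hyp_plane" "w \<in> hyp_plane" shows "0 < 1 - z \<bullet> w"
proof -
  have "z \<bullet> w \<le> cmod z * cmod w" by (rule norm_cauchy_schwarz)
  also have "\<dots> < 1 * 1" using assms by (intro mult_strict_mono') (auto simp: hyp_plane_def)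
  finally show ?thesis by simp
qed

definition klein_cosh :: "complex \<Rightarrow> complex \<Rightarrow> real" where
  "klein_cosh z w = (1 - z \<bullet> w) / sqrt ((1 - (cmod z)\<^sup>2) * (1 - (cmod w)\<^sup>2))"

lemma klein_cosh_ge_1:
  assumes "z \<in> hyp_plane" "w \<in> hyp_plane" shows "1 \<le> klein_cosh z w"
proof -
  have p: "0 < (1 - (cmod z)\<^sup>2) * (1 - (cmod w)\<^sup>2)" using assms by (simp add: hyp_plane_iff)
  have "sqrt ((1 - (cmod z)\<^sup>2) * (1 - (cmod w)\<^sup>2)) \<le> sqrt ((1 - z \<bullet> w)\<^sup>2)"
    using klein_discriminant_nonneg[OF assms(1)] by (rule real_sqrt_le_mono)
  also have "\<dots> = 1 - z \<bullet> w" using inner_less_one[OF assms] by simp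
  finally show ?thesis using p by (simp add: klein_cosh_def)
qed

lemma cosh_hdist: "z \<in> hyp_plane \<Longrightarrow> w \<in> hyp_plane \<Longrightarrow> cosh (hdist z w) = klein_cosh z w"
  and hdist_nonneg: "z \<in> hyp_plane \<Longrightarrow> w \<in> hyp_plane \<Longrightarrow> 0 \<le> hdist z w"
  using klein_cosh_ge_1[of z w] by (simp_all add: hdist_def klein_cosh_def cosh_arcosh_real arcosh_nonneg_real)

lemma hdist_eq_iff:
  assumes "z \<in> hyp_plane" "w \<in> hyp_plane" "0 \<le> r"
  shows "hdist z w = r \<longleftrightarrow> klein_cosh z w = cosh r"
  using cosh_hdist[OF assms(1,2)] hdist_nonneg[OF assms(1,2)] assms(3)
    arcosh_cosh_real[of "hdist z w"] arcosh_cosh_real[of r] by auto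

text \<open>The Gram determinant of the three lifts to the hyperboloid decides collinearity.\<close>

lemma klein_gram:
  "(1 - (cmod p)\<^sup>2) * (1 - (cmod z)\<^sup>2) * (1 - (cmod q)\<^sup>2) + 2 * (1 - p \<bullet> z) * (1 - z \<bullet> q) * (1 - p \<bullet> q)
   - (1 - (cmod p)\<^sup>2) * (1 - z \<bullet> q)\<^sup>2 - (1 - (cmod z)\<^sup>2) * (1 - p \<bullet> q)\<^sup>2 - (1 - (cmod q)\<^sup>2) * (1 - p \<bullet> z)\<^sup>2
   = (kdet p z q)\<^sup>2"
  unfolding cmod_power2 inner_complex_def kdet_def by (simp add: algebra_simps power2_eq_square)

text \<open>With A, B, C the cosh of the three distances, equality in the triangle inequality reads
  C - A B = sqrt ((A^2 - 1) (B^2 - 1)). Squared, this is the vanishing of the Gram determinant of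
  \<open>klein_gram\<close>; the inequality on the right keeps the sign that squaring loses.\<close>

lemma mem_hsegment_iff:
  assumes p: "p \<in> hyp_plane" and q: "q \<in> hyp_plane" and z: "z \<in> hyp_plane"
  shows "z \<in> hsegment p q \<longleftrightarrow> kdet p z q = 0 \<and> (1 - p \<bullet> z) * (1 - z \<bullet> q) \<le> (1 - p \<bullet> q) * (1 - (cmod z)\<^sup>2)"
proof -
  define N where "N = 1 - (cmod p)\<^sup>2"
  define M where "M = 1 - (cmod q)\<^sup>2"
  define Z where "Z = 1 - (cmod z)\<^sup>2"
  have pos: "0 < N" "0 < M" "0 < Z" using assms by (auto simp: N_def M_def Z_def hyp_plane_iff)
  define a where "a = 1 - p \<bullet> z"
  define b where "b = 1 - z \<bullet> q"
  define k where "k = 1 - p \<bullet> q"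
  define A where "A = klein_cosh p z"
  define B where "B = klein_cosh z q"
  define C where "C = klein_cosh p q"
  have ge: "1 \<le> A" "1 \<le> B" using klein_cosh_ge_1 assms by (auto simp: A_def B_def)
  have A: "A = a / (sqrt N * sqrt Z)" and B: "B = b / (sqrt Z * sqrt M)" and C: "C = k / (sqrt N * sqrt M)"
    by (simp_all add: A_def B_def C_def klein_cosh_def a_def b_def k_def N_def M_def Z_def real_sqrt_mult)
  have CAB: "C - A * B = (k * Z - a * b) / (Z * (sqrt N * sqrt M))"
    unfolding A B C using pos by (simp add: field_simps)
  have A2: "A\<^sup>2 - 1 = (a\<^sup>2 - N * Z) / (N * Z)" and B2: "B\<^sup>2 - 1 = (b\<^sup>2 - Z * M) / (Z * M)"
    unfolding A B using pos by (simp_all add: power_divide power_mult_distrib diff_divide_distrib)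
  have "(C - A * B)\<^sup>2 = (k * Z - a * b)\<^sup>2 / (Z\<^sup>2 * (N * M))"
    unfolding CAB using pos by (simp add: power_divide power_mult_distrib)
  moreover have "(A\<^sup>2 - 1) * (B\<^sup>2 - 1) = (a\<^sup>2 - N * Z) * (b\<^sup>2 - Z * M) / (Z\<^sup>2 * (N * M))"
    unfolding A2 B2 by (simp add: power2_eq_square mult_ac)
  moreover have "(a\<^sup>2 - N * Z) * (b\<^sup>2 - Z * M) - (k * Z - a * b)\<^sup>2 = Z * (kdet p z q)\<^sup>2"
    using klein_gram[of p z q, folded N_def M_def Z_def a_def b_def k_def, symmetric]
    by (simp only:) (simp add: algebra_simps power2_eq_square)
  ultimately have "(A\<^sup>2 - 1) * (B\<^sup>2 - 1) - (C - A * B)\<^sup>2 = Z * (kdet p z q)\<^sup>2 / (Z\<^sup>2 * (N * M))"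
    by (simp add: diff_divide_distrib[symmetric])
  then have G: "(C - A * B)\<^sup>2 = (A\<^sup>2 - 1) * (B\<^sup>2 - 1) \<longleftrightarrow> kdet p z q = 0"
    using pos by auto
  have AB: "0 \<le> (A\<^sup>2 - 1) * (B\<^sup>2 - 1)" using ge by (auto simp: one_le_power)
  have "sinh (hdist p z) = sqrt (A\<^sup>2 - 1)" "sinh (hdist z q) = sqrt (B\<^sup>2 - 1)"
    using klein_cosh_ge_1[OF p z] klein_cosh_ge_1[OF z q]
    by (simp_all add: hdist_def sinh_arcosh_real A_def B_def klein_cosh_def)
  then have "cosh (hdist p z + hdist z q) = A * B + sqrt ((A\<^sup>2 - 1) * (B\<^sup>2 - 1))"
    using assms by (simp add: cosh_add cosh_hdist A_def B_def real_sqrt_mult)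
  then have "z \<in> hsegment p q \<longleftrightarrow> C = A * B + sqrt ((A\<^sup>2 - 1) * (B\<^sup>2 - 1))"
    using hdist_eq_iff[OF p q, of "hdist p z + hdist z q"] hdist_nonneg[OF p z] hdist_nonneg[OF z q] z
    by (auto simp: hsegment_def C_def)
  also have "\<dots> \<longleftrightarrow> C - A * B = sqrt ((A\<^sup>2 - 1) * (B\<^sup>2 - 1))" by auto
  also have "\<dots> \<longleftrightarrow> 0 \<le> C - A * B \<and> (C - A * B)\<^sup>2 = (A\<^sup>2 - 1) * (B\<^sup>2 - 1)"
    using AB by (metis real_sqrt_ge_zero real_sqrt_pow2 real_sqrt_unique)
  also have "0 \<le> C - A * B \<longleftrightarrow> a * b \<le> k * Z"
    unfolding CAB using pos by (subst pos_le_divide_eq) auto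
  finally show ?thesis unfolding G by (simp add: a_def b_def k_def Z_def conj_commute)
qed

text \<open>On the line through p and q the sign condition of \<open>mem_hsegment_iff\<close>
  becomes l (1 - l) >= 0, because the last factor is positive for distinct points of the
  disc.\<close>

lemma klein_segment_identity:
  fixes p q :: complex
  assumes "z = (1 - l) *\<^sub>R p + l *\<^sub>R q"
  shows "(1 - p \<bullet> q) * (1 - (cmod z)\<^sup>2) - (1 - p \<bullet> z) * (1 - z \<bullet> q) =
    l * (1 - l) * ((1 - p \<bullet> q)\<^sup>2 - (1 - (cmod p)\<^sup>2) * (1 - (cmod q)\<^sup>2))"
  unfolding assms cmod_power2 inner_complex_def by (simp add: algebra_simps power2_eq_square)

lemma hsegment_eq_closed_segment:
  assumes p: "p \<in> hyp_plane" and q: "q \<in> hyp_plane"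
  shows "hsegment p q = closed_segment p q"
proof
  have seg: "closed_segment p q \<subseteq> hyp_plane"
    using assms closed_segment_subset[of p "ball 0 1" q] by (simp add: hyp_plane_def)
  show "closed_segment p q \<subseteq> hsegment p q"
  proof
    fix z assume zs: "z \<in> closed_segment p q"
    then obtain l where l: "0 \<le> l" "l \<le> 1" "z = (1 - l) *\<^sub>R p + l *\<^sub>R q" by (auto simp: closed_segment_def)
    have "kdet p z q = 0" unfolding kdet_def l(3) by (simp add: algebra_simps)
    moreover have "0 \<le> l * (1 - l) * ((1 - p \<bullet> q)\<^sup>2 - (1 - (cmod p)\<^sup>2) * (1 - (cmod q)\<^sup>2))"
      using l klein_discriminant_nonneg[OF p, of q] by (intro mult_nonneg_nonneg) auto
    ultimately show "z \<in> hsegment p q"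
      using mem_hsegment_iff[OF p q] zs seg klein_segment_identity[OF l(3)] by auto
  qed
  show "hsegment p q \<subseteq> closed_segment p q"
  proof
    fix z assume zs: "z \<in> hsegment p q"
    then have z: "z \<in> hyp_plane" by (simp add: hsegment_def)
    have d: "kdet p z q = 0" and le: "(1 - p \<bullet> z) * (1 - z \<bullet> q) \<le> (1 - p \<bullet> q) * (1 - (cmod z)\<^sup>2)"
      using mem_hsegment_iff[OF p q z] zs by auto
    show "z \<in> closed_segment p q"
    proof (cases "p = q")
      case True
      then have "(1 - p \<bullet> z)\<^sup>2 \<le> (1 - (cmod p)\<^sup>2) * (1 - (cmod z)\<^sup>2)"
        using le by (simp add: power2_eq_square inner_commute dot_square_norm)
      then have "z = p" using klein_discriminant_pos[OF p, of z] by fastforce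
      then show ?thesis by simp
    next
      case False
      define m where "m = (Re q - Re p)\<^sup>2 + (Im q - Im p)\<^sup>2"
      have m: "m \<noteq> 0" using False by (auto simp: m_def complex_eq_iff sum_power2_eq_zero_iff)
      \<comment> \<open>The parameter of the orthogonal projection of z to the line through p and
        q.\<close>
      define l where "l = ((Re z - Re p) * (Re q - Re p) + (Im z - Im p) * (Im q - Im p)) / m"
      have lm: "l * m = (Re z - Re p) * (Re q - Re p) + (Im z - Im p) * (Im q - Im p)" using m by (simp add: l_def)
      have "m * (Re z - Re p) = (l * m) * (Re q - Re p) + kdet p z q * (Im q - Im p)"
        "m * (Im z - Im p) = (l * m) * (Im q - Im p) - kdet p z q * (Re q - Re p)"
        unfolding lm by (simp_all add: m_def kdet_def algebra_simps power2_eq_square)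
      then have "m * (Re z - Re p) = m * (l * (Re q - Re p))" "m * (Im z - Im p) = m * (l * (Im q - Im p))"
        unfolding d by simp_all
      then have "Re z - Re p = l * (Re q - Re p)" "Im z - Im p = l * (Im q - Im p)"
        using m by simp_all
      then have zl: "z = (1 - l) *\<^sub>R p + l *\<^sub>R q" by (simp add: complex_eq_iff algebra_simps)
      have "0 \<le> l * (1 - l) * ((1 - p \<bullet> q)\<^sup>2 - (1 - (cmod p)\<^sup>2) * (1 - (cmod q)\<^sup>2))"
        using klein_segment_identity[OF zl] le by simp
      then have "0 \<le> l * (1 - l)"
        using klein_discriminant_pos[OF p False] by (simp add: zero_le_mult_iff)
      then have "0 \<le> l" "l \<le> 1" by (auto simp: zero_le_mult_iff)
      then show ?thesis using zl by (auto simp: closed_segment_def)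
    qed
  qed
qed

lemma hconvex_iff: "hconvex S \<longleftrightarrow> S \<subseteq> hyp_plane \<and> convex S"
proof -
  have "(\<forall>p\<in>S. \<forall>q\<in>S. hsegment p q \<subseteq> S) \<longleftrightarrow> (\<forall>p\<in>S. \<forall>q\<in>S. closed_segment p q \<subseteq> S)"
    if "S \<subseteq> hyp_plane"
    using that hsegment_eq_closed_segment by (metis subset_iff)
  then show ?thesis unfolding hconvex_def convex_contains_segment by blast
qed

lemma convex_hull_subset_hyp_plane: "X \<subseteq> hyp_plane \<Longrightarrow> convex hull X \<subseteq> hyp_plane"
  by (simp add: hyp_plane_def hull_minimal)

lemma hconvex_hull_eq:
  assumes "X \<subseteq> hyp_plane" shows "hconvex hull X = convex hull X"
proof
  show "hconvex hull X \<subseteq> convex hull X"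
    using convex_hull_subset_hyp_plane[OF assms] by (intro hull_minimal) (auto simp: hconvex_iff hull_subset)
  show "convex hull X \<subseteq> hconvex hull X"
    unfolding hull_def hconvex_iff by auto
qed

section \<open>Isometries of the disc and their effect on convex sets\<close>

definition hisometry :: "(complex \<Rightarrow> complex) \<Rightarrow> (complex \<Rightarrow> complex) \<Rightarrow> bool" where
  "hisometry T T' \<longleftrightarrow> (\<forall>z\<in>hyp_plane. T z \<in> hyp_plane \<and> T' z \<in> hyp_plane \<and> T' (T z) = z \<and> T (T' z) = z) \<and>
     (\<forall>z\<in>hyp_plane. \<forall>w\<in>hyp_plane. hdist (T z) (T w) = hdist z w)"

lemma hisometry_inverse: "hisometry T T' \<Longrightarrow> hisometry T' T"
  unfolding hisometry_def by metis

lemma hisometry_compose: "hisometry T T' \<Longrightarrow> hisometry U U' \<Longrightarrow> hisometry (U \<circ> T) (T' \<circ> U')"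
  unfolding hisometry_def by auto

text \<open>Segments are defined by distances alone, so an isometry preserves
  \<open>hconvex\<close>, which in this model is Euclidean convexity within the disc.\<close>

lemma hisometry_convex_image:
  assumes T: "hisometry T T'" and S: "S \<subseteq> hyp_plane" "convex S"
  shows "convex (T ` S)"
proof -
  have "hconvex S" using S by (simp add: hconvex_iff)
  have "hconvex (T ` S)" unfolding hconvex_def
  proof (intro conjI ballI subsetI)
    fix p q z assume "p \<in> T ` S" "q \<in> T ` S" and z: "z \<in> hsegment p q"
    then obtain a b where ab: "p = T a" "q = T b" "a \<in> S" "b \<in> S" by auto
    have "T' z \<in> hsegment a b"
      using z T S(1) ab unfolding hsegment_def hisometry_def by (auto simp: subset_iff) metis
    then have "T' z \<in> S" using \<open>hconvex S\<close> ab by (auto simp: hconvex_def)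
    moreover have "z = T (T' z)" using z T by (auto simp: hsegment_def hisometry_def)
    ultimately show "z \<in> T ` S" by blast
  next
    fix z assume "z \<in> T ` S"
    then show "z \<in> hyp_plane" using T S by (auto simp: hisometry_def)
  qed
  then show ?thesis by (simp add: hconvex_iff)
qed

lemma hisometry_image_inverse:
  assumes "hisometry T T'" "Y \<subseteq> hyp_plane" shows "T ` T' ` Y = Y"
proof -
  have "T (T' z) = z" if "z \<in> Y" for z using assms that by (auto simp: hisometry_def)
  then show ?thesis unfolding image_image by simp
qed

lemma hisometry_convex_hull:
  assumes T: "hisometry T T'" and X: "X \<subseteq> hyp_plane"
  shows "convex hull (T ` X) = T ` (convex hull X)"
proof
  note D = convex_hull_subset_hyp_plane
  have TX: "T ` X \<subseteq> hyp_plane" using T X by (auto simp: hisometry_def)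
  show "convex hull (T ` X) \<subseteq> T ` (convex hull X)"
    using hisometry_convex_image[OF T D[OF X]] by (intro hull_minimal image_mono hull_subset) auto
  have "X = T' ` T ` X" using hisometry_image_inverse[OF hisometry_inverse[OF T] X] by simp
  also have "\<dots> \<subseteq> T' ` (convex hull (T ` X))" by (intro image_mono hull_subset)
  finally have "convex hull X \<subseteq> T' ` (convex hull (T ` X))"
    using hisometry_convex_image[OF hisometry_inverse[OF T] D[OF TX]] by (intro hull_minimal) auto
  then have "T ` (convex hull X) \<subseteq> T ` T' ` (convex hull (T ` X))" by (rule image_mono)
  also have "\<dots> = convex hull (T ` X)" by (rule hisometry_image_inverse[OF T D[OF TX]])
  finally show "T ` (convex hull X) \<subseteq> convex hull (T ` X)" .
qed

lemma hisometry_rotation: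
  assumes "cmod u = 1" shows "hisometry (\<lambda>z. u * z) (\<lambda>z. cnj u * z)"
proof -
  have u: "(Re u)\<^sup>2 + (Im u)\<^sup>2 = 1" using assms by (metis cmod_power2 one_power2)
  have uu: "cnj u * u = 1" using assms by (simp add: complex_norm_square[symmetric] mult.commute)
  have "(u * z) \<bullet> (u * w) = ((Re u)\<^sup>2 + (Im u)\<^sup>2) * (z \<bullet> w)" for z w
    by (simp add: inner_complex_def algebra_simps power2_eq_square)
  then have "(u * z) \<bullet> (u * w) = z \<bullet> w" for z w using u by simp
  then show ?thesis using assms uu
    by (auto simp: hisometry_def hdist_def norm_mult hyp_plane_def mult.assoc[symmetric]) (simp add: mult.commute)
qed

text \<open>The translation along the real axis that takes t to 0: a Lorentz boost of velocity t,
  read off in the projective coordinates of the model.\<close>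

definition boost :: "real \<Rightarrow> complex \<Rightarrow> complex" where
  "boost t z = Complex ((Re z - t) / (1 - t * Re z)) (sqrt (1 - t\<^sup>2) * Im z / (1 - t * Re z))"

lemma boost_denominator_pos:
  assumes "\<bar>t\<bar> < 1" "\<bar>x\<bar> \<le> 1" shows "0 < 1 - t * (x::real)"
proof -
  have "\<bar>t * x\<bar> \<le> \<bar>t\<bar> * 1" unfolding abs_mult using assms by (intro mult_left_mono) auto
  then show ?thesis using assms by linarith
qed

lemma hyp_plane_Re: "z \<in> hyp_plane \<Longrightarrow> \<bar>Re z\<bar> \<le> 1"
  using abs_Re_le_cmod[of z] by (auto simp: hyp_plane_def)

text \<open>A boost preserves the Lorentz form of the lifts (1, z) and (1, w); rescaling their
  images to first coordinate 1 produces the quotient. The scaling factors cancel in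
  \<open>hdist\<close>.\<close>

lemma boost_inner:
  assumes t: "\<bar>t\<bar> < 1" and z: "\<bar>Re z\<bar> \<le> 1" and w: "\<bar>Re w\<bar> \<le> 1"
  shows "1 - boost t z \<bullet> boost t w = (1 - t\<^sup>2) * (1 - z \<bullet> w) / ((1 - t * Re z) * (1 - t * Re w))"
proof -
  have s: "sqrt (1 - t\<^sup>2) * sqrt (1 - t\<^sup>2) = 1 - t\<^sup>2" using t by (simp add: abs_square_le_1)
  have n: "1 - t * Re z \<noteq> 0" "1 - t * Re w \<noteq> 0"
    using boost_denominator_pos[OF t] z w by (metis less_irrefl)+
  have "boost t z \<bullet> boost t w = ((Re z - t) * (Re w - t) + (sqrt (1 - t\<^sup>2) * sqrt (1 - t\<^sup>2)) * (Im z * Im w)) / ((1 - t * Re z) * (1 - t * Re w))"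
    by (simp add: boost_def inner_complex_def add_divide_distrib mult_ac)
  then have "1 - boost t z \<bullet> boost t w = ((1 - t * Re z) * (1 - t * Re w) - ((Re z - t) * (Re w - t) + (1 - t\<^sup>2) * (Im z * Im w))) / ((1 - t * Re z) * (1 - t * Re w))"
    unfolding s using n by (simp add: diff_divide_distrib)
  also have "(1 - t * Re z) * (1 - t * Re w) - ((Re z - t) * (Re w - t) + (1 - t\<^sup>2) * (Im z * Im w)) = (1 - t\<^sup>2) * (1 - z \<bullet> w)"
    by (simp add: inner_complex_def algebra_simps power2_eq_square)
  finally show ?thesis .
qed

lemma boost_cmod:
  assumes "\<bar>t\<bar> < 1" "\<bar>Re z\<bar> \<le> 1"
  shows "1 - (cmod (boost t z))\<^sup>2 = (1 - t\<^sup>2) * (1 - (cmod z)\<^sup>2) / (1 - t * Re z)\<^sup>2"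
  using boost_inner[OF assms(1,2,2)] by (simp add: dot_square_norm power2_eq_square)

lemma boost_inverse:
  assumes "\<bar>t\<bar> < 1" "\<bar>Re z\<bar> \<le> 1" shows "boost (- t) (boost t z) = z"
proof -
  have p: "0 < 1 - t * Re z" using boost_denominator_pos assms by simp
  have t: "0 < 1 - t\<^sup>2" using assms by (simp add: abs_square_less_1)
  have s: "sqrt (1 - t\<^sup>2) * sqrt (1 - t\<^sup>2) = 1 - t\<^sup>2" using t by simp
  have d: "1 + t * Re (boost t z) = (1 - t\<^sup>2) / (1 - t * Re z)"
    using p by (simp add: boost_def field_simps power2_eq_square)
  have "Re (boost t z) + t = (1 - t\<^sup>2) * Re z / (1 - t * Re z)"
    using p by (simp add: boost_def field_simps power2_eq_square)
  moreover have "sqrt (1 - t\<^sup>2) * Im (boost t z) = (1 - t\<^sup>2) * Im z / (1 - t * Re z)"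
    unfolding boost_def complex.sel times_divide_eq_right mult.assoc[symmetric] s ..
  ultimately show ?thesis
    using p t by (subst boost_def) (simp add: complex_eq_iff d)
qed

lemma hisometry_boost:
  assumes t: "\<bar>t\<bar> < 1" shows "hisometry (boost t) (boost (- t))"
proof -
  have t': "\<bar>- t\<bar> < 1" "0 < 1 - t\<^sup>2" using t by (auto simp: abs_square_less_1)
  have in_plane: "boost s z \<in> hyp_plane" if "z \<in> hyp_plane" "\<bar>s\<bar> < 1" for s z
  proof -
    have "0 < 1 - s * Re z" "0 < 1 - s\<^sup>2" using boost_denominator_pos[OF that(2) hyp_plane_Re[OF that(1)]] that
      by (auto simp: abs_square_less_1)
    then show ?thesis
      using that boost_cmod[OF that(2) hyp_plane_Re[OF that(1)]] by (simp add: hyp_plane_iff)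
  qed
  have "hdist (boost t z) (boost t w) = hdist z w" if z: "z \<in> hyp_plane" and w: "w \<in> hyp_plane" for z w
  proof -
    note r = hyp_plane_Re[OF z] hyp_plane_Re[OF w]
    note p = boost_denominator_pos[OF t r(1)] boost_denominator_pos[OF t r(2)]
    have "sqrt ((1 - (cmod (boost t z))\<^sup>2) * (1 - (cmod (boost t w))\<^sup>2)) =
        sqrt (((1 - t\<^sup>2) / ((1 - t * Re z) * (1 - t * Re w)))\<^sup>2 * ((1 - (cmod z)\<^sup>2) * (1 - (cmod w)\<^sup>2)))"
      unfolding boost_cmod[OF t r(1)] boost_cmod[OF t r(2)]
      by (rule arg_cong[where f = sqrt]) (simp add: power2_eq_square mult_ac)
    also have "\<dots> = (1 - t\<^sup>2) / ((1 - t * Re z) * (1 - t * Re w)) * sqrt ((1 - (cmod z)\<^sup>2) * (1 - (cmod w)\<^sup>2))"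
      unfolding real_sqrt_mult[of "_\<^sup>2"] real_sqrt_abs using p t'(2) by simp
    finally show ?thesis unfolding hdist_def boost_inner[OF t r] using p t'(2) by simp
  qed
  then show ?thesis using in_plane t t' boost_inverse[OF t] boost_inverse[OF t'(1)]
    by (auto simp: hisometry_def hyp_plane_Re)
qed

section \<open>Counterclockwise order and linear maps\<close>

lemma cnj_mult_self: "cnj p * p = of_real ((cmod p)\<^sup>2)"
  unfolding complex_norm_square by (rule mult.commute)

lemma cnj_mult_eq_scaled_quotient:
  assumes "p \<noteq> 0"
  obtains r where "0 < r" "cnj p * z = of_real r * (z / p)"
proof
  show "0 < (cmod p)\<^sup>2" using assms by simp
  show "cnj p * z = of_real ((cmod p)\<^sup>2) * (z / p)"
    unfolding cnj_mult_self[symmetric] using assms by (simp add: mult.assoc)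
qed

text \<open>Arguments in [0, pi), counted from u. Cross products and signs of real multiples behave
  predictably under a linear map, unlike the argument itself.\<close>

definition ccw_half :: "complex \<Rightarrow> complex \<Rightarrow> bool" where
  "ccw_half u v \<longleftrightarrow> 0 < Im (cnj u * v) \<or> Im (cnj u * v) = 0 \<and> 0 < Re (cnj u * v)"

lemma Arg2pi_polar: "z = of_real (cmod z) * cis (Arg2pi z)"
  using Arg2pi_eq[of z] by (simp add: cis_conv_exp)

lemma ccw_half_iff:
  assumes "u \<noteq> 0" "v \<noteq> 0"
  shows "ccw_half u v \<longleftrightarrow> Arg2pi (v / u) < pi"
proof -
  obtain r where r: "0 < r" "cnj u * v = of_real r * (v / u)" using cnj_mult_eq_scaled_quotient[OF assms(1)] .
  define a where "a = Arg2pi (v / u)"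
  define s where "s = r * cmod (v / u)"
  have s: "0 < s" using r assms by (simp add: s_def)
  have "cnj u * v = of_real s * cis a"
    unfolding r(2) by (subst Arg2pi_polar) (simp add: s_def a_def)
  then have "Im (cnj u * v) = s * sin a" "Re (cnj u * v) = s * cos a" by simp_all
  then have "ccw_half u v \<longleftrightarrow> 0 < sin a \<or> sin a = 0 \<and> 0 < cos a"
    unfolding ccw_half_def using s by (simp add: zero_less_mult_iff)
  moreover have a: "0 \<le> a" "a < 2 * pi" using Arg2pi[of "v / u"] by (auto simp: a_def)
  moreover have "0 < sin a \<or> sin a = 0 \<and> 0 < cos a \<longleftrightarrow> a < pi"
  proof (cases "a = 0 \<or> a = pi")
    case False
    then show ?thesis using a sin_gt_zero[of a] sin_lt_zero[of a] by force
  qed auto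
  ultimately show ?thesis by (simp add: a_def)
qed

text \<open>Within one half-plane bounded by the line through 0 and p, two arguments differ by less
  than pi, so the sign of the cross product orders them; otherwise the half-planes decide.\<close>

lemma Arg2pi_le_iff:
  assumes "p \<noteq> 0" "z \<noteq> 0" "q \<noteq> 0"
  shows "Arg2pi (z / p) \<le> Arg2pi (q / p) \<longleftrightarrow>
    (ccw_half p z \<and> \<not> ccw_half p q) \<or> ((ccw_half p z \<longleftrightarrow> ccw_half p q) \<and> 0 \<le> Im (cnj z * q))"
proof -
  define a where "a = Arg2pi (z / p)"
  define b where "b = Arg2pi (q / p)"
  have ab: "0 \<le> a" "a < 2 * pi" "0 \<le> b" "b < 2 * pi"
    using Arg2pi[of "z / p"] Arg2pi[of "q / p"] by (auto simp: a_def b_def)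
  define s where "s = (cmod p)\<^sup>2 * (cmod (z / p) * cmod (q / p))"
  have s: "0 < s" using assms by (simp add: s_def)
  have "cnj z * q = of_real ((cmod p)\<^sup>2) * (cnj (z / p) * (q / p))"
    unfolding cnj_mult_self[symmetric] using assms by simp
  also have "cnj (z / p) * (q / p) = of_real (cmod (z / p) * cmod (q / p)) * (cis (- a) * cis b)"
  proof -
    have 1: "z / p = of_real (cmod (z / p)) * cis a" and 2: "q / p = of_real (cmod (q / p)) * cis b"
      unfolding a_def b_def by (rule Arg2pi_polar)+
    show ?thesis by (subst 1, subst 2) (simp add: cis_cnj del: cis_mult)
  qed
  finally have "Im (cnj z * q) = s * sin (b - a)" by (simp add: cis_mult s_def)
  then have i: "0 \<le> Im (cnj z * q) \<longleftrightarrow> 0 \<le> sin (b - a)" using s by (simp add: zero_le_mult_iff)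
  have same: "0 \<le> sin (b - a) \<longleftrightarrow> a \<le> b" if "\<bar>b - a\<bar> < pi"
    using that sin_ge_zero[of "b - a"] sin_gt_zero[of "a - b"] sin_minus[of "b - a"] by force
  show ?thesis
    unfolding ccw_half_iff[OF assms(1,2)] ccw_half_iff[OF assms(1,3)] i a_def[symmetric] b_def[symmetric]
    using same ab by (cases "a < pi"; cases "b < pi") auto
qed

definition axis_scale :: "real \<Rightarrow> complex \<Rightarrow> complex" where
  "axis_scale s z = Complex (Re z) (s * Im z)"

lemma axis_scale_Im: "Im (cnj (axis_scale s u) * axis_scale s v) = s * Im (cnj u * v)"
  by (simp add: axis_scale_def algebra_simps)

lemma axis_scale_eq_0_iff: "s \<noteq> 0 \<Longrightarrow> axis_scale s z = 0 \<longleftrightarrow> z = 0"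
  by (auto simp: axis_scale_def complex_eq_iff)

text \<open>The map multiplies cross products by s. If the cross product vanishes, v is a real
  multiple of u, and linearity keeps the multiple and its sign.\<close>

lemma ccw_half_axis_scale:
  assumes "0 < s" "u \<noteq> 0"
  shows "ccw_half (axis_scale s u) (axis_scale s v) \<longleftrightarrow> ccw_half u v"
proof (cases "Im (cnj u * v) = 0")
  case True
  define c where "c = Re (cnj u * v) / (cmod u)\<^sup>2"
  have "cnj u * v = of_real (c * (cmod u)\<^sup>2)"
    using True assms by (simp add: c_def complex_eq_iff)
  also have "\<dots> = of_real c * (cnj u * u)" unfolding cnj_mult_self by simp
  finally have "cnj u * v = cnj u * (c *\<^sub>R u)" by (simp add: scaleR_conv_of_real)
  then have v: "v = c *\<^sub>R u" using assms by (metis complex_cnj_zero_iff mult_cancel_left)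
  have "Re (cnj (axis_scale s u) * axis_scale s v) = c * (cmod (axis_scale s u))\<^sup>2"
    unfolding v cmod_power2 by (simp add: axis_scale_def algebra_simps power2_eq_square)
  moreover have "Re (cnj u * v) = c * (cmod u)\<^sup>2"
    unfolding v cmod_power2 by (simp add: algebra_simps power2_eq_square)
  ultimately show ?thesis
    unfolding ccw_half_def axis_scale_Im using True assms axis_scale_eq_0_iff[of s u]
    by (simp add: zero_less_mult_iff)
next
  case False
  then show ?thesis unfolding ccw_half_def axis_scale_Im using assms by (auto simp: zero_less_mult_iff)
qed

lemma Arg2pi_le_axis_scale:
  assumes "0 < s" "p \<noteq> 0" "z \<noteq> 0" "q \<noteq> 0"
  shows "Arg2pi (axis_scale s z / axis_scale s p) \<le> Arg2pi (axis_scale s q / axis_scale s p) \<longleftrightarrow> Arg2pi (z / p) \<le> Arg2pi (q / p)"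
proof -
  have "axis_scale s p \<noteq> 0" "axis_scale s z \<noteq> 0" "axis_scale s q \<noteq> 0" using assms axis_scale_eq_0_iff[of s] by auto
  then show ?thesis
    unfolding Arg2pi_le_iff[OF assms(2-4)] Arg2pi_le_iff[OF \<open>axis_scale s p \<noteq> 0\<close> \<open>axis_scale s z \<noteq> 0\<close> \<open>axis_scale s q \<noteq> 0\<close>]
      ccw_half_axis_scale[OF assms(1,2)] axis_scale_Im using assms(1) by (simp add: zero_le_mult_iff)
qed

lemma Arg2pi_scaled_ratio:
  assumes "0 < r" "0 < r'"
  shows "Arg2pi ((of_real r * z) / (of_real r' * p)) = Arg2pi (z / p)"
proof -
  have "(of_real r * z) / (of_real r' * p) = of_real (r / r') * (z / p)" by simp
  then show ?thesis using Arg2pi_times_of_real[of "r / r'" "z / p"] assms by (simp only:) simp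
qed

text \<open>The boost is, up to a positive factor, an orientation preserving linear map on vectors based at \<open>t\<close>.\<close>

lemma boost_eq:
  "boost t z = of_real (1 / (1 - t * Re z)) * axis_scale (sqrt (1 - t\<^sup>2)) (z - of_real t)"
  by (simp add: boost_def axis_scale_def complex_eq_iff)

lemma ccw_arc_boost:
  assumes t: "\<bar>t\<bar> < 1" and D: "p \<in> hyp_plane" "q \<in> hyp_plane" "z \<in> hyp_plane"
    and ne: "p \<noteq> of_real t" "q \<noteq> of_real t" "z \<noteq> of_real t"
  shows "boost t z \<in> ccw_arc 0 r (boost t p) (boost t q) \<longleftrightarrow> z \<in> ccw_arc (of_real t) r p q"
proof -
  let ?A = "axis_scale (sqrt (1 - t\<^sup>2))"
  have s: "0 < sqrt (1 - t\<^sup>2)" using t by (simp add: abs_square_less_1)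
  have c: "of_real t \<in> hyp_plane" using t by (simp add: hyp_plane_def)
  have b0: "boost t (of_real t) = 0" by (simp add: boost_def complex_eq_iff)
  have arg: "Arg2pi (boost t w / boost t p) = Arg2pi (?A (w - of_real t) / ?A (p - of_real t))"
    if "w \<in> hyp_plane" for w
    unfolding boost_eq using boost_denominator_pos[OF t hyp_plane_Re] that D(1)
    by (intro Arg2pi_scaled_ratio) auto
  have z1: "?A (p - of_real t) / ?A (p - of_real t) = 1"
    using ne(1) axis_scale_eq_0_iff[of "sqrt (1 - t\<^sup>2)" "p - of_real t"] s by simp
  \<comment> \<open>Since \<open>Arg2pi 1 = 0\<close>, strict positivity is the negated comparison
    with p itself, so \<open>Arg2pi_le_axis_scale\<close> settles this condition as well.\<close>
  have "0 < Arg2pi (?A (z - of_real t) / ?A (p - of_real t)) \<longleftrightarrow> \<not> Arg2pi (?A (z - of_real t) / ?A (p - of_real t)) \<le> Arg2pi (?A (p - of_real t) / ?A (p - of_real t))"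
    unfolding z1 using Arg2pi_of_real[of 1] by (simp add: not_le)
  also have "\<dots> \<longleftrightarrow> \<not> Arg2pi ((z - of_real t) / (p - of_real t)) \<le> Arg2pi ((p - of_real t) / (p - of_real t))"
    using Arg2pi_le_axis_scale[OF s, of "p - of_real t" "z - of_real t" "p - of_real t"] ne by simp
  also have "\<dots> \<longleftrightarrow> 0 < Arg2pi ((z - of_real t) / (p - of_real t))"
    using ne Arg2pi_of_real[of 1] by (simp add: not_le)
  finally have pos: "0 < Arg2pi (?A (z - of_real t) / ?A (p - of_real t)) \<longleftrightarrow> 0 < Arg2pi ((z - of_real t) / (p - of_real t))" .
  have "hdist 0 (boost t z) = hdist (of_real t) z" "boost t z \<in> hyp_plane"
    using hisometry_boost[OF t] c D(3) b0 unfolding hisometry_def by metis+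
  then show ?thesis
    unfolding ccw_arc_def hcircle_def using D(3) pos Arg2pi_le_axis_scale[OF s, of "p - of_real t" "z - of_real t" "q - of_real t"] ne
    by (simp add: arg[OF D(2)] arg[OF D(3)])
qed

lemma ccw_arc_rotation:
  assumes u: "cmod u = 1" and D: "c \<in> hyp_plane" "z \<in> hyp_plane"
  shows "u * z \<in> ccw_arc (u * c) r (u * p) (u * q) \<longleftrightarrow> z \<in> ccw_arc c r p q"
proof -
  have "u \<noteq> 0" using u by auto
  then have "(u * w - u * c) / (u * p - u * c) = (w - c) / (p - c)" for w
    by (metis nonzero_mult_divide_mult_cancel_left right_diff_distrib)
  moreover have "u * z \<in> hcircle (u * c) r \<longleftrightarrow> z \<in> hcircle c r"
    using hisometry_rotation[OF u] D unfolding hcircle_def hisometry_def by auto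
  ultimately show ?thesis by (simp add: ccw_arc_def)
qed

section \<open>Invariance of hyperbolic area\<close>

lemma borel_measurable_Complex:
  assumes "f \<in> borel_measurable M" "g \<in> borel_measurable M"
  shows "(\<lambda>x. Complex (f x) (g x)) \<in> borel_measurable M"
proof -
  have "(\<lambda>x. Complex (f x) (g x)) = (\<lambda>x. complex_of_real (f x) + \<i> * complex_of_real (g x))"
    by (rule ext) (simp only: complex_eq_iff, simp)
  also have "\<dots> \<in> borel_measurable M" using assms by measurable
  finally show ?thesis .
qed

lemma borel_measurable_Re_Im: "Re \<in> borel_measurable borel" "Im \<in> borel_measurable borel"
  by (auto intro!: borel_measurable_continuous_onI continuous_intros)

lemma lborel_complex: "lborel = distr (lborel \<Otimes>\<^sub>M lborel) borel (\<lambda>p. Complex (fst p) (snd p))"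
proof (rule lborel_eqI)
  fix l u :: complex assume "\<And>b. b \<in> Basis \<Longrightarrow> l \<bullet> b \<le> u \<bullet> b"
  from this[of 1] this[of \<i>] have le: "Re l \<le> Re u" "Im l \<le> Im u"
    by (auto simp: Basis_complex_def inner_complex_def)
  have M: "(\<lambda>p. Complex (fst p) (snd p)) \<in> measurable (lborel \<Otimes>\<^sub>M lborel) borel"
    by (intro borel_measurable_Complex) measurable
  have "(\<lambda>p. Complex (fst p) (snd p)) -` box l u \<inter> space (lborel \<Otimes>\<^sub>M lborel) = {Re l<..<Re u} \<times> {Im l<..<Im u}"
    by (auto simp: space_pair_measure in_box_complex_iff)
  then have "emeasure (distr (lborel \<Otimes>\<^sub>M lborel) borel (\<lambda>p. Complex (fst p) (snd p))) (box l u)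
      = emeasure lborel {Re l<..<Re u} * emeasure lborel {Im l<..<Im u}"
    by (subst emeasure_distr[OF M]) (auto simp: lborel.emeasure_pair_measure_Times)
  then show "emeasure (distr (lborel \<Otimes>\<^sub>M lborel) borel (\<lambda>p. Complex (fst p) (snd p))) (box l u) = (\<Prod>b\<in>Basis. (u - l) \<bullet> b)"
    using le by (simp add: Basis_complex_def inner_complex_def ennreal_mult)
qed simp

lemma nn_integral_complex:
  assumes f: "f \<in> borel_measurable borel"
  shows "(\<integral>\<^sup>+z. f z \<partial>lborel) = (\<integral>\<^sup>+x. \<integral>\<^sup>+y. f (Complex x y) \<partial>lborel \<partial>lborel)"
    and "(\<integral>\<^sup>+z. f z \<partial>lborel) = (\<integral>\<^sup>+y. \<integral>\<^sup>+x. f (Complex x y) \<partial>lborel \<partial>lborel)"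
proof -
  have M: "(\<lambda>p. Complex (fst p) (snd p)) \<in> measurable (lborel \<Otimes>\<^sub>M lborel) borel"
    by (intro borel_measurable_Complex) measurable
  have f': "(\<lambda>p. f (Complex (fst p) (snd p))) \<in> borel_measurable (lborel \<Otimes>\<^sub>M lborel)"
    using measurable_compose[OF M f] .
  have eq: "(\<integral>\<^sup>+z. f z \<partial>lborel) = (\<integral>\<^sup>+p. f (Complex (fst p) (snd p)) \<partial>(lborel \<Otimes>\<^sub>M lborel))"
    by (subst lborel_complex) (simp add: nn_integral_distr[OF M] f)
  show "(\<integral>\<^sup>+z. f z \<partial>lborel) = (\<integral>\<^sup>+x. \<integral>\<^sup>+y. f (Complex x y) \<partial>lborel \<partial>lborel)"
    unfolding eq by (subst lborel.nn_integral_fst[OF f', symmetric]) simp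
  show "(\<integral>\<^sup>+z. f z \<partial>lborel) = (\<integral>\<^sup>+y. \<integral>\<^sup>+x. f (Complex x y) \<partial>lborel \<partial>lborel)"
    unfolding eq by (subst lborel_pair.nn_integral_snd[OF f', symmetric]) simp
qed

lemma nn_integral_shift:
  assumes "f \<in> borel_measurable borel"
  shows "(\<integral>\<^sup>+x. f (x + t) \<partial>lborel) = (\<integral>\<^sup>+x. f x \<partial>(lborel :: real measure))"
  using nn_integral_real_affine[OF assms, of 1 t] by (simp add: add.commute)

lemma nn_integral_shear_Re:
  assumes f: "f \<in> borel_measurable borel"
  shows "(\<integral>\<^sup>+z. f (Complex (Re z + t * Im z) (Im z)) \<partial>lborel) = (\<integral>\<^sup>+z. f z \<partial>lborel)"
proof -
  have M: "(\<lambda>z. f (Complex (Re z + t * Im z) (Im z))) \<in> borel_measurable borel"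
    by (intro measurable_compose[OF _ f] borel_measurable_Complex borel_measurable_add borel_measurable_times
        borel_measurable_const borel_measurable_Re_Im)
  have M2: "(\<lambda>x. f (Complex x y)) \<in> borel_measurable borel" for y
    by (intro measurable_compose[OF _ f] borel_measurable_Complex) auto
  show ?thesis
    using nn_integral_shift[OF M2] by (simp add: nn_integral_complex(2)[OF M] nn_integral_complex(2)[OF f])
qed

lemma nn_integral_shear_Im:
  assumes f: "f \<in> borel_measurable borel"
  shows "(\<integral>\<^sup>+z. f (Complex (Re z) (Im z + t * Re z)) \<partial>lborel) = (\<integral>\<^sup>+z. f z \<partial>lborel)"
proof -
  have M: "(\<lambda>z. f (Complex (Re z) (Im z + t * Re z))) \<in> borel_measurable borel"
    by (intro measurable_compose[OF _ f] borel_measurable_Complex borel_measurable_add borel_measurable_times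
        borel_measurable_const borel_measurable_Re_Im)
  have M2: "(\<lambda>y. f (Complex x y)) \<in> borel_measurable borel" for x
    by (intro measurable_compose[OF _ f] borel_measurable_Complex) auto
  show ?thesis
    using nn_integral_shift[OF M2] by (simp add: nn_integral_complex(1)[OF M] nn_integral_complex(1)[OF f])
qed

text \<open>A rotation by an angle other than \<open>pi\<close> is a product of three shears.\<close>

lemma nn_integral_rotation:
  assumes f: "f \<in> borel_measurable borel" and u: "cmod u = 1"
  shows "(\<integral>\<^sup>+z. f (u * z) \<partial>lborel) = (\<integral>\<^sup>+z. f z \<partial>lborel)"
proof -
  have main: "(\<integral>\<^sup>+z. f (u * z) \<partial>lborel) = (\<integral>\<^sup>+z. f z \<partial>lborel)"
    if f: "f \<in> borel_measurable borel" and u: "cmod u = 1" and u1: "u \<noteq> -1" for f u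
  proof -
    have uu: "(Re u)\<^sup>2 + (Im u)\<^sup>2 = 1" using u by (metis cmod_power2 one_power2)
    have nz: "1 + Re u \<noteq> 0"
    proof
      assume "1 + Re u = 0"
      then have "Re u = -1" by simp
      then have "Im u = 0" using uu by simp
      then show False using \<open>Re u = -1\<close> u1 by (simp add: complex_eq_iff)
    qed
    \<comment> \<open>For u = cis phi the three shears have coefficients - tan (phi / 2), sin phi, -
      tan (phi / 2), and tan (phi / 2) = Im u / (1 + Re u).\<close>
    define t where "t = - (Im u / (1 + Re u))"
    have t1: "t * (1 + Re u) = - Im u" using nz by (simp add: t_def)
    have "t * Im u * (1 + Re u) = t * (1 + Re u) * Im u" by simp
    also have "\<dots> = - (Im u)\<^sup>2" unfolding t1 by (simp add: power2_eq_square)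
    also have "\<dots> = (Re u - 1) * (1 + Re u)" using uu by (simp add: algebra_simps power2_eq_square)
    finally have "t * Im u * (1 + Re u) = (Re u - 1) * (1 + Re u)" .
    then have t2: "t * Im u = Re u - 1" using nz by simp
    define g where "g z = f (Complex (Re z + t * Im z) (Im z))" for z
    define h where "h z = g (Complex (Re z) (Im z + Im u * Re z))" for z
    have M: "g \<in> borel_measurable borel" "h \<in> borel_measurable borel"
      unfolding g_def h_def
      by (intro measurable_compose[OF _ f] borel_measurable_Complex borel_measurable_add borel_measurable_times
        borel_measurable_const borel_measurable_Re_Im | simp)+
    have "f (u * z) = h (Complex (Re z + t * Im z) (Im z))" for z
    proof -
      have "Re z + t * Im z + t * (Im z + Im u * (Re z + t * Im z))
        = Re z * (1 + t * Im u) + Im z * (t + t + (t * Im u) * t)" by (simp add: algebra_simps)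
      also have "\<dots> = Re z * Re u + Im z * (t * (1 + Re u))" unfolding t2 by (simp add: algebra_simps)
      finally have 1: "Re z + t * Im z + t * (Im z + Im u * (Re z + t * Im z)) = Re z * Re u - Im z * Im u"
        unfolding t1 by simp
      have "Im z + Im u * (Re z + t * Im z) = Im z * (1 + t * Im u) + Im u * Re z" by (simp add: algebra_simps)
      then have 2: "Im z + Im u * (Re z + t * Im z) = Im z * Re u + Im u * Re z" unfolding t2 by simp
      show ?thesis unfolding h_def g_def complex.sel 1
        by (rule arg_cong[where f = f]) (simp add: complex_eq_iff 2 mult.commute)
    qed
    then have "(\<integral>\<^sup>+z. f (u * z) \<partial>lborel) = (\<integral>\<^sup>+z. h z \<partial>lborel)"
      using nn_integral_shear_Re[OF M(2)] by simp
    also have "\<dots> = (\<integral>\<^sup>+z. g z \<partial>lborel)" unfolding h_def by (rule nn_integral_shear_Im[OF M(1)])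
    also have "\<dots> = (\<integral>\<^sup>+z. f z \<partial>lborel)" unfolding g_def by (rule nn_integral_shear_Re[OF f])
    finally show ?thesis .
  qed
  show ?thesis
  proof (cases "u = -1")
    \<comment> \<open>The half turn is the square of the quarter turn \<open>\<i>\<close>, which is
      already covered.\<close>
    case True
    have "(\<lambda>z. f (\<i> * z)) \<in> borel_measurable borel"
      by (intro measurable_compose[OF _ f]) simp
    from main[OF this, of \<i>] have "(\<integral>\<^sup>+z. f (- z) \<partial>lborel) = (\<integral>\<^sup>+z. f (\<i> * z) \<partial>lborel)"
      by (simp add: complex_eq_iff mult.assoc[symmetric])
    also have "\<dots> = (\<integral>\<^sup>+z. f z \<partial>lborel)" using main[OF f, of \<i>] by (simp add: complex_eq_iff)
    finally show ?thesis using True by simp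
  qed (use main f u in blast)
qed

section \<open>The hyperbolic area measure under rotations and boosts\<close>

definition klein_density :: "complex \<Rightarrow> real" where
  "klein_density z = (if z \<in> hyp_plane then (1 - (cmod z)\<^sup>2) powr (- 3 / 2) else 0)"

lemma borel_measurable_klein_density: "klein_density \<in> borel_measurable borel"
proof -
  have "hyp_plane \<in> sets borel" by (simp add: hyp_plane_def)
  then show ?thesis unfolding klein_density_def by measurable
qed

lemma hmeasure_eq: "hmeasure = density lborel (\<lambda>z. ennreal (klein_density z))"
  unfolding hmeasure_def klein_density_def by (rule arg_cong[where f = "density lborel"]) auto

lemma sets_hmeasure: "sets hmeasure = sets borel" by (simp add: hmeasure_def)

lemma emeasure_hmeasure:
  assumes "A \<in> sets borel"
  shows "emeasure hmeasure A = (\<integral>\<^sup>+z. ennreal (klein_density z) * indicator A z \<partial>lborel)"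
  unfolding hmeasure_eq using assms borel_measurable_klein_density by (simp add: emeasure_density)

lemma klein_density_rotation: "cmod u = 1 \<Longrightarrow> klein_density (u * z) = klein_density z"
  by (simp add: klein_density_def hyp_plane_def norm_mult)

lemma hmeasure_rotation:
  assumes A: "A \<in> sets borel" and u: "cmod u = 1"
  shows "emeasure hmeasure ((\<lambda>z. u * z) -` A) = emeasure hmeasure A"
proof -
  have M: "(\<lambda>z. ennreal (klein_density z) * indicator A z) \<in> borel_measurable borel"
    using A borel_measurable_klein_density by measurable
  have "(\<lambda>z. u * z) \<in> borel_measurable borel" by simp
  from measurable_sets[OF this A] have "(\<lambda>z. u * z) -` A \<in> sets borel" by simp
  then show ?thesis
    using nn_integral_rotation[OF M u]
    by (simp add: emeasure_hmeasure A klein_density_rotation[OF u] indicator_def vimage_def)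
qed

text \<open>The first two factors form the Jacobian of \<open>boost t\<close>, whose real part
  depends on Re z only and whose imaginary part is linear in Im z. With s = 1 - t^2 and p = 1 - t Re
  z their product is (s / p^2) powr (3 / 2), while 1 - |z|^2 is multiplied by s / p^2.\<close>

lemma klein_density_boost:
  assumes t: "\<bar>t\<bar> < 1" and z: "\<bar>Re z\<bar> \<le> 1"
  shows "(1 - t\<^sup>2) / (1 - t * Re z)\<^sup>2 * (sqrt (1 - t\<^sup>2) / (1 - t * Re z)) * klein_density (boost t z) = klein_density z"
proof -
  define p where "p = 1 - t * Re z"
  define s where "s = 1 - t\<^sup>2"
  define d where "d = 1 - (cmod z)\<^sup>2"
  have p: "0 < p" using boost_denominator_pos[OF t z] by (simp add: p_def)
  have s: "0 < s" using t by (simp add: s_def abs_square_less_1)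
  have b: "1 - (cmod (boost t z))\<^sup>2 = s * d / p\<^sup>2" using boost_cmod[OF t z] by (simp add: s_def d_def p_def)
  have iff: "boost t z \<in> hyp_plane \<longleftrightarrow> z \<in> hyp_plane"
    unfolding hyp_plane_iff b d_def[symmetric] using p s by (simp add: zero_less_divide_iff zero_less_mult_iff)
  show ?thesis
  proof (cases "z \<in> hyp_plane")
    case True
    then have d: "0 < d" by (simp add: d_def hyp_plane_iff)
    have sp: "s / p\<^sup>2 * (sqrt s / p) = (s / p\<^sup>2) powr (3 / 2)"
    proof -
      have "(s / p\<^sup>2) powr (3 / 2) = (s / p\<^sup>2) powr (1 + 1 / 2)" by simp
      also have "\<dots> = (s / p\<^sup>2) * sqrt (s / p\<^sup>2)" using s p by (subst powr_add) (simp add: powr_half_sqrt)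
      also have "sqrt (s / p\<^sup>2) = sqrt s / p" using p by (simp add: real_sqrt_divide)
      finally show ?thesis by simp
    qed
    have "s * d / p\<^sup>2 = (s / p\<^sup>2) * d" by simp
    then have "(s * d / p\<^sup>2) powr (- 3 / 2) = (s / p\<^sup>2) powr (- (3 / 2)) * d powr (- 3 / 2)"
      by (simp only:) (subst powr_mult, use s d p in \<open>auto\<close>)
    also have "(s / p\<^sup>2) powr (- (3 / 2)) = inverse ((s / p\<^sup>2) powr (3 / 2))" by (rule powr_minus)
    finally have "(s / p\<^sup>2 * (sqrt s / p)) * (s * d / p\<^sup>2) powr (- 3 / 2) = d powr (- 3 / 2)"
      unfolding sp using s p by simp
    then show ?thesis using True iff b by (simp add: klein_density_def s_def p_def d_def)
  qed (simp add: klein_density_def iff)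
qed

text \<open>A boost maps vertical lines to vertical lines and is linear on each of them. So the
  change of variables splits by Fubini into a substitution by the Moebius map \<open>m\<close> in
  the real part and a scaling by \<open>k u\<close> in the imaginary part.\<close>

lemma nn_integral_boost:
  assumes t: "\<bar>t\<bar> < 1" and f: "f \<in> borel_measurable borel"
  shows "(\<integral>\<^sup>+z. ennreal (klein_density z) * f z \<partial>lborel) = (\<integral>\<^sup>+z. ennreal (klein_density z) * f (boost t z) \<partial>lborel)"
proof -
  define m where "m u = (u - t) / (1 - t * u)" for u
  define m' where "m' u = (1 - t\<^sup>2) / (1 - t * u)\<^sup>2" for u
  define k where "k u = sqrt (1 - t\<^sup>2) / (1 - t * u)" for u
  have s: "0 < 1 - t\<^sup>2" using t by (simp add: abs_square_less_1)
  have pos: "0 < 1 - t * u" if "u \<in> {-1..1}" for u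
    using boost_denominator_pos[OF t, of u] that by auto
  have k: "0 < k u" "0 \<le> m' u" if "u \<in> {-1..1}" for u using pos[OF that] s by (simp_all add: k_def m'_def)
  have m1: "m (-1) = -1" "m 1 = 1" using pos[of "-1"] pos[of 1] by (auto simp: m_def divide_eq_eq)
  have der: "(m has_real_derivative m' u) (at u)" if "u \<in> {-1..1}" for u
    using pos[OF that] unfolding m_def[abs_def] m'_def
    by (auto intro!: derivative_eq_intros simp: field_simps power2_eq_square)
  have cont: "continuous_on {-1..1} m'"
  proof -
    have "(1 - t * u)\<^sup>2 \<noteq> 0" if "u \<in> {-1..1}" for u using pos[OF that] by simp
    then show ?thesis unfolding m'_def[abs_def] by (intro continuous_intros ballI)
  qed
  have MF: "(\<lambda>z. ennreal (klein_density z) * f z) \<in> borel_measurable borel"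
    using f borel_measurable_klein_density by measurable
  define F where "F z = ennreal (klein_density z) * f z" for z
  have F: "F \<in> borel_measurable borel" using MF by (simp add: F_def[abs_def])
  have slice: "(\<lambda>y. F (Complex x y)) \<in> borel_measurable borel" for x
    by (intro measurable_compose[OF _ F] borel_measurable_Complex) auto
  define h where "h x = (\<integral>\<^sup>+y. F (Complex x y) \<partial>lborel)" for x
  have Mh: "h \<in> borel_measurable borel"
  proof -
    have "(\<lambda>p. F (Complex (fst p) (snd p))) \<in> borel_measurable (borel \<Otimes>\<^sub>M lborel)"
      by (intro measurable_compose[OF _ F] borel_measurable_Complex) measurable
    then show ?thesis unfolding h_def by (intro lborel.borel_measurable_nn_integral) (simp add: case_prod_beta)
  qed
  have F0: "F (Complex x y) = 0" if "x \<notin> {-1..1}" for x y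
    using that hyp_plane_Re[of "Complex x y"] by (auto simp: F_def klein_density_def)
  have boostF: "ennreal (m' u) * (ennreal (k u) * F (boost t (Complex u v))) = ennreal (klein_density (Complex u v)) * f (boost t (Complex u v))"
    if "u \<in> {-1..1}" for u v
  proof -
    have "ennreal (m' u) * (ennreal (k u) * F (boost t (Complex u v))) =
       ennreal (m' u * k u * klein_density (boost t (Complex u v))) * f (boost t (Complex u v))"
      using k[OF that] unfolding F_def
      by (simp add: ennreal_mult mult.assoc klein_density_def)
    also have "m' u * k u * klein_density (boost t (Complex u v)) = klein_density (Complex u v)"
      unfolding m'_def k_def using klein_density_boost[OF t, of "Complex u v"] that by (simp add: abs_le_iff)
    finally show ?thesis .
  qed
  have Mb: "(\<lambda>z. f (boost t z)) \<in> borel_measurable borel"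
    unfolding boost_def
    by (intro measurable_compose[OF _ f] borel_measurable_Complex borel_measurable_divide borel_measurable_diff borel_measurable_times
        borel_measurable_const borel_measurable_Re_Im)
  have MG: "(\<lambda>z. ennreal (klein_density z) * f (boost t z)) \<in> borel_measurable borel"
    using Mb borel_measurable_klein_density by measurable
  have "(\<integral>\<^sup>+z. F z \<partial>lborel) = (\<integral>\<^sup>+x. h x \<partial>lborel)" unfolding h_def by (rule nn_integral_complex(1)[OF F])
  \<comment> \<open>\<open>m\<close> fixes -1 and 1, and the density vanishes outside the strip
    between them, so the substitution can run over a compact interval.\<close>
  also have "\<dots> = (\<integral>\<^sup>+x. h x * indicator {m (-1)..m 1} x \<partial>lborel)"
    unfolding m1 using F0 by (intro nn_integral_cong) (auto simp: h_def indicator_def)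
  also have "\<dots> = (\<integral>\<^sup>+u. h (m u) * ennreal (m' u) * indicator {-1..1} u \<partial>lborel)"
    using nn_integral_substitution_aux[OF Mh _ der cont k(2)] by simp
  also have "\<dots> = (\<integral>\<^sup>+u. \<integral>\<^sup>+v. ennreal (klein_density (Complex u v)) * f (boost t (Complex u v)) \<partial>lborel \<partial>lborel)"
  proof (intro nn_integral_cong)
    fix u :: real
    show "h (m u) * ennreal (m' u) * indicator {-1..1} u = (\<integral>\<^sup>+v. ennreal (klein_density (Complex u v)) * f (boost t (Complex u v)) \<partial>lborel)"
    proof (cases "u \<in> {-1..1}")
      case True
      have "h (m u) = ennreal (k u) * (\<integral>\<^sup>+v. F (Complex (m u) (k u * v)) \<partial>lborel)"
        unfolding h_def using nn_integral_real_affine[OF slice, of "k u" "m u" 0] k[OF True] by simp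
      also have "\<dots> = (\<integral>\<^sup>+v. ennreal (k u) * F (boost t (Complex u v)) \<partial>lborel)"
      proof (subst nn_integral_cmult[symmetric])
        show "(\<lambda>v. F (Complex (m u) (k u * v))) \<in> borel_measurable lborel"
          using measurable_compose[OF _ slice, of "\<lambda>v. k u * v" lborel "m u"] by simp
      qed (simp add: boost_def m_def k_def)
      finally have hm: "h (m u) = (\<integral>\<^sup>+v. ennreal (k u) * F (boost t (Complex u v)) \<partial>lborel)" .
      have "(\<lambda>v. F (boost t (Complex u v))) = (\<lambda>v. F (Complex (m u) (k u * v)))"
        by (simp add: boost_def m_def k_def)
      then have "(\<lambda>v. F (boost t (Complex u v))) \<in> borel_measurable borel"
        using measurable_compose[OF _ slice, of "\<lambda>v. k u * v" borel "m u"] by simp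
      then have "h (m u) * ennreal (m' u) = (\<integral>\<^sup>+v. ennreal (m' u) * (ennreal (k u) * F (boost t (Complex u v))) \<partial>lborel)"
        unfolding hm by (subst nn_integral_cmult) (auto simp: mult.commute)
      then show ?thesis using True by (simp add: boostF)
    next
      case False
      then have "klein_density (Complex u v) = 0" for v
        using hyp_plane_Re[of "Complex u v"] by (auto simp: klein_density_def)
      then show ?thesis using False by simp
    qed
  qed
  also have "\<dots> = (\<integral>\<^sup>+z. ennreal (klein_density z) * f (boost t z) \<partial>lborel)"
    by (rule nn_integral_complex(1)[OF MG, symmetric])
  finally show ?thesis by (simp add: F_def)
qed

lemma borel_measurable_boost: "boost t \<in> borel_measurable borel"
  unfolding boost_def[abs_def]
  by (intro borel_measurable_Complex borel_measurable_divide borel_measurable_diff borel_measurable_times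
      borel_measurable_const borel_measurable_Re_Im)

lemma hmeasure_boost:
  assumes A: "A \<in> sets borel" and t: "\<bar>t\<bar> < 1"
  shows "emeasure hmeasure (boost t -` A) = emeasure hmeasure A"
proof -
  have f: "indicator A \<in> borel_measurable borel" using A by simp
  have "boost t -` A \<in> sets borel" using measurable_sets[OF borel_measurable_boost A] by simp
  then show ?thesis using nn_integral_boost[OF t f] A
    by (simp add: emeasure_hmeasure indicator_def vimage_def)
qed

section \<open>Area of polygons inscribed in a circle\<close>

lemma powr_minus_three_halves: "0 < D \<Longrightarrow> D powr (- 3 / 2) = 1 / (D * sqrt (D::real))"
proof -
  assume D: "0 < D"
  have "D powr (- 3 / 2) = D powr (- (1 + 1 / 2))" by simp
  also have "\<dots> = inverse (D powr (1 + 1 / 2))" by (rule powr_minus)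
  also have "D powr (1 + 1 / 2) = D * sqrt D" using D by (subst powr_add) (simp add: powr_half_sqrt)
  finally show "D powr (- 3 / 2) = 1 / (D * sqrt D)" by (simp only: inverse_eq_divide)
qed

text \<open>\<open>H\<close> is an antiderivative of the density along the chord, and at both ends 1
  - x^2 - y^2 equals 1 - r^2.\<close>

lemma nn_integral_klein_chord:
  assumes r: "0 < r" "r < 1" and x: "\<bar>x\<bar> \<le> r" and "q = sqrt (r\<^sup>2 - x\<^sup>2)"
  shows "(\<integral>\<^sup>+y. ennreal (klein_density (Complex x y)) * indicator {-q..q} y \<partial>lborel)
     = ennreal (2 * q / ((1 - x\<^sup>2) * sqrt (1 - r\<^sup>2)))"
proof -
  define H where "H y = y / ((1 - x\<^sup>2) * sqrt (1 - x\<^sup>2 - y\<^sup>2))" for y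
  have x2: "x\<^sup>2 \<le> r\<^sup>2" using x r by (simp add: abs_le_square_iff[symmetric])
  have r2: "r\<^sup>2 < 1" using r by (simp add: power_less_one_iff)
  have q: "0 \<le> q" "q\<^sup>2 = r\<^sup>2 - x\<^sup>2" using x2 assms(4) by auto
  have pos: "0 < 1 - x\<^sup>2 - y\<^sup>2" if "y \<in> {-q..q}" for y
  proof -
    have "\<bar>y\<bar> \<le> \<bar>q\<bar>" using that q(1) by auto
    then have "y\<^sup>2 \<le> q\<^sup>2" by (simp only: abs_le_square_iff)
    then show ?thesis using q r2 by simp
  qed
  have x1: "0 < 1 - x\<^sup>2" using x2 r2 by simp
  have kd: "klein_density (Complex x y) = 1 / ((1 - x\<^sup>2 - y\<^sup>2) * sqrt (1 - x\<^sup>2 - y\<^sup>2))" if "y \<in> {-q..q}" for y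
  proof -
    have "1 - (cmod (Complex x y))\<^sup>2 = 1 - x\<^sup>2 - y\<^sup>2" by (simp add: cmod_power2)
    then show ?thesis using pos[OF that] powr_minus_three_halves[OF pos[OF that]]
      by (simp only: klein_density_def hyp_plane_iff if_True)
  qed
  have M: "(\<lambda>y. klein_density (Complex x y)) \<in> borel_measurable borel"
    by (intro measurable_compose[OF _ borel_measurable_klein_density] borel_measurable_Complex) auto
  have "(\<integral>\<^sup>+y. ennreal (klein_density (Complex x y)) * indicator {-q..q} y \<partial>lborel) = ennreal (H q - H (-q))"
  proof (rule nn_integral_FTC_Icc[OF M])
    fix y assume y: "y \<in> {-q..q}"
    show "0 \<le> klein_density (Complex x y)" by (simp add: klein_density_def)
    define D where "D = 1 - x\<^sup>2 - y\<^sup>2"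
    have D: "0 < D" using pos[OF y] by (simp add: D_def)
    have "((\<lambda>y. y / ((1 - x\<^sup>2) * sqrt (1 - x\<^sup>2 - y\<^sup>2))) has_real_derivative
       ((1 - x\<^sup>2) * sqrt D + y * ((1 - x\<^sup>2) * (y / sqrt D))) / ((1 - x\<^sup>2) * sqrt D * ((1 - x\<^sup>2) * sqrt D))) (at y)"
      using D x1 unfolding D_def by (auto intro!: derivative_eq_intros simp: divide_simps)
    moreover have "((1 - x\<^sup>2) * sqrt D + y * ((1 - x\<^sup>2) * (y / sqrt D))) / ((1 - x\<^sup>2) * sqrt D * ((1 - x\<^sup>2) * sqrt D))
      = (sqrt D * sqrt D + y\<^sup>2) / (sqrt D * ((1 - x\<^sup>2) * (sqrt D * sqrt D)))"
    proof -
      have "(X * s + y * (X * (y / s))) / (X * s * (X * s)) = (s * s + y\<^sup>2) / (s * (X * (s * s)))"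
        if "X \<noteq> 0" "s \<noteq> 0" for X s :: real
        using that by (simp add: field_simps power2_eq_square)
      then show ?thesis using D x1 by simp
    qed
    moreover have "\<dots> = 1 / (D * sqrt D)" using D x1 by (simp add: D_def)
    ultimately have "(H has_real_derivative 1 / (D * sqrt D)) (at y)" by (simp add: H_def[abs_def])
    then show "(H has_real_derivative klein_density (Complex x y)) (at y)"
      using kd[OF y] by (simp add: D_def)
  qed (use q in auto)
  also have "H q - H (-q) = 2 * q / ((1 - x\<^sup>2) * sqrt (1 - r\<^sup>2))"
    using q by (simp add: H_def add_divide_distrib[symmetric])
  finally show ?thesis .
qed

text \<open>A sector of half angle a, in a disc whose hyperbolic radius has cosh c, has area 2 a (c
  - 1); the triangle over its chord is removed, or added when a exceeds pi / 2.\<close>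

definition cap_area :: "real \<Rightarrow> real \<Rightarrow> real" where
  "cap_area c a = 2 * c * a - 2 * a - tri_area c a"

text \<open>\<open>G\<close> comes from the substitution x = r cos u, under which the denominator in
  the derivative of \<open>tri_area\<close> becomes (1 - x^2) / (1 - r^2). As \<open>arccos\<close>
  is not differentiable at 1, only continuity is available at x = r, which the interior form of the
  fundamental theorem allows.\<close>

lemma has_integral_cap:
  assumes r: "0 < r" "r < 1" and a: "0 \<le> a" "a \<le> pi" and c: "c = 1 / sqrt (1 - r\<^sup>2)"
  shows "((\<lambda>x. 2 * sqrt (r\<^sup>2 - x\<^sup>2) / ((1 - x\<^sup>2) * sqrt (1 - r\<^sup>2))) has_integral cap_area c a) {r * cos a..r}"
proof -
  define G where "G x = - cap_area c (arccos (x / r))" for x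
  have r2: "0 < 1 - r\<^sup>2" using r by (simp add: power_less_one_iff)
  have c0: "0 < c" "c\<^sup>2 = 1 / (1 - r\<^sup>2)" using r2 by (auto simp: c power_divide)
  have derc: "(cap_area c has_real_derivative 2 * c - 2 * c / ((cos u)\<^sup>2 + c\<^sup>2 * (sin u)\<^sup>2)) (at u)" for u
    unfolding cap_area_def[abs_def]
    by (auto intro!: derivative_eq_intros tri_area_has_real_derivative[OF c0(1)] simp: algebra_simps)
  have contc: "continuous_on UNIV (cap_area c)"
    using derc by (meson DERIV_isCont continuous_at_imp_continuous_on)
  have bnd: "-1 \<le> x / r \<and> x / r \<le> 1" if "x \<in> {r * cos a..r}" for x
  proof -
    have "r * (-1) \<le> r * cos a" using r by (intro mult_left_mono) auto
    then show ?thesis using that r by (auto simp: field_simps)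
  qed
  have "continuous_on {r * cos a..r} G"
    unfolding G_def using bnd r
    by (intro continuous_intros continuous_on_compose2[OF contc]) auto
  moreover have "(G has_vector_derivative 2 * sqrt (r\<^sup>2 - x\<^sup>2) / ((1 - x\<^sup>2) * sqrt (1 - r\<^sup>2))) (at x)"
    if x: "x \<in> {r * cos a<..<r}" for x
  proof -
    have xr: "-1 < x / r" "x / r < 1" using x r mult_left_mono[of "-1" "cos a" r] by (auto simp: field_simps)
    define u where "u = arccos (x / r)"
    have cu: "cos u = x / r" unfolding u_def using xr by (intro cos_arccos) auto
    have su: "sin u = sqrt (1 - (x / r)\<^sup>2)" unfolding u_def using xr by (intro sin_arccos) auto
    define w where "w = sqrt (r\<^sup>2 - x\<^sup>2)"
    have "(x / r)\<^sup>2 < 1" using xr by (simp add: abs_square_less_1)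
    then have x2: "x\<^sup>2 < r\<^sup>2" using r by (simp add: power_divide)
    have w: "0 < w" "w\<^sup>2 = r\<^sup>2 - x\<^sup>2" using x2 by (auto simp: w_def)
    have "1 - (x / r)\<^sup>2 = (w / r)\<^sup>2" using w(2) r by (simp add: power_divide field_simps)
    then have su': "sin u = w / r" using su w r by simp
    have E: "(cos u)\<^sup>2 + c\<^sup>2 * (sin u)\<^sup>2 = (1 - x\<^sup>2) / (1 - r\<^sup>2)"
    proof -
      have "(cos u)\<^sup>2 + c\<^sup>2 * (sin u)\<^sup>2 = x\<^sup>2 / r\<^sup>2 + (r\<^sup>2 - x\<^sup>2) / r\<^sup>2 / (1 - r\<^sup>2)"
        unfolding cu su' c0 by (simp add: power_divide w)
      also have "x\<^sup>2 / r\<^sup>2 = x\<^sup>2 * (1 - r\<^sup>2) / (r\<^sup>2 * (1 - r\<^sup>2))" using r2 by simp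
      also have "x\<^sup>2 * (1 - r\<^sup>2) / (r\<^sup>2 * (1 - r\<^sup>2)) + (r\<^sup>2 - x\<^sup>2) / r\<^sup>2 / (1 - r\<^sup>2) = (x\<^sup>2 * (1 - r\<^sup>2) + (r\<^sup>2 - x\<^sup>2)) / (r\<^sup>2 * (1 - r\<^sup>2))"
        by (simp add: add_divide_distrib)
      also have "x\<^sup>2 * (1 - r\<^sup>2) + (r\<^sup>2 - x\<^sup>2) = r\<^sup>2 * (1 - x\<^sup>2)" by (simp add: algebra_simps)
      finally show ?thesis using r by simp
    qed
    have "(arccos has_real_derivative inverse (- sin u)) (at (x / r))"
      unfolding su by (rule DERIV_arccos[OF xr])
    moreover have "((\<lambda>x. x / r) has_real_derivative 1 / r) (at x)"
      using r by (auto intro!: derivative_eq_intros)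
    ultimately have "((\<lambda>x. arccos (x / r)) has_real_derivative inverse (- sin u) * (1 / r)) (at x)"
      by (rule DERIV_chain2)
    then have "((\<lambda>x. cap_area c (arccos (x / r))) has_real_derivative
        (2 * c - 2 * c / ((1 - x\<^sup>2) / (1 - r\<^sup>2))) * (inverse (- sin u) * (1 / r))) (at x)"
      unfolding E[symmetric] by (intro DERIV_chain2[where g = "\<lambda>x. arccos (x / r)" and f = "cap_area c"])
         (simp_all only: u_def[symmetric] derc)
    then have "(G has_real_derivative - ((2 * c - 2 * c / ((1 - x\<^sup>2) / (1 - r\<^sup>2))) * (inverse (- sin u) * (1 / r)))) (at x)"
      unfolding G_def[abs_def] by (rule DERIV_minus)
    moreover have "- ((2 * c - 2 * c / ((1 - x\<^sup>2) / (1 - r\<^sup>2))) * (inverse (- sin u) * (1 / r))) =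
       2 * w / ((1 - x\<^sup>2) * sqrt (1 - r\<^sup>2))"
    proof -
      have x1: "0 < 1 - x\<^sup>2" using x2 r2 by simp
      have "2 * c - 2 * c / ((1 - x\<^sup>2) / (1 - r\<^sup>2)) = 2 * c * w\<^sup>2 / (1 - x\<^sup>2)"
        unfolding w using x1 by (simp add: field_simps)
      then show ?thesis unfolding su' using w r x1 by (simp add: c power2_eq_square divide_simps)
    qed
    ultimately show ?thesis by (simp add: has_real_derivative_iff_has_vector_derivative w_def)
  qed
  moreover have "r * cos a \<le> r" using r by (simp add: mult_le_cancel_left1)
  ultimately have "((\<lambda>x. 2 * sqrt (r\<^sup>2 - x\<^sup>2) / ((1 - x\<^sup>2) * sqrt (1 - r\<^sup>2))) has_integral G r - G (r * cos a)) {r * cos a..r}"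
    by (intro fundamental_theorem_of_calculus_interior)
  moreover have "G r - G (r * cos a) = cap_area c a"
    using r a by (simp add: G_def arccos_cos) (simp add: cap_area_def tri_area_def)
  ultimately show ?thesis by simp
qed

text \<open>The chord that bounds a cap is a null set, so the open and the closed cap are treated
  alike; a = pi gives the area of the disc \<open>cball 0 r\<close>.\<close>

lemma emeasure_cap:
  assumes r: "0 < r" "r < 1" and a: "0 \<le> a" "a \<le> pi" and c: "c = 1 / sqrt (1 - r\<^sup>2)"
    and A: "A \<in> sets borel" "{z. cmod z \<le> r \<and> r * cos a < Re z} \<subseteq> A" "A \<subseteq> {z. cmod z \<le> r \<and> r * cos a \<le> Re z}"
  shows "emeasure hmeasure A = ennreal (cap_area c a)"
proof -
  let ?g = "\<lambda>x. 2 * sqrt (r\<^sup>2 - x\<^sup>2) / ((1 - x\<^sup>2) * sqrt (1 - r\<^sup>2))"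
  let ?f = "\<lambda>x. if x \<in> {r * cos a..r} then ?g x else 0"
  have r2: "0 < 1 - r\<^sup>2" using r by (simp add: power_less_one_iff)
  have ra: "- r \<le> r * cos a" using mult_left_mono[of "-1" "cos a" r] r by simp
  have xr: "\<bar>x\<bar> \<le> r" "x\<^sup>2 \<le> r\<^sup>2" if "x \<in> {r * cos a..r}" for x
  proof -
    show "\<bar>x\<bar> \<le> r" using that ra by auto
    then show "x\<^sup>2 \<le> r\<^sup>2" using r by (simp add: abs_le_square_iff[symmetric])
  qed
  have M: "(\<lambda>z. ennreal (klein_density z) * indicator A z) \<in> borel_measurable borel"
    using A borel_measurable_klein_density by measurable
  have slice: "(\<integral>\<^sup>+y. ennreal (klein_density (Complex x y)) * indicator A (Complex x y) \<partial>lborel) = ennreal (?f x)"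
    if ne: "x \<noteq> r * cos a" for x
  proof (cases "x \<in> {r * cos a..r}")
    case True
    define q where "q = sqrt (r\<^sup>2 - x\<^sup>2)"
    have "Complex x y \<in> A \<longleftrightarrow> cmod (Complex x y) \<le> r" for y
      using A(2,3) True ne by fastforce
    moreover have "cmod (Complex x y) \<le> r \<longleftrightarrow> y \<in> {-q..q}" for y
    proof -
      have "cmod (Complex x y) \<le> r \<longleftrightarrow> x\<^sup>2 + y\<^sup>2 \<le> r\<^sup>2"
        using r abs_le_square_iff[of "cmod (Complex x y)" r] by (simp add: cmod_power2)
      also have "\<dots> \<longleftrightarrow> y\<^sup>2 \<le> q\<^sup>2" using xr(2)[OF True] by (auto simp: q_def)
      also have "\<dots> \<longleftrightarrow> \<bar>y\<bar> \<le> \<bar>q\<bar>" by (simp add: abs_le_square_iff)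
      also have "\<dots> \<longleftrightarrow> y \<in> {-q..q}" using xr(2)[OF True] by (auto simp: q_def)
      finally show ?thesis .
    qed
    ultimately have "indicator A (Complex x y) = (indicator {-q..q} y :: ennreal)" for y
      by (auto simp: indicator_def)
    then show ?thesis using nn_integral_klein_chord[OF r xr(1)[OF True] q_def] True
      by (simp add: q_def)
  next
    case False
    have "Complex x y \<notin> A" for y
      using False A(3) abs_Re_le_cmod[of "Complex x y"] by fastforce
    then show ?thesis using False by auto
  qed
  have "AE x in lborel. x \<noteq> r * cos a" by (rule AE_lborel_singleton)
  then have "emeasure hmeasure A = (\<integral>\<^sup>+x. ennreal (?f x) \<partial>lborel)"
    unfolding emeasure_hmeasure[OF A(1)] nn_integral_complex(1)[OF M]
    by (intro nn_integral_cong_AE) (auto elim!: eventually_mono dest: slice)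
  also have "\<dots> = ennreal (cap_area c a)"
  proof (rule nn_integral_has_integral_lborel)
    show "?f \<in> borel_measurable borel" by measurable
    show "0 \<le> ?f x" for x
    proof (cases "x \<in> {r * cos a..r}")
      case True
      then show ?thesis using xr(2)[OF True] r2 by (auto intro!: divide_nonneg_nonneg mult_nonneg_nonneg)
    qed auto
    show "(?f has_integral cap_area c a) UNIV"
      using has_integral_cap[OF r a c] by (simp only: has_integral_restrict_UNIV)
  qed
  finally show ?thesis .
qed

lemma borel_rotated_cap: "{z. cmod z \<le> r \<and> h < Re (cis t * z)} \<in> sets borel"
proof -
  have "{z. cmod z \<le> r \<and> h < Re (cis t * z)} = cball 0 r \<inter> {z. h < Re (cis t * z)}" by auto
  also have "\<dots> \<in> sets borel"
    by (intro sets.Int borel_closed borel_open open_Collect_less continuous_intros) auto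
  finally show ?thesis .
qed

lemma emeasure_rotated_cap:
  assumes r: "0 < r" "r < 1" and a: "0 \<le> a" "a \<le> pi" and c: "c = 1 / sqrt (1 - r\<^sup>2)"
  shows "emeasure hmeasure {z. cmod z \<le> r \<and> r * cos a < Re (cis t * z)} = ennreal (cap_area c a)"
proof -
  have "emeasure hmeasure {z. cmod z \<le> r \<and> r * cos a < Re z} = ennreal (cap_area c a)"
    using borel_rotated_cap[of r "r * cos a" 0] by (intro emeasure_cap[OF r a c]) auto
  moreover have "{z. cmod z \<le> r \<and> r * cos a < Re (cis t * z)} = (\<lambda>z. cis t * z) -` {z. cmod z \<le> r \<and> r * cos a < Re z}"
    by (auto simp: norm_mult)
  ultimately show ?thesis
    using hmeasure_rotation[of "{z. cmod z \<le> r \<and> r * cos a < Re z}" "cis t"] borel_rotated_cap[of r "r * cos a" 0]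
    by simp
qed

lemma cap_area_nonneg:
  assumes r: "0 < r" "r < 1" and a: "0 \<le> a" "a \<le> pi" and c: "c = 1 / sqrt (1 - r\<^sup>2)"
  shows "0 \<le> cap_area c a"
  using has_integral_cap[OF assms]
proof (rule has_integral_nonneg)
  fix x assume x: "x \<in> {r * cos a..r}"
  have "- r \<le> r * cos a" using mult_left_mono[of "-1" "cos a" r] r by simp
  then have "\<bar>x\<bar> \<le> \<bar>r\<bar>" using x by auto
  then have "x\<^sup>2 \<le> r\<^sup>2" by (simp add: abs_le_square_iff)
  moreover have "r\<^sup>2 < 1" using r by (simp add: power_less_one_iff)
  ultimately show "0 \<le> 2 * sqrt (r\<^sup>2 - x\<^sup>2) / ((1 - x\<^sup>2) * sqrt (1 - r\<^sup>2))"
    by (intro divide_nonneg_nonneg mult_nonneg_nonneg) auto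
qed

text \<open>Chords perpendicular to the axis of a cap end on its arc.\<close>

lemma cap_subset_convex:
  assumes r: "0 < r" and C: "convex C" and b: "0 \<le> b" "b \<le> pi"
    and arc: "\<And>t. \<bar>t - s\<bar> < b \<Longrightarrow> r *\<^sub>R cis t \<in> C"
    and z: "cmod z \<le> r" "r * cos b < Re (cis (- s) * z)"
  shows "z \<in> C"
proof -
  define w where "w = cis (- s) * z"
  have zw: "z = cis s * w" by (simp add: w_def mult.assoc[symmetric] cis_mult)
  have nw: "cmod w \<le> r" using z(1) by (simp add: w_def norm_mult)
  have wr: "\<bar>Re w\<bar> \<le> r" using abs_Re_le_cmod[of w] nw by linarith
  have bnd: "-1 \<le> Re w / r" "Re w / r \<le> 1" using wr r by (auto simp: field_simps)
  define e where "e = arccos (Re w / r)"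
  have ce: "r * cos e = Re w" using bnd r by (simp add: e_def cos_arccos)
  have e: "0 \<le> e" "e \<le> pi" using bnd by (auto simp: e_def arccos_lbound arccos_ubound)
  have "cos b < cos e" using z(2) ce r by (simp add: w_def[symmetric]) (metis mult_less_cancel_left_pos)
  then have "e < b" using cos_monotone_0_pi_le[of b e] b e by force
  then have in_C: "r *\<^sub>R cis (s + e) \<in> C" "r *\<^sub>R cis (s - e) \<in> C" using e by (auto intro!: arc)
  have "(Re w)\<^sup>2 + (Im w)\<^sup>2 \<le> r\<^sup>2" using nw r by (simp add: cmod_power2[symmetric])
  also have "r\<^sup>2 = (Re w)\<^sup>2 + (r * sin e)\<^sup>2" unfolding ce[symmetric]
    by (simp add: power_mult_distrib distrib_left[symmetric])
  finally have "(Im w)\<^sup>2 \<le> (r * sin e)\<^sup>2" by simp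
  moreover have se: "0 \<le> r * sin e" using r e by (simp add: sin_ge_zero)
  ultimately have "\<bar>Im w\<bar> \<le> r * sin e" using abs_le_square_iff[of "Im w" "r * sin e"] by simp
  have "\<exists>l. 0 \<le> l \<and> l \<le> 1 \<and> Im w = (1 - 2 * l) * (r * sin e)"
  proof (cases "r * sin e = 0")
    case True
    then show ?thesis using \<open>\<bar>Im w\<bar> \<le> r * sin e\<close> by (intro exI[of _ 0]) auto
  next
    case False
    then have p: "0 < r * sin e" using se by linarith
    then show ?thesis using \<open>\<bar>Im w\<bar> \<le> r * sin e\<close>
      by (intro exI[of _ "(1 - Im w / (r * sin e)) / 2"]) (auto simp: field_simps abs_le_iff)
  qed
  then obtain l where l: "0 \<le> l" "l \<le> 1" "Im w = (1 - 2 * l) * (r * sin e)" by blast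
  have "w = (1 - l) *\<^sub>R (r *\<^sub>R cis e) + l *\<^sub>R (r *\<^sub>R cis (- e))"
    using l(3) ce by (simp add: complex_eq_iff algebra_simps)
  then have "z = (1 - l) *\<^sub>R (cis s * (r *\<^sub>R cis e)) + l *\<^sub>R (cis s * (r *\<^sub>R cis (- e)))"
    unfolding zw by (simp add: distrib_left)
  then have "z = (1 - l) *\<^sub>R (r *\<^sub>R cis (s + e)) + l *\<^sub>R (r *\<^sub>R cis (s - e))"
    by (simp add: cis_mult)
  then show ?thesis using convexD_alt[OF C in_C l(1,2)] by simp
qed

section \<open>A disc as the union of an inscribed polygon and caps\<close>

locale circle_partition =
  fixes n :: nat and r :: real and tt :: "nat \<Rightarrow> real"
  assumes n: "0 < n" and r: "0 < r" "r < 1"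
    and mono: "\<And>i. i < n \<Longrightarrow> tt i < tt (Suc i)"
    and total: "tt n = tt 0 + 2 * pi"
begin

definition half :: "nat \<Rightarrow> real" where "half i = (tt (Suc i) - tt i) / 2"
definition mid :: "nat \<Rightarrow> real" where "mid i = (tt (Suc i) + tt i) / 2"
definition vertex :: "nat \<Rightarrow> complex" where "vertex i = r *\<^sub>R cis (tt i)"
text \<open>Strict inequality leaves the bounding chord to the polygon, so that the disc minus the
  caps is exactly a convex hull. If \<open>half i\<close> exceeds pi / 2, the cap contains the
  centre.\<close>

definition cap :: "nat \<Rightarrow> complex set" where
  "cap i = {z. cmod z \<le> r \<and> r * cos (half i) < Re (cis (- mid i) * z)}"

lemma tt_mono: "i \<le> j \<Longrightarrow> j \<le> n \<Longrightarrow> tt i \<le> tt j"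
proof (induction rule: dec_induct)
  case (step k)
  then show ?case using mono[of k] by simp
qed simp

lemma half_bounds: "i < n \<Longrightarrow> 0 < half i" "i < n \<Longrightarrow> half i \<le> pi"
  using mono[of i] tt_mono[of 0 i] tt_mono[of "Suc i" n] total by (auto simp: half_def)

lemma sum_half: "(\<Sum>i<n. half i) = pi"
proof -
  have "(\<Sum>i<n. half i) = (\<Sum>i<n. tt (Suc i) - tt i) / 2" by (simp add: half_def sum_divide_distrib)
  also have "\<dots> = pi" by (simp add: sum_lessThan_telescope total)
  finally show ?thesis .
qed

lemma Re_rotated: "Re (cis (- s) * (r *\<^sub>R cis t)) = r * cos (t - s)"
  by (simp add: cis_mult)

text \<open>Modulo full turns, a point of another arc stays at angular distance at least
  \<open>half i\<close> from the midpoint of arc i.\<close>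

lemma cos_other_arc:
  assumes "i < n" "j < n" "j \<noteq> i" "tt j \<le> t" "t \<le> tt (Suc j)"
  shows "cos (t - mid i) \<le> cos (half i)"
proof -
  have key: "cos e \<le> cos (half i)" if "half i \<le> e" "e \<le> 2 * pi - half i" for e
  proof (cases "e \<le> pi")
    case True
    then show ?thesis using that half_bounds[OF assms(1)] by (intro cos_monotone_0_pi_le) auto
  next
    case False
    then have "cos (2 * pi - e) \<le> cos (half i)"
      using that half_bounds[OF assms(1)] by (intro cos_monotone_0_pi_le) auto
    then show ?thesis by (simp add: cos_diff)
  qed
  show ?thesis
  proof (cases "i < j")
    case True
    then have "tt (Suc i) \<le> tt j" "tt (Suc j) \<le> tt n" "tt 0 \<le> tt i"
      using assms(1,2) by (auto intro!: tt_mono)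
    then show ?thesis using assms(4,5) total by (intro key) (auto simp: half_def mid_def field_simps)
  next
    case False
    then have "tt (Suc j) \<le> tt i" "tt (Suc i) \<le> tt n" "tt 0 \<le> tt j"
      using assms(1,2,3) by (auto intro!: tt_mono)
    \<comment> \<open>An arc that precedes arc i is moved forward by a full turn, so that the same
      estimate applies.\<close>
    then have "cos (t + 2 * pi - mid i) \<le> cos (half i)"
      using assms(4,5) total by (intro key) (auto simp: half_def mid_def field_simps)
    then show ?thesis using cos_periodic[of "t - mid i"] by (simp add: algebra_simps)
  qed
qed

lemma convex_halfplanes: "convex {z. Re (u * z) \<le> b}" "convex {z. b < Re (u * z)}"
proof -
  have "Re (u * z) = cnj u \<bullet> z" for z by (simp add: inner_complex_def)
  then show "convex {z. Re (u * z) \<le> b}" "convex {z. b < Re (u * z)}"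
    by (simp_all add: convex_halfspace_le convex_halfspace_gt)
qed

text \<open>By \<open>cap_subset_convex\<close> a cap lies in every convex set that contains its
  open arc; the closed half-plane opposite to the other cap is such a set.\<close>

lemma disjoint_caps:
  assumes "i < n" "j < n" "j \<noteq> i" shows "cap i \<inter> cap j = {}"
proof -
  have "z \<in> {z. Re (cis (- mid i) * z) \<le> r * cos (half i)}" if "z \<in> cap j" for z
  proof (rule cap_subset_convex[OF r(1) convex_halfplanes(1)])
    fix t assume "\<bar>t - mid j\<bar> < half j"
    then have "tt j \<le> t" "t \<le> tt (Suc j)" by (auto simp: half_def mid_def field_simps abs_less_iff)
    then show "r *\<^sub>R cis t \<in> {z. Re (cis (- mid i) * z) \<le> r * cos (half i)}"
      using cos_other_arc[OF assms] r unfolding mem_Collect_eq Re_rotated by simp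
  qed (use that half_bounds[OF assms(2)] in \<open>auto simp: cap_def\<close>)
  then show ?thesis by (fastforce simp: cap_def)
qed

text \<open>The disc minus the caps is an intersection of convex sets that contain the vertices.
  Conversely, a line that separates z from the vertices has a normal pointing into some arc k, and z
  then lies beyond the chord of that arc.\<close>

lemma convex_hull_vertices: "convex hull (vertex ` {..<n}) = cball 0 r - (\<Union>i<n. cap i)"
proof
  let ?C = "cball 0 r \<inter> (\<Inter>i\<in>{..<n}. {z. Re (cis (- mid i) * z) \<le> r * cos (half i)})"
  have halfplane: "Re (cis (- mid i) * vertex j) \<le> r * cos (half i)" if ij: "i < n" "j < n" for i j
  proof (cases "j = i")
    case True
    have "tt i - mid i = - half i" by (simp add: mid_def half_def field_simps)
    then show ?thesis using True by (simp only: vertex_def Re_rotated cos_minus)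
  next
    case False
    then show ?thesis using cos_other_arc[OF ij False, of "tt j"] mono[OF ij(2)] r
      by (simp only: vertex_def Re_rotated mult_le_cancel_left_pos)
  qed
  have "cmod (vertex j) \<le> r" for j using r by (simp add: vertex_def)
  then have "vertex ` {..<n} \<subseteq> ?C" using halfplane by (auto simp del: times_complex.sel)
  then have "convex hull (vertex ` {..<n}) \<subseteq> ?C"
    by (intro hull_minimal convex_Int convex_INT convex_halfplanes convex_cball)
  also have "\<dots> \<subseteq> cball 0 r - (\<Union>i<n. cap i)"
  proof (intro subsetI DiffI)
    fix z assume z: "z \<in> ?C"
    then show "z \<in> cball 0 r" by blast
    have "Re (cis (- mid i) * z) \<le> r * cos (half i)" if "i < n" for i using z that by blast
    then show "z \<notin> (\<Union>i<n. cap i)" unfolding cap_def by (auto simp del: times_complex.sel simp flip: not_le)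
  qed
  finally show "convex hull (vertex ` {..<n}) \<subseteq> cball 0 r - (\<Union>i<n. cap i)" .
  show "cball 0 r - (\<Union>i<n. cap i) \<subseteq> convex hull (vertex ` {..<n})"
  proof (rule ccontr)
    assume "\<not> ?thesis"
    then obtain z where "z \<in> cball 0 r - (\<Union>i<n. cap i)" and z3: "z \<notin> convex hull (vertex ` {..<n})" by blast
    then have z: "cmod z \<le> r" "\<And>i. i < n \<Longrightarrow> z \<notin> cap i" by auto
    have "closed (convex hull (vertex ` {..<n}))"
      by (intro compact_imp_closed finite_imp_compact_convex_hull) auto
    then obtain a b where ab: "a \<bullet> z < b" "\<And>x. x \<in> convex hull (vertex ` {..<n}) \<Longrightarrow> b < a \<bullet> x"
      using separating_hyperplane_closed_point[OF convex_convex_hull _ z3] by blast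
    have v: "a \<bullet> z < a \<bullet> vertex i" if "i < n" for i
      using ab(1) ab(2)[of "vertex i"] that hull_inc[of "vertex i" "vertex ` {..<n}" convex] by force
    have "a \<noteq> 0" using v[OF n] by auto
    \<comment> \<open>\<open>u\<close> is the unit normal of the separating line on the side of z,
      and \<open>\<beta>\<close> is its argument within the turn that starts at vertex 0.\<close>
    define u where "u = - a / of_real (cmod a)"
    define \<beta> where "\<beta> = tt 0 + Arg2pi (u / cis (tt 0))"
    have "cmod (u / cis (tt 0)) = 1" using \<open>a \<noteq> 0\<close> by (simp add: u_def norm_divide norm_mult)
    then have "u / cis (tt 0) = cis (Arg2pi (u / cis (tt 0)))" using Arg2pi_polar[of "u / cis (tt 0)"] by simp
    then have u: "u = cis \<beta>" by (simp add: \<beta>_def cis_mult[symmetric] field_simps)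
    have inner: "Re (cis (- \<beta>) * w) = - (a \<bullet> w) / cmod a" for w
    proof -
      have "cis (- \<beta>) = cnj u" by (simp add: u cis_cnj)
      then show ?thesis using \<open>a \<noteq> 0\<close> by (simp add: u_def inner_complex_def diff_divide_distrib add_divide_distrib)
    qed
    have v': "r * cos (tt i - \<beta>) < Re (cis (- \<beta>) * z)" if "i < n" for i
    proof -
      have "Re (cis (- \<beta>) * vertex i) < Re (cis (- \<beta>) * z)"
        unfolding inner using v[OF that] \<open>a \<noteq> 0\<close> by (simp add: divide_strict_right_mono)
      then show ?thesis by (simp only: vertex_def Re_rotated)
    qed
    have v'': "r * cos (tt i - \<beta>) < Re (cis (- \<beta>) * z)" if "i \<le> n" for i
    proof (cases "i = n")
      case True
      then have "tt i - \<beta> = (tt 0 - \<beta>) + 2 * pi" using total by simp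
      then show ?thesis using v'[OF n] by (simp only: cos_periodic)
    qed (use v' that in auto)
    have \<beta>: "tt 0 \<le> \<beta>" "\<beta> \<le> tt n" using Arg2pi[of "u / cis (tt 0)"] total by (auto simp: \<beta>_def)
    define k where "k = (LEAST k. \<beta> \<le> tt (Suc k))"
    have ex: "\<beta> \<le> tt (Suc (n - 1))" using \<beta> n by simp
    have k: "\<beta> \<le> tt (Suc k)" "k < n" using LeastI[of "\<lambda>k. \<beta> \<le> tt (Suc k)", OF ex] Least_le[of "\<lambda>k. \<beta> \<le> tt (Suc k)", OF ex] n
      by (auto simp: k_def)
    have k': "tt k \<le> \<beta>"
    proof (cases k)
      case (Suc l)
      then have "\<not> \<beta> \<le> tt (Suc l)" using not_less_Least[of l "\<lambda>k. \<beta> \<le> tt (Suc k)"] by (simp add: k_def)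
      then show ?thesis using Suc by simp
    qed (use \<beta> in simp)
    \<comment> \<open>The angular distance from \<open>\<beta>\<close> to the nearer end of arc k.
      The arc of this half width around \<open>\<beta>\<close> stays within arc k, and the bound at
      the nearer end puts z beyond its chord.\<close>
    define b' where "b' = min (\<beta> - tt k) (tt (Suc k) - \<beta>)"
    have "z \<in> {z. r * cos (half k) < Re (cis (- mid k) * z)}"
    proof (rule cap_subset_convex[OF r(1) convex_halfplanes(2)])
      show "0 \<le> b'" "b' \<le> pi" using k k' half_bounds[OF k(2)] by (auto simp: b'_def half_def min_def)
      show "r *\<^sub>R cis t \<in> {z. r * cos (half k) < Re (cis (- mid k) * z)}" if "\<bar>t - \<beta>\<bar> < b'" for t
      proof -
        have "\<bar>t - mid k\<bar> < half k" using that by (auto simp: b'_def half_def mid_def abs_less_iff field_simps)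
        then have "cos (half k) < cos \<bar>t - mid k\<bar>" using half_bounds[OF k(2)] by (intro cos_monotone_0_pi) auto
        then show ?thesis using r unfolding mem_Collect_eq Re_rotated by simp
      qed
      show "cmod z \<le> r" by fact
      have "r * cos (tt k - \<beta>) < Re (cis (- \<beta>) * z)" "r * cos (tt (Suc k) - \<beta>) < Re (cis (- \<beta>) * z)"
        using v'' k(2) by auto
      moreover have "cos (tt k - \<beta>) = cos (\<beta> - tt k)" using cos_minus[of "\<beta> - tt k"] by simp
      ultimately show "r * cos b' < Re (cis (- \<beta>) * z)" by (simp add: b'_def min_def)
    qed
    then show False using z(1) z(2)[OF k(2)] by (auto simp: cap_def)
  qed
qed

lemma measure_convex_hull_vertices:
  "measure hmeasure (convex hull (vertex ` {..<n})) = (\<Sum>i<n. tri_area (1 / sqrt (1 - r\<^sup>2)) (half i))"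
proof -
  define c where "c = 1 / sqrt (1 - r\<^sup>2)"
  have B: "emeasure hmeasure (cball 0 r) = ennreal (cap_area c pi)"
  proof (rule emeasure_cap[OF r _ _ c_def])
    show "cball 0 r \<subseteq> {z. cmod z \<le> r \<and> r * cos pi \<le> Re z}"
      using abs_Re_le_cmod by (auto simp: abs_le_iff) (metis abs_Re_le_cmod abs_le_iff minus_le_iff order_trans)
  qed (auto)
  have caps: "cap i \<in> sets hmeasure" for i unfolding cap_def sets_hmeasure by (rule borel_rotated_cap)
  have em: "emeasure hmeasure (cap i) = ennreal (cap_area c (half i))" if "i < n" for i
    unfolding cap_def by (rule emeasure_rotated_cap[OF r _ _ c_def]) (use half_bounds[OF that] in auto)
  have nonneg: "0 \<le> cap_area c (half i)" if "i < n" for i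
    using cap_area_nonneg[OF r _ _ c_def] half_bounds[OF that] by simp
  have "(\<Sum>i<n. emeasure hmeasure (cap i)) = emeasure hmeasure (\<Union>i<n. cap i)"
    using disjoint_caps caps by (intro sum_emeasure) (auto simp: disjoint_family_on_def)
  then have U: "emeasure hmeasure (\<Union>i<n. cap i) = ennreal (\<Sum>i<n. cap_area c (half i))"
    by (subst sum_ennreal[symmetric]) (use em nonneg in auto)
  have "emeasure hmeasure (cball 0 r - (\<Union>i<n. cap i)) = emeasure hmeasure (cball 0 r) - emeasure hmeasure (\<Union>i<n. cap i)"
    using caps B U by (intro emeasure_Diff) (auto simp: sets_hmeasure cap_def)
  also have "\<dots> = ennreal (cap_area c pi - (\<Sum>i<n. cap_area c (half i)))"
    unfolding B U using nonneg by (intro ennreal_minus sum_nonneg) auto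
  finally have e: "emeasure hmeasure (convex hull (vertex ` {..<n})) = ennreal (cap_area c pi - (\<Sum>i<n. cap_area c (half i)))"
    unfolding convex_hull_vertices .
  have "(\<Union>i<n. cap i) \<subseteq> cball 0 r" by (auto simp: cap_def)
  then have "emeasure hmeasure (\<Union>i<n. cap i) \<le> emeasure hmeasure (cball 0 r)"
    by (intro emeasure_mono) (auto simp: sets_hmeasure)
  then have "(\<Sum>i<n. cap_area c (half i)) \<le> cap_area c pi"
    unfolding B U using cap_area_nonneg[OF r _ _ c_def, of pi] by (simp add: ennreal_le_iff)
  then have "measure hmeasure (convex hull (vertex ` {..<n})) = cap_area c pi - (\<Sum>i<n. cap_area c (half i))"
    using e by (simp add: measure_def)
  \<comment> \<open>The terms of \<open>cap_area\<close> that are linear in the angle cancel against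
    those of the whole disc, because the half angles add up to pi.\<close>
  also have "\<dots> = (\<Sum>i<n. tri_area c (half i)) + (2 * c - 2) * (pi - (\<Sum>i<n. half i))"
  proof -
    have "cap_area c t = (2 * c - 2) * t - tri_area c t" for t by (simp add: cap_area_def algebra_simps)
    moreover have "tri_area c pi = 0" by (simp add: tri_area_def)
    ultimately show ?thesis by (simp add: sum_subtractf sum_distrib_left[symmetric] right_diff_distrib)
  qed
  also have "\<dots> = (\<Sum>i<n. tri_area c (half i))" by (simp add: sum_half)
  finally show ?thesis by (simp add: c_def)
qed

end

section \<open>Cyclic polygons\<close>

lemma Arg2pi_cis: "0 \<le> t \<Longrightarrow> t < 2 * pi \<Longrightarrow> Arg2pi (cis t) = t"
  by (rule Arg2pi_unique[of 1]) (simp_all add: cis_conv_exp)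

lemma cosh_sinh_half: "cosh (x::real) = 1 + 2 * (sinh (x / 2))\<^sup>2"
  using cosh_double[of "x / 2"] by (simp add: cosh_square_eq)

lemma one_minus_tanh_square: "1 - (tanh (x::real))\<^sup>2 = 1 / (cosh x)\<^sup>2"
  by (simp add: tanh_def power_divide diff_divide_distrib[symmetric] divide_simps) (simp add: cosh_square_eq)

lemma hcircle_0:
  assumes "0 \<le> R"
  shows "hcircle 0 R = {z. cmod z = tanh R}"
proof -
  have t: "0 \<le> tanh R" "tanh R < 1" using assms by (simp_all add: tanh_real_lt_1)
  have 0: "(0::complex) \<in> hyp_plane" by (simp add: hyp_plane_def)
  have "z \<in> hcircle 0 R \<longleftrightarrow> cmod z = tanh R" if z: "z \<in> hyp_plane" for z
  proof -
    have p: "0 < 1 - (cmod z)\<^sup>2" using z by (simp add: hyp_plane_iff)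
    have "z \<in> hcircle 0 R \<longleftrightarrow> 1 / sqrt (1 - (cmod z)\<^sup>2) = cosh R"
      using z hdist_eq_iff[OF 0 z assms] by (simp add: hcircle_def klein_cosh_def)
    also have "\<dots> \<longleftrightarrow> sqrt (1 - (cmod z)\<^sup>2) = 1 / cosh R" using p by (auto simp: field_simps)
    also have "\<dots> \<longleftrightarrow> 1 - (cmod z)\<^sup>2 = (1 / cosh R)\<^sup>2"
      using p by (metis cosh_real_nonneg divide_nonneg_nonneg less_imp_le real_sqrt_pow2 real_sqrt_unique zero_le_one)
    also have "\<dots> \<longleftrightarrow> (cmod z)\<^sup>2 = (tanh R)\<^sup>2" using one_minus_tanh_square[of R] by (auto simp: power_divide)
    also have "\<dots> \<longleftrightarrow> cmod z = tanh R" using t by simp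
    finally show ?thesis .
  qed
  moreover have "z \<in> hyp_plane" if "cmod z = tanh R" for z using that t by (simp add: hyp_plane_def)
  moreover have "hcircle 0 R \<subseteq> hyp_plane" by (auto simp: hcircle_def)
  ultimately show ?thesis by blast
qed

text \<open>Half-angle formulas for cosh and cos turn the distance formula into that of half a
  Euclidean chord in a circle of radius sinh R; this links hyperbolic side lengths to
  \<open>inscribed\<close>.\<close>

lemma sinh_half_hdist_circle:
  assumes "0 < R" "0 \<le> \<delta>" "\<delta> \<le> 2 * pi"
  shows "sinh (hdist (tanh R *\<^sub>R cis t) (tanh R *\<^sub>R cis (t + \<delta>)) / 2) = sinh R * sin (\<delta> / 2)"
proof -
  let ?p = "tanh R *\<^sub>R cis t" and ?q = "tanh R *\<^sub>R cis (t + \<delta>)"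
  have th: "0 < tanh R" using assms(1) by simp
  have D: "?p \<in> hyp_plane" "?q \<in> hyp_plane" using th by (auto simp: hyp_plane_def tanh_real_lt_1)
  have n: "(cmod ?p)\<^sup>2 = (tanh R)\<^sup>2" "(cmod ?q)\<^sup>2 = (tanh R)\<^sup>2" by (simp_all add: power_mult_distrib)
  have i: "?p \<bullet> ?q = (tanh R)\<^sup>2 * cos \<delta>"
  proof -
    have "cos t * cos (t + \<delta>) + sin t * sin (t + \<delta>) = cos \<delta>" using cos_diff[of "t + \<delta>" t] by (simp add: mult.commute)
    moreover have "?p \<bullet> ?q = (tanh R)\<^sup>2 * (cos t * cos (t + \<delta>) + sin t * sin (t + \<delta>))"
      by (simp add: inner_complex_def power2_eq_square algebra_simps)
    ultimately show ?thesis by simp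
  qed
  have c: "(1 - (tanh R)\<^sup>2) * (cosh R)\<^sup>2 = 1" unfolding one_minus_tanh_square by simp
  have "klein_cosh ?p ?q = (1 - (tanh R)\<^sup>2 * cos \<delta>) / (1 - (tanh R)\<^sup>2)"
    unfolding klein_cosh_def n i real_sqrt_abs2 by (simp add: one_minus_tanh_square)
  also have "\<dots> = 1 + (tanh R)\<^sup>2 * (1 - cos \<delta>) * (cosh R)\<^sup>2"
    unfolding one_minus_tanh_square using c by (simp add: field_simps)
  also have "(tanh R)\<^sup>2 * (1 - cos \<delta>) * (cosh R)\<^sup>2 = (sinh R)\<^sup>2 * (1 - cos \<delta>)"
    by (simp add: tanh_def power_divide)
  also have "1 - cos \<delta> = 2 * (sin (\<delta> / 2))\<^sup>2" using cos_double_sin[of "\<delta> / 2"] by simp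
  finally have "cosh (hdist ?p ?q) = 1 + 2 * (sinh R * sin (\<delta> / 2))\<^sup>2"
    using cosh_hdist[OF D] by (simp add: power_mult_distrib)
  then have "(sinh (hdist ?p ?q / 2))\<^sup>2 = (sinh R * sin (\<delta> / 2))\<^sup>2" using cosh_sinh_half[of "hdist ?p ?q"] by simp
  moreover have "0 \<le> sinh (hdist ?p ?q / 2)" using hdist_nonneg[OF D] by simp
  moreover have "0 \<le> sinh R * sin (\<delta> / 2)" using assms by (intro mult_nonneg_nonneg sin_ge_zero) auto
  ultimately show ?thesis by (simp only: power2_eq_iff_nonneg)
qed

text \<open>The side \<open>k\<close> of a polygon joins the vertices \<open>k - 1\<close> and \<open>k\<close>, indices being read cyclically.\<close>

definition prev_index :: "nat \<Rightarrow> nat \<Rightarrow> nat" where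
  "prev_index n k = (if k = 0 then n - 1 else k - 1)"

lemma bij_prev_index: "0 < n \<Longrightarrow> bij_betw (prev_index n) {..<n} {..<n}"
  by (rule bij_betw_byWitness[where f' = "\<lambda>k. if Suc k = n then 0 else Suc k"])
     (auto simp: prev_index_def split: if_splits)

text \<open>Arguments counted from the vertex x 0 increase along the polygon, since an arc that
  avoids x 0 cannot complete a turn. This makes the vertices a \<open>circle_partition\<close>,
  whose half arcs are the angles wanted.\<close>

lemma polygon_centred_imp_inscribed:
  fixes e :: "nat \<Rightarrow> 'n::finite" and d :: "real ^ 'n"
  assumes n: "n = CARD('n)" "3 \<le> n" and e: "bij_betw e {..<n} UNIV" and d: "\<And>i. 0 < d $ i" and R: "0 < R"
    and circ: "\<And>i. i < n \<Longrightarrow> x i \<in> hcircle 0 R"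
    and arcs: "\<And>i. i \<in> {1..<n} \<Longrightarrow> x 0 \<notin> ccw_arc 0 R (x (i - 1)) (x i)"
    and sides: "\<And>i. i \<in> {1..<n} \<Longrightarrow> hdist (x (i - 1)) (x i) = d $ e i" "hdist (x (n - 1)) (x 0) = d $ e 0"
  shows "\<exists>a. inscribed (\<lambda>i. sinh (d $ i / 2)) (sinh R) a \<and>
     measure hmeasure (convex hull (x ` {..<n})) = (\<Sum>i\<in>UNIV. tri_area (cosh R) (a i))"
proof -
  define r where "r = tanh R"
  have r: "0 < r" "r < 1" using R by (simp_all add: r_def tanh_real_lt_1)
  have nx: "cmod (x i) = r" "x i \<noteq> 0" if "i < n" for i
    using circ[OF that] R r by (auto simp: hcircle_0 r_def)
  define \<theta> where "\<theta> i = Arg2pi (x i / x 0)" for i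
  \<comment> \<open>Index n stands for the return to vertex 0 after a full turn; the value
    \<open>x n\<close> is unconstrained.\<close>
  define tt where "tt i = Arg2pi (x 0) + (if i = n then 2 * pi else \<theta> i)" for i
  have \<theta>0: "\<theta> 0 = 0" using nx(2)[of 0] n Arg2pi_of_real[of 1] by (simp add: \<theta>_def)
  have \<theta>: "0 \<le> \<theta> i" "\<theta> i < 2 * pi" for i using Arg2pi[of "x i / x 0"] by (auto simp: \<theta>_def)
  have inc: "\<theta> (i - 1) < \<theta> i" if i: "i \<in> {1..<n}" for i
  proof -
    let ?p = "x (i - 1)"
    have p: "?p \<noteq> 0" "x i \<noteq> 0" "x 0 \<noteq> 0" "i - 1 < n" "i < n" "0 < n" using i nx by auto
    define A where "A = Arg2pi (x i / ?p)"
    have A: "0 \<le> A" "A < 2 * pi" using Arg2pi[of "x i / ?p"] by (auto simp: A_def)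
    have "A \<noteq> 0"
    proof
      assume "A = 0"
      then have "x i / ?p = of_real (cmod (x i / ?p))" using Arg2pi_polar[of "x i / ?p"] by (simp add: A_def)
      then have "x i = ?p" using p nx(1) r by (simp add: norm_divide)
      then have "d $ e i = hdist ?p ?p" using sides(1)[OF i] by simp
      also have "\<dots> = 0"
        using hdist_eq_iff[of ?p ?p 0] circ[OF p(4)] by (simp add: klein_cosh_def hcircle_def dot_square_norm hyp_plane_iff)
      finally show False using d[of "e i"] by simp
    qed
    have prod: "\<theta> i = Arg2pi ((?p / x 0) * (x i / ?p))" using p by (simp add: \<theta>_def)
    have sum: "\<theta> i = (if \<theta> (i - 1) + A < 2 * pi then \<theta> (i - 1) + A else \<theta> (i - 1) + A - 2 * pi)"
      unfolding prod unfolding \<theta>_def A_def by (rule Arg2pi_times) (use p in auto)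
    show ?thesis
    proof (cases "\<theta> (i - 1) = 0")
      case True
      then show ?thesis using sum A \<open>A \<noteq> 0\<close> by simp
    next
      case False
      \<comment> \<open>The argument of x 0 seen from the previous vertex is 2 pi -
        \<open>\<theta> (i - 1)\<close>; as x 0 is off the arc, the step \<open>A\<close> is smaller
        than that.\<close>
      have "(?p / x 0) * (x 0 / ?p) = 1" using p by simp
      then have "Arg2pi ((?p / x 0) * (x 0 / ?p)) = 0" using Arg2pi_of_real[of 1] by simp
      then have "Arg2pi (x 0 / ?p) = 2 * pi - \<theta> (i - 1)"
        using Arg2pi_times[of "?p / x 0" "x 0 / ?p"] False p \<theta>(1)[of "i - 1"] Arg2pi[of "x 0 / ?p"]
        unfolding \<theta>_def by (auto split: if_splits)
      then have "A < 2 * pi - \<theta> (i - 1)"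
        using arcs[OF i] circ[OF p(6)] \<theta>[of "i - 1"] by (auto simp: ccw_arc_def A_def not_le)
      then show ?thesis using sum A \<open>A \<noteq> 0\<close> by simp
    qed
  qed
  interpret circle_partition n r tt
  proof
    show "0 < n" "0 < r" "r < 1" using n r by auto
    show "tt n = tt 0 + 2 * pi" using n by (simp add: tt_def \<theta>0)
    show "tt i < tt (Suc i)" if "i < n" for i
      using that inc[of "Suc i"] \<theta>[of i] by (auto simp: tt_def)
  qed
  have vx: "x i = vertex i" if "i < n" for i
  proof -
    have x0: "x 0 = of_real r * cis (Arg2pi (x 0))" using Arg2pi_polar[of "x 0"] nx(1)[of 0] n by simp
    have "x i / x 0 = cis (\<theta> i)"
      using Arg2pi_polar[of "x i / x 0"] nx(1)[of 0] nx(1)[OF that] n r by (simp add: \<theta>_def norm_divide)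
    then have "x i = x 0 * cis (\<theta> i)" using nx(2)[of 0] n by (simp add: field_simps)
    also have "\<dots> = of_real r * (cis (Arg2pi (x 0)) * cis (\<theta> i))" by (subst x0) (simp add: mult.assoc)
    finally show ?thesis using that by (simp add: vertex_def tt_def cis_mult scaleR_conv_of_real)
  qed
  have vn: "vertex n = vertex 0"
    unfolding vertex_def total cis_mult[symmetric] by simp
  have side: "sinh (hdist (vertex i) (vertex (Suc i)) / 2) = sinh R * sin (half i)" if "i < n" for i
  proof -
    have eq: "tt (Suc i) = tt i + 2 * half i" by (simp add: half_def field_simps)
    show ?thesis unfolding vertex_def eq unfolding r_def
      using sinh_half_hdist_circle[OF R, of "2 * half i" "tt i"] half_bounds[OF that] by simp
  qed
  define ei where "ei = inv_into {..<n} e"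
  have ei: "ei i < n" "e (ei i) = i" for i
    using e inv_into_into[of i e "{..<n}"] f_inv_into_f[of i e "{..<n}"] by (auto simp: ei_def bij_betw_def)
  have bij_ei: "bij_betw ei UNIV {..<n}" unfolding ei_def by (rule bij_betw_inv_into[OF e])
  have bij: "bij_betw (\<lambda>i. prev_index n (ei i)) UNIV {..<n}"
    using bij_betw_trans[OF bij_ei bij_prev_index[of n]] n by (simp add: comp_def)
  define a where "a i = half (prev_index n (ei i))" for i
  have re: "(\<Sum>i\<in>UNIV. f (a i)) = (\<Sum>k<n. f (half k))" for f :: "real \<Rightarrow> real"
    unfolding a_def using sum.reindex_bij_betw[OF bij, of "\<lambda>k. f (half k)"] .
  have "sinh (d $ i / 2) = sinh R * sin (a i)" for i
  proof (cases "ei i = 0")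
    case True
    then have "d $ i = hdist (vertex (n - 1)) (vertex (Suc (n - 1)))"
      using sides(2) ei(2)[of i] n vx[of "n - 1"] vx[of 0] vn by simp
    then show ?thesis using side[of "n - 1"] n True by (simp add: a_def prev_index_def)
  next
    case False
    then have "d $ i = hdist (vertex (ei i - 1)) (vertex (Suc (ei i - 1)))"
      using sides(1)[of "ei i"] ei[of i] vx[of "ei i - 1"] vx[of "ei i"] by simp
    then show ?thesis using side[of "ei i - 1"] ei(1)[of i] False by (simp add: a_def prev_index_def)
  qed
  moreover have "0 < a i" for i
  proof -
    have "prev_index n (ei i) < n" using ei(1)[of i] by (auto simp: prev_index_def)
    then show ?thesis unfolding a_def by (rule half_bounds(1))
  qed
  ultimately have ins: "inscribed (\<lambda>i. sinh (d $ i / 2)) (sinh R) a"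
    using R re[of "\<lambda>x. x"] sum_half by (simp add: inscribed_def)
  have "1 / sqrt (1 - r\<^sup>2) = cosh R" unfolding r_def one_minus_tanh_square by (simp add: real_sqrt_divide)
  moreover have "x ` {..<n} = vertex ` {..<n}" using vx by (intro image_cong) auto
  ultimately have "measure hmeasure (convex hull (x ` {..<n})) = (\<Sum>i\<in>UNIV. tri_area (cosh R) (a i))"
    using measure_convex_hull_vertices re[of "tri_area (cosh R)"] by simp
  then show ?thesis using ins by blast
qed

lemma inscribed_imp_polygon:
  fixes e :: "nat \<Rightarrow> 'n::finite" and d :: "real ^ 'n"
  assumes n: "3 \<le> CARD('n)" and e: "bij_betw e {..<CARD('n)} UNIV" and d: "\<And>i. 0 < d $ i"
    and i: "inscribed (\<lambda>i. sinh (d $ i / 2)) S a"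
  shows "\<exists>x. cyclic_ngon e d 0 (arsinh S) x"
proof -
  let ?n = "CARD('n)"
  define R where "R = arsinh S"
  have S: "0 < S" "sinh R = S" using i by (auto simp: R_def inscribed_def)
  have R: "0 < R" using S by (metis sinh_real_pos_iff)
  have a: "\<And>i. 0 < a i" "sum a UNIV = pi" "\<And>i. sinh (d $ i / 2) = S * sin (a i)"
    using i by (auto simp: inscribed_def)
  \<comment> \<open>Vertex k sits at the end of the arcs 1, ..., k. The arc of side 0 is absent
    because that side closes the polygon from the last vertex to vertex 0.\<close>
  define tt where "tt k = (\<Sum>j\<in>{1..k}. 2 * a (e j))" for k
  have step: "tt (Suc k) = tt k + 2 * a (e (Suc k))" for k by (simp add: tt_def)
  have mono: "tt i < tt j" if "i < j" for i j
    using that by (rule lift_Suc_mono_less[rotated]) (use step a(1) in auto)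
  have tt0: "tt 0 = 0" by (simp add: tt_def)
  have "sum a UNIV = (\<Sum>k<?n. a (e k))" using sum.reindex_bij_betw[OF e, of a] by simp
  also have "{..<?n} = insert 0 {1..?n - 1}" using n by auto
  finally have last: "tt (?n - 1) + 2 * a (e 0) = 2 * pi"
    using a(2) by (simp add: tt_def sum_distrib_left[symmetric])
  have bound: "tt k < 2 * pi" "0 \<le> tt k" if "k < ?n" for k
  proof -
    have "k = ?n - 1 \<or> k < ?n - 1" using that by linarith
    then have "tt k \<le> tt (?n - 1)" by (auto dest: mono)
    then show "tt k < 2 * pi" using last a(1)[of "e 0"] by simp
    show "0 \<le> tt k" using mono[of 0 k] tt0 by (cases k) auto
  qed
  define x where "x k = tanh R *\<^sub>R cis (tt k)" for k
  have th: "0 < tanh R" using R by simp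
  have xc: "x k \<in> hcircle 0 R" for k using R by (simp add: hcircle_0 x_def)
  have ratio: "(x j - 0) / (x k - 0) = cis (tt j - tt k)" for j k
    using th by (simp add: x_def scaleR_conv_of_real cis_divide)
  have arg: "Arg2pi ((x j - 0) / (x k - 0)) = (if tt k \<le> tt j then tt j - tt k else tt j - tt k + 2 * pi)"
    if "j < ?n" "k < ?n" for j k
  proof (cases "tt k \<le> tt j")
    case True
    moreover have "tt j - tt k < 2 * pi" using bound[OF that(1)] bound[OF that(2)] by simp
    ultimately show ?thesis unfolding ratio by (simp add: Arg2pi_cis)
  next
    case False
    have "cis (tt j - tt k) = cis (tt j - tt k + 2 * pi)" by (simp add: cis_mult[symmetric])
    then show ?thesis unfolding ratio using False bound[OF that(1)] bound[OF that(2)] by (simp add: Arg2pi_cis)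
  qed
  have sinj: "u = v" if "sinh (u / 2) = sinh (v / 2)" for u v :: real using that by simp
  have D: "x k \<in> hyp_plane" for k using xc by (auto simp: hcircle_def)
  have side: "hdist (x (k - 1)) (x k) = d $ e k" if "k \<in> {1..<?n}" for k
  proof (rule sinj)
    have eq: "tt k = tt (k - 1) + 2 * a (e k)" using step[of "k - 1"] that by simp
    have "k - 1 < ?n" "k < ?n" using that by auto
    then have "2 * a (e k) \<le> 2 * pi" using eq bound(1)[of k] bound(2)[of "k - 1"] by linarith
    then show "sinh (hdist (x (k - 1)) (x k) / 2) = sinh (d $ e k / 2)"
      using sinh_half_hdist_circle[OF R, of "2 * a (e k)" "tt (k - 1)"] a(1)[of "e k"] a(3)[of "e k"] S
      unfolding x_def eq[symmetric] by simp
  qed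
  moreover have "hdist (x (?n - 1)) (x 0) = d $ e 0"
  proof (rule sinj)
    have "2 * a (e 0) \<le> 2 * pi" using last bound[of "?n - 1"] n by auto
    moreover have "x 0 = tanh R *\<^sub>R cis (tt (?n - 1) + 2 * a (e 0))" unfolding last by (simp add: x_def tt0)
    moreover have "x (?n - 1) = tanh R *\<^sub>R cis (tt (?n - 1))" by (simp only: x_def)
    ultimately show "sinh (hdist (x (?n - 1)) (x 0) / 2) = sinh (d $ e 0 / 2)"
      using sinh_half_hdist_circle[OF R, of "2 * a (e 0)" "tt (?n - 1)"] a(1)[of "e 0"] a(3)[of "e 0"] S
      by simp
  qed
  moreover have "x j \<notin> ccw_arc 0 R (x (k - 1)) (x k)" if k: "k \<in> {1..<?n}" and j: "j < ?n" "j \<noteq> k" for k j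
  proof -
    have k': "k - 1 < ?n" "k < ?n" "tt (k - 1) < tt k" using k mono[of "k - 1" k] by auto
    \<comment> \<open>Counted from vertex k - 1, that vertex itself has argument 0, which the arc
      excludes; every other j lies beyond vertex k, an earlier one after a wrap by 2 pi.\<close>
    consider "j = k - 1" | "j < k - 1" | "k < j" using j k by fastforce
    then show ?thesis
    proof cases
      case 1
      then show ?thesis using arg[OF j(1) k'(1)] by (simp add: ccw_arc_def)
    next
      case 2
      then have "tt j < tt (k - 1)" using mono by simp
      then show ?thesis using arg[OF j(1) k'(1)] arg[OF k'(2,1)] k'(3) bound[OF k'(2)] bound[OF j(1)] by (simp add: ccw_arc_def)
    next
      case 3
      then have "tt k < tt j" using mono by simp
      then show ?thesis using arg[OF j(1) k'(1)] arg[OF k'(2,1)] k'(3) by (simp add: ccw_arc_def)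
    qed
  qed
  moreover have "(0::complex) \<in> hyp_plane" by (simp add: hyp_plane_def)
  ultimately have "cyclic_ngon e d 0 R x"
    unfolding cyclic_ngon_def using R xc by blast
  then show ?thesis by (auto simp: R_def)
qed

text \<open>The image of a hull under an isometry is handled as a preimage under the inverse map,
  which may contain points outside the disc; the density vanishes there.\<close>

lemma emeasure_hmeasure_Int_hyp_plane:
  assumes "A \<in> sets borel"
  shows "emeasure hmeasure (A \<inter> hyp_plane) = emeasure hmeasure A"
proof -
  have "A \<inter> hyp_plane \<in> sets borel" using assms by (simp add: hyp_plane_def)
  then show ?thesis unfolding emeasure_hmeasure[OF assms] emeasure_hmeasure
    by (subst emeasure_hmeasure) (auto intro!: nn_integral_cong simp: klein_density_def indicator_def)
qed

text \<open>A rotation brings the centre to the nonnegative real axis and a boost takes it from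
  there to 0. Sides, arcs and area are invariant, which reduces the claim to
  \<open>polygon_centred_imp_inscribed\<close>.\<close>

lemma cyclic_ngon_imp_inscribed:
  fixes e :: "nat \<Rightarrow> 'n::finite" and d :: "real ^ 'n"
  assumes n: "3 \<le> CARD('n)" and e: "bij_betw e {..<CARD('n)} UNIV" and d: "\<And>i. 0 < d $ i"
    and ngon: "cyclic_ngon e d c R x"
  shows "\<exists>a. inscribed (\<lambda>i. sinh (d $ i / 2)) (sinh R) a \<and>
     measure hmeasure (hconvex hull (x ` {..<CARD('n)})) = (\<Sum>i\<in>UNIV. tri_area (cosh R) (a i))"
proof -
  let ?n = "CARD('n)"
  have c: "c \<in> hyp_plane" and R: "0 < R" and circ: "\<And>i. i < ?n \<Longrightarrow> x i \<in> hcircle c R"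
    and arcs: "\<And>i. i \<in> {1..<?n} \<Longrightarrow> x 0 \<notin> ccw_arc c R (x (i - 1)) (x i)"
    and sides: "\<And>i. i \<in> {1..<?n} \<Longrightarrow> hdist (x (i - 1)) (x i) = d $ e i" "hdist (x (?n - 1)) (x 0) = d $ e 0"
    using ngon n unfolding cyclic_ngon_def by auto
  define t where "t = cmod c"
  define u where "u = cis (- Arg2pi c)"
  have t: "\<bar>t\<bar> < 1" using c by (simp add: t_def hyp_plane_def)
  have u: "cmod u = 1" by (simp add: u_def)
  have uc: "u * c = of_real t"
    by (subst Arg2pi_polar[of c]) (simp add: u_def t_def cis_mult)
  define T where "T = boost t \<circ> (\<lambda>z. u * z)"
  define T' where "T' = (\<lambda>z. cnj u * z) \<circ> boost (- t)"
  have iso: "hisometry T T'"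
    unfolding T_def T'_def by (rule hisometry_compose[OF hisometry_rotation[OF u] hisometry_boost[OF t]])
  have Tc: "T c = 0" by (simp add: T_def uc boost_def complex_eq_iff)
  have D: "x i \<in> hyp_plane" "hdist c (x i) = R" if "i < ?n" for i
    using circ[OF that] by (auto simp: hcircle_def)
  have TD: "T z \<in> hyp_plane" if "z \<in> hyp_plane" for z using iso that by (simp add: hisometry_def)
  have Tdist: "hdist (T z) (T w) = hdist z w" if "z \<in> hyp_plane" "w \<in> hyp_plane" for z w
    using iso that by (simp add: hisometry_def)
  have uD: "u * x i \<in> hyp_plane" "u * x i \<noteq> of_real t" if "i < ?n" for i
  proof -
    show "u * x i \<in> hyp_plane" using D(1)[OF that] u by (simp add: hyp_plane_def norm_mult)
    have "hdist c c = 0" using hdist_eq_iff[OF c c, of 0] c by (simp add: klein_cosh_def dot_square_norm hyp_plane_iff)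
    then have "x i \<noteq> c" using D(2)[OF that] R by auto
    moreover have "u \<noteq> 0" using u by auto
    ultimately show "u * x i \<noteq> of_real t" unfolding uc[symmetric] by simp
  qed
  have "T (x i) \<in> hcircle 0 R" if "i < ?n" for i
    using Tdist[OF c D(1)[OF that]] D[OF that] TD Tc by (simp add: hcircle_def)
  moreover have "T (x 0) \<notin> ccw_arc 0 R (T (x (i - 1))) (T (x i))" if i: "i \<in> {1..<?n}" for i
  proof -
    have i': "0 < ?n" "i - 1 < ?n" "i < ?n" using i by auto
    have "T (x 0) \<in> ccw_arc 0 R (T (x (i - 1))) (T (x i)) \<longleftrightarrow> u * x 0 \<in> ccw_arc (u * c) R (u * x (i - 1)) (u * x i)"
      unfolding T_def comp_def uc using uD[OF i'(1)] uD[OF i'(2)] uD[OF i'(3)] by (intro ccw_arc_boost[OF t])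
    also have "\<dots> \<longleftrightarrow> x 0 \<in> ccw_arc c R (x (i - 1)) (x i)"
      by (rule ccw_arc_rotation[OF u c D(1)[OF i'(1)]])
    finally show ?thesis using arcs[OF i] by simp
  qed
  moreover have "hdist (T (x (i - 1))) (T (x i)) = d $ e i" if i: "i \<in> {1..<?n}" for i
    using Tdist[OF D(1) D(1), of "i - 1" i] sides(1)[OF i] i by auto
  moreover have "hdist (T (x (?n - 1))) (T (x 0)) = d $ e 0"
    using Tdist[OF D(1) D(1), of "?n - 1" 0] sides(2) n by auto
  ultimately obtain a where a: "inscribed (\<lambda>i. sinh (d $ i / 2)) (sinh R) a"
     "measure hmeasure (convex hull ((\<lambda>i. T (x i)) ` {..<?n})) = (\<Sum>i\<in>UNIV. tri_area (cosh R) (a i))"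
    using polygon_centred_imp_inscribed[OF refl n e d R, of "\<lambda>i. T (x i)"] by blast
  have X: "x ` {..<?n} \<subseteq> hyp_plane" using D by auto
  define H where "H = convex hull (x ` {..<?n})"
  have HD: "H \<subseteq> hyp_plane" using convex_hull_subset_hyp_plane[OF X] by (simp add: H_def)
  have H: "H \<in> sets borel" unfolding H_def
    by (intro borel_compact finite_imp_compact_convex_hull) auto
  have uH: "(\<lambda>z. cnj u * z) -` H \<in> sets borel"
    using measurable_sets[OF _ H, of "\<lambda>z. cnj u * z" borel] by simp
  have T'H: "T' -` H = boost (- t) -` ((\<lambda>z. cnj u * z) -` H)" by (auto simp: T'_def)
  have T'Hb: "T' -` H \<in> sets borel" unfolding T'H using measurable_sets[OF borel_measurable_boost uH, of "- t"] by simp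
  have "(\<lambda>i. T (x i)) ` {..<?n} = T ` x ` {..<?n}" by (simp add: image_image)
  then have "convex hull ((\<lambda>i. T (x i)) ` {..<?n}) = T ` H"
    unfolding H_def using hisometry_convex_hull[OF iso X] by simp
  also have "\<dots> = T' -` H \<inter> hyp_plane"
    using iso HD unfolding hisometry_def by (auto simp: image_iff) (metis subsetD)+
  finally have "emeasure hmeasure (convex hull ((\<lambda>i. T (x i)) ` {..<?n})) = emeasure hmeasure (T' -` H)"
    using emeasure_hmeasure_Int_hyp_plane[OF T'Hb] by simp
  also have "\<dots> = emeasure hmeasure ((\<lambda>z. cnj u * z) -` H)"
    unfolding T'H using t by (intro hmeasure_boost[OF uH]) simp
  also have "\<dots> = emeasure hmeasure H" using u by (intro hmeasure_rotation[OF H]) simp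
  finally have "measure hmeasure H = (\<Sum>i\<in>UNIV. tri_area (cosh R) (a i))" using a(2) by (simp add: measure_def)
  then show ?thesis using a(1) hconvex_hull_eq[OF X] by (auto simp: H_def)
qed

section \<open>Circumradius, area and symmetry\<close>

lemma cosh_eq_sqrt: "cosh (x::real) = sqrt (1 + (sinh x)\<^sup>2)"
  using cosh_square_eq[of x] by (metis add.commute cosh_real_nonneg real_sqrt_unique)

text \<open>One polygon, centred at 0, comes from \<open>inscribed_imp_polygon\<close>. Any other,
  wherever its centre lies, has the same radius and angles by \<open>inscribed_unique\<close>, so
  both definite descriptions are resolved.\<close>

lemma
  fixes e :: "nat \<Rightarrow> 'n::finite" and d :: "real ^ 'n"
  assumes n: "3 \<le> CARD('n)" and e: "bij_betw e {..<CARD('n)} UNIV" and d: "d \<in> AC_set"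
  shows circumradius_eq: "circumradius e d = arsinh (sinh_radius d)"
    and D0_eq: "D0 e d = area_fun d"
proof -
  have i: "inscribed (\<lambda>i. sinh (d $ i / 2)) (sinh_radius d) (half_angle d)" by (rule inscribed_AC[OF n d])
  have dp: "0 < d $ i" for i using d by (simp add: AC_set_def)
  obtain x where x: "cyclic_ngon e d 0 (arsinh (sinh_radius d)) x" using inscribed_imp_polygon[OF n e dp i] by blast
  have u: "r = arsinh (sinh_radius d) \<and> measure hmeasure (hconvex hull (x ` {..<CARD('n)})) = area_fun d"
    if ngon: "cyclic_ngon e d c r x" for c r x
  proof -
    obtain a where a: "inscribed (\<lambda>i. sinh (d $ i / 2)) (sinh r) a"
      "measure hmeasure (hconvex hull (x ` {..<CARD('n)})) = (\<Sum>i\<in>UNIV. tri_area (cosh r) (a i))"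
      using cyclic_ngon_imp_inscribed[OF n e dp ngon] by blast
    have "sinh r = sinh_radius d" "a = half_angle d" using inscribed_unique[OF n a(1) i] by auto
    moreover have "r = arsinh (sinh r)" by (simp add: arsinh_sinh_real)
    ultimately show ?thesis using a(2) by (simp add: area_fun_def cosh_eq_sqrt)
  qed
  show "circumradius e d = arsinh (sinh_radius d)"
    unfolding circumradius_def using u x by (intro the_equality) blast+
  show "D0 e d = area_fun d"
    unfolding D0_def using u x by (intro the_equality) metis+
qed

lemma permuted_AC:
  fixes d :: "real ^ 'n::finite" and p :: "'n \<Rightarrow> 'n"
  assumes d: "d \<in> AC_set" and p: "bij p"
  shows "(\<chi> i. d $ p i) \<in> AC_set"
proof -
  have "(\<Sum>j\<in>UNIV. sinh (d $ p j / 2)) = (\<Sum>j\<in>UNIV. sinh (d $ j / 2))"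
    using sum.reindex_bij_betw[OF p, of "\<lambda>j. sinh (d $ j / 2)"] .
  then show ?thesis using d by (simp add: AC_set_def sum_diff1)
qed

text \<open>The permuted angles solve the permuted problem with the same radius, so by uniqueness
  they are its angles.\<close>

lemma area_fun_permuted:
  fixes d :: "real ^ 'n::finite" and p :: "'n \<Rightarrow> 'n"
  assumes n: "3 \<le> CARD('n)" and d: "d \<in> AC_set" and p: "bij p"
  shows "area_fun (\<chi> i. d $ p i) = area_fun d"
proof -
  let ?d = "\<chi> i. d $ p i"
  have "(\<Sum>j\<in>UNIV. half_angle d (p j)) = (\<Sum>j\<in>UNIV. half_angle d j)"
    using sum.reindex_bij_betw[OF p, of "half_angle d"] .
  then have "inscribed (\<lambda>i. sinh (?d $ i / 2)) (sinh_radius d) (\<lambda>i. half_angle d (p i))"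
    using inscribed_AC[OF n d] by (simp add: inscribed_def)
  from inscribed_unique[OF n this inscribed_AC[OF n permuted_AC[OF d p]]]
  have "sinh_radius ?d = sinh_radius d" "half_angle ?d = (\<lambda>i. half_angle d (p i))" by auto
  then show ?thesis unfolding area_fun_def
    using sum.reindex_bij_betw[OF p, of "\<lambda>i. tri_area (sqrt (1 + (sinh_radius d)\<^sup>2)) (half_angle d i)"] by simp
qed

lemma C_set_iff:
  fixes d :: "real ^ 'n::finite"
  assumes "\<And>i. 0 < d $ i" "d $ m = maxside d"
  shows "d \<in> C_set \<longleftrightarrow> pi < (\<Sum>i\<in>UNIV. arcsin (sinh (d $ i / 2) / sinh (d $ m / 2)))"
  using assms by (simp add: C_set_def theta_def sum_distrib_left[symmetric])

text \<open>A half angle that is not acute can occur only at a longest side, and by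
  \<open>inscribed_max_acute_iff\<close> it does so exactly outside \<open>C_set\<close>.\<close>

lemma cos_half_angle_sign:
  fixes d :: "real ^ 'n::finite"
  assumes n: "3 \<le> CARD('n)" and d: "d \<in> AC_set"
  shows "if d \<in> AC_set - C_set \<and> d $ i = maxside d then cos (half_angle d i) \<le> 0 else 0 \<le> cos (half_angle d i)"
proof -
  have ins: "inscribed (\<lambda>i. sinh (d $ i / 2)) (sinh_radius d) (half_angle d)" by (rule inscribed_AC[OF n d])
  have dp: "0 < d $ i" for i using d by (simp add: AC_set_def)
  have a: "0 < half_angle d i" "half_angle d i < pi" for i
    using ins angle_less_pi[OF n, of "half_angle d"] by (auto simp: inscribed_def)
  have le: "d $ j \<le> maxside d" for j by (simp add: maxside_def)
  have "maxside d \<in> range (\<lambda>i. d $ i)" unfolding maxside_def by (intro Max_in) auto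
  then obtain m where m: "d $ m = maxside d" by (metis imageE)
  show ?thesis
  proof (cases "d \<in> AC_set - C_set \<and> d $ i = maxside d")
    case True
    have "sinh (d $ j / 2) \<le> sinh (d $ i / 2)" for j using le[of j] True by simp
    from inscribed_max_acute_iff[OF n ins this] have "\<not> half_angle d i < pi / 2"
      using C_set_iff[OF dp, of i] True by simp
    then have "cos (half_angle d i) \<le> cos (pi / 2)" using a[of i] by (intro cos_monotone_0_pi_le) auto
    then show ?thesis using True by simp
  next
    case False
    have "half_angle d i < pi / 2"
    proof (cases "i = m")
      case True
      have "sinh (d $ j / 2) \<le> sinh (d $ m / 2)" for j using le[of j] m by simp
      from inscribed_max_acute_iff[OF n ins this] show ?thesis
        using C_set_iff[OF dp m] False True m d by simp
    next
      case False
      have "sinh (d $ i / 2) \<le> sinh (d $ m / 2)" using le[of i] m by simp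
      from inscribed_nonmax_acute[OF n ins this False] show ?thesis .
    qed
    then show ?thesis using False a(1)[of i] cos_gt_zero[of "half_angle d i"] by simp
  qed
qed

theorem proposition2p3:
  fixes e :: "nat \<Rightarrow> 'n::finite"
  assumes "CARD('n) \<ge> 3"
    and "bij_betw e {..<CARD('n)} (UNIV :: 'n set)"
  shows "(\<forall>d\<in>AC_set. D0 e d > 0) \<and>
    smooth_on AC_set (D0 e) \<and>
    (\<forall>d\<in>AC_set. \<forall>p :: 'n \<Rightarrow> 'n. bij p \<longrightarrow> D0 e (\<chi> i. d $ p i) = D0 e d) \<and>
    (\<forall>d\<in>AC_set. \<forall>i.
      ((\<lambda>t. D0 e (\<chi> j. if j = i then t else d $ j)) has_real_derivative
        (if d \<in> AC_set - C_set \<and> d $ i = maxside d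
         then - sqrt (1 / (cosh (d $ i / 2))\<^sup>2 - 1 / (cosh (circumradius e d))\<^sup>2)
         else sqrt (1 / (cosh (d $ i / 2))\<^sup>2 - 1 / (cosh (circumradius e d))\<^sup>2)))
      (at (d $ i)))"
proof (intro conjI ballI allI impI)
  note n = assms(1) and D0 = D0_eq[OF assms]
  fix d :: "real ^ 'n" assume d: "d \<in> AC_set"
  have ins: "inscribed (\<lambda>i. sinh (d $ i / 2)) (sinh_radius d) (half_angle d)" by (rule inscribed_AC[OF n d])
  then have S: "0 < sinh_radius d" by (simp add: inscribed_def)
  then have "1 < sqrt (1 + (sinh_radius d)\<^sup>2)" by simp
  then show "0 < D0 e d"
    unfolding D0[OF d] area_fun_def using ins by (intro sum_tri_area_pos[OF n]) (auto simp: inscribed_def)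
  show "D0 e (\<chi> i. d $ p i) = D0 e d" if "bij p" for p
    unfolding D0[OF d] D0[OF permuted_AC[OF d that]] by (rule area_fun_permuted[OF n d that])
  fix i
  define g where "g = (\<lambda>j. sinh_radius d * cos (half_angle d j) / (sqrt (1 + (sinh_radius d)\<^sup>2) * cosh (d $ j / 2)))"
  let ?line = "\<lambda>t. \<chi> j. if j = i then t else d $ j"
  have "(area_fun has_derivative (\<lambda>v. \<Sum>j\<in>UNIV. g j * v $ j)) (at d)"
    using area_fun_has_derivative[OF n d] by (simp add: g_def)
  \<comment> \<open>\<open>D0\<close> is known to equal \<open>area_fun\<close> on
    \<open>AC_set\<close> only; openness of that set carries the derivative over.\<close>
  then have der: "(D0 e has_derivative (\<lambda>v. \<Sum>j\<in>UNIV. g j * v $ j)) (at d)"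
    by (rule has_derivative_transform_within_open[OF _ open_AC d]) (simp add: D0)
  have 1: "(?line has_derivative (\<lambda>t. \<chi> j. if j = i then t else 0)) (at (d $ i))"
  proof (rule has_derivative_vec)
    fix k show "((\<lambda>t. ?line t $ k) has_derivative (\<lambda>t. (\<chi> j. if j = i then t else 0) $ k)) (at (d $ i))"
      by (cases "k = i") auto
  qed
  have "?line (d $ i) = d" by (simp add: vec_eq_iff)
  then have 2: "(D0 e has_derivative (\<lambda>v. \<Sum>j\<in>UNIV. g j * v $ j)) (at (?line (d $ i)))" using der by simp
  have "((\<lambda>t. D0 e (?line t)) has_derivative (\<lambda>t. \<Sum>j\<in>UNIV. g j * (\<chi> j. if j = i then t else 0) $ j)) (at (d $ i))"
    by (rule has_derivative_compose[OF 1 2])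
  also have "(\<lambda>t. \<Sum>j\<in>UNIV. g j * (\<chi> j. if j = i then t else 0) $ j) = (*) (g i)"
    by (simp add: fun_eq_iff if_distrib[of "(*) _"] cong: if_cong)
  finally have line_der: "((\<lambda>t. D0 e (?line t)) has_real_derivative g i) (at (d $ i))"
    by (simp add: has_field_derivative_def)
  define h where "h = cosh (d $ i / 2)"
  define c where "c = sqrt (1 + (sinh_radius d)\<^sup>2)"
  have c: "0 < c" "c\<^sup>2 = 1 + (sinh_radius d)\<^sup>2" by (auto simp: c_def add_pos_nonneg)
  have h: "0 < h" "h\<^sup>2 = 1 + (sinh_radius d * sin (half_angle d i))\<^sup>2"
    using ins by (auto simp: h_def cosh_square_eq inscribed_def)
  have "cosh (circumradius e d) = c"
    unfolding circumradius_eq[OF assms d] cosh_eq_sqrt c_def by simp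
  \<comment> \<open>Hence the square root in the claim is the absolute value of the partial
    derivative \<open>g i\<close>, and the sign of the cosine decides between the two cases.\<close>
  moreover have "1 / h\<^sup>2 - 1 / c\<^sup>2 = (sinh_radius d * cos (half_angle d i) / (c * h))\<^sup>2"
  proof -
    have "1 / h\<^sup>2 - 1 / c\<^sup>2 = (c\<^sup>2 - h\<^sup>2) / (c * h)\<^sup>2"
      using c(1) h(1) by (simp add: field_simps)
    also have "c\<^sup>2 - h\<^sup>2 = (sinh_radius d * cos (half_angle d i))\<^sup>2"
      unfolding c h by (simp add: cos_squared_eq power_mult_distrib algebra_simps)
    finally show ?thesis by (simp add: power_divide)
  qed
  ultimately have sq: "sqrt (1 / (cosh (d $ i / 2))\<^sup>2 - 1 / (cosh (circumradius e d))\<^sup>2) = \<bar>g i\<bar>"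
    by (simp add: g_def h_def c_def)
  have "0 \<le> g i \<longleftrightarrow> 0 \<le> cos (half_angle d i)" "g i \<le> 0 \<longleftrightarrow> cos (half_angle d i) \<le> 0"
    using c h S by (auto simp: g_def c_def[symmetric] h_def[symmetric] zero_le_divide_iff divide_le_0_iff zero_le_mult_iff mult_le_0_iff)
  then have "g i = (if d \<in> AC_set - C_set \<and> d $ i = maxside d then - \<bar>g i\<bar> else \<bar>g i\<bar>)"
    using cos_half_angle_sign[OF n d, of i] by (auto split: if_splits)
  then show "((\<lambda>t. D0 e (?line t)) has_real_derivative
        (if d \<in> AC_set - C_set \<and> d $ i = maxside d
         then - sqrt (1 / (cosh (d $ i / 2))\<^sup>2 - 1 / (cosh (circumradius e d))\<^sup>2)
         else sqrt (1 / (cosh (d $ i / 2))\<^sup>2 - 1 / (cosh (circumradius e d))\<^sup>2)))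
      (at (d $ i))"
    unfolding sq using line_der by simp
next
  show "smooth_on AC_set (D0 e)"
    unfolding smooth_on_def
    using Ck_on_cong[OF open_AC _ Ck_on_area_fun[OF assms(1)]] D0_eq[OF assms] by metis
qed

end
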